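(* Let $M$ be a compact smooth manifold, let $\Phi\in C^\infty(\mathbb R,\mathbb R_{>0})$, and consider on $\mathcal M(M)$ the Riemannian metric $$G_g(h,k)=\int_M\Phi(\operatorname{Scal}(g))\,g^0_2(h,k)\operatorname{vol}(g).$$ If $M$ admits a metric $g_0$ satisfying the Einstein equation $\operatorname{Ricci}(g_0)=\lambda g_0$ for some constant $\lambda\in\mathbb R$, and if $\Phi(u)\le C(1+|u|^{2k})$ for constants $C$ and $k<\dim(M)/8$, then $(\mathcal M(M),G)$ is geodesically incomplete.
   Context: $\mathcal M(M)=\Gamma(S^2_+T^*M)$ is the space of all smooth Riemannian metrics on $M$, an open convex subset of the Fréchet space $\Gamma(S^2T^*M)$ of smooth symmetric $\binom02$-tensor fields. For symmetric $h,k$: $g^0_2(h,k)=\operatorname{Tr}(g^{-1}hg^{-1}k)$; $\operatorname{vol}(g)$ is the volume density; $\operatorname{Ricci}$ and $\operatorname{Scal}=\operatorname{Tr}^g(\operatorname{Ricci})$ are the Ricci tensor and the scalar curvature. Geodesics are those of the (weak) Riemannian metric $G$ on $\mathcal M(M)$ (critical points of the energy $\frac12\int G_g(g_t,g_t)\,dt$ with fixed endpoints). Geodesically incomplete means that some geodesic cannot be extended to all times. *)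

theory Defs
  imports "HOL-Analysis.Analysis"
begin

section \<open>Smooth maps between Euclidean spaces\<close>

text \<open>Only meant for open sets \<open>S\<close>.\<close>

primrec Ck_on :: "nat \<Rightarrow> 'a::euclidean_space set \<Rightarrow> ('a \<Rightarrow> 'b::real_normed_vector) \<Rightarrow> bool" where
  "Ck_on 0 S f \<longleftrightarrow> continuous_on S f"
| "Ck_on (Suc k) S f \<longleftrightarrow>
     (\<forall>x\<in>S. f differentiable (at x)) \<and> (\<forall>v. Ck_on k S (\<lambda>x. frechet_derivative f (at x) v))"

definition smooth_on :: "'a::euclidean_space set \<Rightarrow> ('a \<Rightarrow> 'b::real_normed_vector) \<Rightarrow> bool" where
  "smooth_on S f \<longleftrightarrow> (\<forall>k. Ck_on k S f)"

definition partial :: "'n::finite \<Rightarrow> (real^'n \<Rightarrow> real) \<Rightarrow> real^'n \<Rightarrow> real" where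
  "partial i f x = frechet_derivative f (at x) (axis i 1)"


section \<open>Compact smooth manifolds\<close>

text \<open>The manifold is the whole type \<open>'m\<close>, of dimension \<open>CARD('n) \<ge> 1\<close>, nonempty and without
  boundary. It carries a smooth structure given by some (not necessarily maximal) smooth atlas.
  A chart is a pair of its open domain and the coordinate map; the values of the coordinate map
  outside the domain are irrelevant. Second countability follows from compactness.\<close>

type_synonym ('m, 'n) chart = "'m set \<times> ('m \<Rightarrow> real^'n)"

abbreviation dom_c :: "('m, 'n::finite) chart \<Rightarrow> 'm set" where
  "dom_c c \<equiv> fst c"

abbreviation coord :: "('m, 'n::finite) chart \<Rightarrow> 'm \<Rightarrow> real^'n" where
  "coord c \<equiv> snd c"

definition img_c :: "('m, 'n::finite) chart \<Rightarrow> (real^'n) set" where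
  "img_c c = coord c ` dom_c c"

definition point :: "('m, 'n::finite) chart \<Rightarrow> real^'n \<Rightarrow> 'm" where
  "point c = inv_into (dom_c c) (coord c)"

definition smooth_atlas :: "('m::t2_space, 'n::finite) chart set \<Rightarrow> bool" where
  "smooth_atlas A \<longleftrightarrow>
     (\<Union>c\<in>A. dom_c c) = UNIV \<and>
     (\<forall>c\<in>A. open (dom_c c) \<and> open (img_c c) \<and>
        homeomorphism (dom_c c) (img_c c) (coord c) (point c)) \<and>
     (\<forall>c\<in>A. \<forall>d\<in>A. smooth_on (coord c ` (dom_c c \<inter> dom_c d)) (coord d \<circ> point c))"

definition compact_smooth_manifold :: "('m::t2_space, 'n::finite) chart set \<Rightarrow> bool" where
  "compact_smooth_manifold A \<longleftrightarrow> compact (UNIV :: 'm set) \<and> smooth_atlas A"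

text \<open>Functions on the manifold that are defined by a coordinate-invariant local formula are
  evaluated in an arbitrary chart around the point.\<close>

definition chart_at :: "('m, 'n::finite) chart set \<Rightarrow> 'm \<Rightarrow> ('m, 'n) chart" where
  "chart_at A p = (SOME c. c \<in> A \<and> p \<in> dom_c c)"


section \<open>Symmetric tensor fields and Riemannian metrics\<close>

text \<open>A \<open>(0,2)\<close>-tensor field is given by its component matrices \<open>h c p\<close>, with entries
  \<open>h(\<partial>\<^sub>i, \<partial>\<^sub>j)\<close> at the point \<open>p\<close> in the coordinate frame of the chart \<open>c\<close>, subject to the
  transformation law. Setting the components to zero where they have no meaning makes
  the representation unique.\<close>

type_synonym ('m, 'n) tensor = "('m, 'n) chart \<Rightarrow> 'm \<Rightarrow> real^'n^'n"

definition jacobian :: "('m, 'n::finite) chart \<Rightarrow> ('m, 'n) chart \<Rightarrow> 'm \<Rightarrow> real^'n^'n" where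
  "jacobian c d p = matrix (frechet_derivative (coord d \<circ> point c) (at (coord c p)))"

definition sym_tensor_field ::
    "('m::t2_space, 'n::finite) chart set \<Rightarrow> ('m, 'n) tensor \<Rightarrow> bool" where
  "sym_tensor_field A h \<longleftrightarrow>
     (\<forall>c\<in>A. smooth_on (img_c c) (\<lambda>x. h c (point c x))) \<and>
     (\<forall>c\<in>A. \<forall>p\<in>dom_c c. transpose (h c p) = h c p) \<and>
     (\<forall>c\<in>A. \<forall>d\<in>A. \<forall>p\<in>dom_c c \<inter> dom_c d.
        h c p = transpose (jacobian c d p) ** h d p ** jacobian c d p) \<and>
     (\<forall>c p. \<not> (c \<in> A \<and> p \<in> dom_c c) \<longrightarrow> h c p = 0)"

text \<open>The set of all smooth Riemannian metrics.\<close>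

definition Met :: "('m::t2_space, 'n::finite) chart set \<Rightarrow> ('m, 'n) tensor set" where
  "Met A = {g. sym_tensor_field A g \<and>
     (\<forall>c\<in>A. \<forall>p\<in>dom_c c. \<forall>v. v \<noteq> 0 \<longrightarrow> v \<bullet> (g c p *v v) > 0)}"


section \<open>Curvature\<close>

text \<open>\<open>christoffel g c k i j\<close> is \<open>\<Gamma>\<^sup>k\<^sub>i\<^sub>j\<close> of the Levi-Civita connection, as a function of the
  coordinates. \<open>riemann g c l k i j\<close> is the component \<open>R\<^sup>l\<^sub>k\<^sub>i\<^sub>j\<close> in
  \<open>R(\<partial>\<^sub>i, \<partial>\<^sub>j) \<partial>\<^sub>k = R\<^sup>l\<^sub>k\<^sub>i\<^sub>j \<partial>\<^sub>l\<close>, and \<open>Ricci(Y, Z) = Tr (X \<mapsto> R(X, Y) Z)\<close>;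
  round spheres have positive Ricci curvature.\<close>

definition entry :: "('m, 'n::finite) tensor \<Rightarrow> ('m, 'n) chart \<Rightarrow> 'n \<Rightarrow> 'n \<Rightarrow> real^'n \<Rightarrow> real" where
  "entry g c i j x = g c (point c x) $ i $ j"

definition christoffel ::
    "('m, 'n::finite) tensor \<Rightarrow> ('m, 'n) chart \<Rightarrow> 'n \<Rightarrow> 'n \<Rightarrow> 'n \<Rightarrow> real^'n \<Rightarrow> real" where
  "christoffel g c k i j x =
     (1/2) * (\<Sum>l\<in>UNIV. matrix_inv (g c (point c x)) $ k $ l *
       (partial i (entry g c j l) x + partial j (entry g c i l) x - partial l (entry g c i j) x))"

definition riemann ::
    "('m, 'n::finite) tensor \<Rightarrow> ('m, 'n) chart \<Rightarrow> 'n \<Rightarrow> 'n \<Rightarrow> 'n \<Rightarrow> 'n \<Rightarrow> real^'n \<Rightarrow> real" where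
  "riemann g c l k i j x =
     partial i (christoffel g c l j k) x - partial j (christoffel g c l i k) x +
     (\<Sum>m\<in>UNIV. christoffel g c l i m x * christoffel g c m j k x -
                 christoffel g c l j m x * christoffel g c m i k x)"

definition ricci :: "('m, 'n::finite) tensor \<Rightarrow> ('m, 'n) chart \<Rightarrow> 'm \<Rightarrow> real^'n^'n" where
  "ricci g c p = (\<chi> j k. \<Sum>i\<in>UNIV. riemann g c i k i j (coord c p))"

definition scal :: "('m, 'n::finite) chart set \<Rightarrow> ('m, 'n) tensor \<Rightarrow> 'm \<Rightarrow> real" where
  "scal A g p = (let c = chart_at A p in trace (matrix_inv (g c p) ** ricci g c p))"

definition einstein_metric ::
    "('m::t2_space, 'n::finite) chart set \<Rightarrow> real \<Rightarrow> ('m, 'n) tensor \<Rightarrow> bool" where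
  "einstein_metric A l g \<longleftrightarrow>
     g \<in> Met A \<and> (\<forall>c\<in>A. \<forall>p\<in>dom_c c. ricci g c p = l *\<^sub>R g c p)"


section \<open>The weak Riemannian metric on the space of metrics\<close>

definition g02 ::
    "('m, 'n::finite) chart set \<Rightarrow> ('m, 'n) tensor \<Rightarrow> ('m, 'n) tensor \<Rightarrow> ('m, 'n) tensor \<Rightarrow> 'm \<Rightarrow> real"
  where
  "g02 A g h k p = (let c = chart_at A p in
     trace (matrix_inv (g c p) ** h c p ** matrix_inv (g c p) ** k c p))"

text \<open>The volume density as a measure: the unique Borel measure that is given by
  \<open>sqrt (det g\<^sub>i\<^sub>j) dx\<close> in every chart. No orientation is needed.\<close>

definition is_volume ::
    "('m::t2_space, 'n::finite) chart set \<Rightarrow> ('m, 'n) tensor \<Rightarrow> 'm measure \<Rightarrow> bool" where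
  "is_volume A g \<mu> \<longleftrightarrow> sets \<mu> = sets borel \<and>
     (\<forall>c\<in>A. \<forall>B\<in>sets borel. B \<subseteq> dom_c c \<longrightarrow>
        emeasure \<mu> B =
          (\<integral>\<^sup>+ x\<in>coord c ` B. ennreal (sqrt (det (g c (point c x)))) \<partial>lborel))"

definition vol :: "('m::t2_space, 'n::finite) chart set \<Rightarrow> ('m, 'n) tensor \<Rightarrow> 'm measure" where
  "vol A g = (SOME \<mu>. is_volume A g \<mu>)"

text \<open>A (weak) Riemannian metric on the space of metrics is represented as a function
  \<open>G g h k\<close> of the foot point \<open>g\<close> and the tangent vectors \<open>h\<close>, \<open>k\<close>.\<close>

type_synonym ('m, 'n) metric_on_Met =
  "('m, 'n) tensor \<Rightarrow> ('m, 'n) tensor \<Rightarrow> ('m, 'n) tensor \<Rightarrow> real"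

definition G_scal ::
    "('m::t2_space, 'n::finite) chart set \<Rightarrow> (real \<Rightarrow> real) \<Rightarrow> ('m, 'n) metric_on_Met" where
  "G_scal A \<Phi> g h k = (\<integral>p. \<Phi> (scal A g p) * g02 A g h k p \<partial>vol A g)"


section \<open>Geodesics\<close>

text \<open>A smooth family of metrics, with parameters in an open set \<open>P\<close> of a Euclidean space: since
  the manifold is compact, smoothness of a map from \<open>P\<close> into the Frechet space of smooth tensor
  fields means joint smoothness in the parameter and the point.\<close>

definition smooth_family :: "('m::t2_space, 'n::finite) chart set \<Rightarrow>
    'p::euclidean_space set \<Rightarrow> ('p \<Rightarrow> ('m, 'n) tensor) \<Rightarrow> bool" where
  "smooth_family A P \<gamma> \<longleftrightarrow>
     (\<forall>t\<in>P. \<gamma> t \<in> Met A) \<and>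
     (\<forall>c\<in>A. smooth_on (P \<times> img_c c) (\<lambda>(t, x). \<gamma> t c (point c x)))"

definition velocity :: "(real \<Rightarrow> ('m, 'n::finite) tensor) \<Rightarrow> real \<Rightarrow> ('m, 'n) tensor" where
  "velocity \<gamma> t c p = vector_derivative (\<lambda>s. \<gamma> s c p) (at t)"

definition energy :: "('m, 'n::finite) metric_on_Met \<Rightarrow> real \<Rightarrow> real \<Rightarrow>
    (real \<Rightarrow> ('m, 'n) tensor) \<Rightarrow> real" where
  "energy G a b \<gamma> = (1/2) * integral {a..b} (\<lambda>t. G (\<gamma> t) (velocity \<gamma> t) (velocity \<gamma> t))"

definition fixed_end_variation :: "('m::t2_space, 'n::finite) chart set \<Rightarrow> real set \<Rightarrow>
    real \<Rightarrow> real \<Rightarrow> real \<Rightarrow> (real \<Rightarrow> ('m, 'n) tensor) \<Rightarrow> (real \<Rightarrow> real \<Rightarrow> ('m, 'n) tensor) \<Rightarrow> bool" where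
  "fixed_end_variation A I a b \<epsilon> \<gamma> V \<longleftrightarrow>
     smooth_family A ({-\<epsilon><..<\<epsilon>} \<times> I) (\<lambda>(s, t). V s t) \<and>
     (\<forall>t\<in>I. V 0 t = \<gamma> t) \<and>
     (\<forall>s\<in>{-\<epsilon><..<\<epsilon>}. V s a = \<gamma> a \<and> V s b = \<gamma> b)"

text \<open>A geodesic on an open interval is a smooth curve whose restriction to each compact
  subinterval is a critical point of the energy with fixed endpoints.\<close>

definition geodesic :: "('m::t2_space, 'n::finite) chart set \<Rightarrow> ('m, 'n) metric_on_Met \<Rightarrow>
    real set \<Rightarrow> (real \<Rightarrow> ('m, 'n) tensor) \<Rightarrow> bool" where
  "geodesic A G I \<gamma> \<longleftrightarrow>
     smooth_family A I \<gamma> \<and>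
     (\<forall>a b \<epsilon> V. a < b \<and> {a..b} \<subseteq> I \<and> 0 < \<epsilon> \<and> fixed_end_variation A I a b \<epsilon> \<gamma> V \<longrightarrow>
        ((\<lambda>s. energy G a b (V s)) has_real_derivative 0) (at 0))"

definition geodesically_incomplete ::
    "('m::t2_space, 'n::finite) chart set \<Rightarrow> ('m, 'n) metric_on_Met \<Rightarrow> bool" where
  "geodesically_incomplete A G \<longleftrightarrow>
     (\<exists>I \<gamma>. open I \<and> is_interval I \<and> I \<noteq> {} \<and> geodesic A G I \<gamma> \<and>
        \<not> (\<exists>\<gamma>'. geodesic A G UNIV \<gamma>' \<and> (\<forall>t\<in>I. \<gamma>' t = \<gamma> t)))"

end

theory Submission
  imports Defs
begin

text \<open>
  The incomplete geodesic is the ray \<open>r(t) g\<^sub>0\<close> of constant multiples of the Einstein metric, run with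
  constant speed; it comes from \<open>r = 0\<close> in finite time.

  Along \<open>\<rho> g\<^sub>0\<close> the Ricci tensor stays \<open>\<Lambda> g\<^sub>0\<close>, so the scalar curvature is the constant \<open>n \<Lambda> / \<rho>\<close>, and
  the squared speed of \<open>r(t) g\<^sub>0\<close> is a constant times \<open>\<psi>(r) r'\<^sup>2\<close> with
  \<open>\<psi>(\<rho>) = \<Phi>(n \<Lambda> / \<rho>) \<rho>\<^bsup>n/2 - 2\<^esup>\<close> (\<open>ray_density\<close>). Let \<open>r\<close> satisfy \<open>\<psi>(r) r'\<^sup>2 = 1\<close>.

  It is a geodesic (\<open>ray_geodesic\<close>). Let \<open>h\<close> be a variation. The energy density depends on \<open>h\<close> through the
  scalar curvature, the speed and the volume. The last two contribute only the trace of \<open>h\<close> with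
  respect to \<open>g\<^sub>0\<close> and its time derivative, because the velocity of the ray is a multiple of the metric.
  The variation of the scalar curvature is a divergence minus the contraction of \<open>h\<close> with the Ricci tensor
  (\<open>palatini\<close>, \<open>scal_param_deriv\<close>). Its coefficient, which contains \<open>\<Phi>'\<close> at the scalar curvature, is
  constant on the manifold, so the divergence integrates to zero (\<open>first_variation\<close>); the Einstein equation
  turns the rest into the trace of \<open>h\<close> again. Hence the first variation of the energy depends on
  \<open>h\<close> only through the function \<open>\<tau>(t)\<close>, the integral of the trace of \<open>h\<close>, as if \<open>h\<close> were tangent to the
  ray (\<open>lagr_variation\<close>), and its integrand is the derivative of \<open>2 \<surd>\<psi>(r(t)) \<tau>(t)\<close>. This function
  vanishes at both ends, so the variation is zero (\<open>energy_variation_zero\<close>).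

  It is incomplete: by the growth condition \<open>\<surd>\<psi>(\<rho>)\<close> is bounded near \<open>0\<close> by a multiple of
  \<open>\<rho>\<^bsup>\<alpha> - 1\<^esup>\<close> with \<open>\<alpha> > 0\<close> (\<open>ray_density_bound\<close>), so the arc length of the ray down to \<open>r = 0\<close> is
  finite (\<open>unit_speed_parametrisation\<close>). A continuation of the geodesic would have the value \<open>0\<close> at the
  corresponding time, which is not a metric.

  The integrals over the manifold are computed in charts. The volume measure exists
  because the chart expressions agree on overlaps (\<open>is_volume_exists\<close>), and a finite partition of
  unity by functions supported in coordinate boxes reduces everything to integrals over boxes
  (\<open>integral_vol_partition\<close>), which can be differentiated under the integral sign.\<close>

section \<open>Calculus of smooth functions\<close>

lemma has_derivative_frechet:
  "f differentiable (at x) \<Longrightarrow> (f has_derivative frechet_derivative f (at x)) (at x)"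
  by (simp add: frechet_derivative_works)

lemma frechet_derivative_eqI: "(f has_derivative f') (at x) \<Longrightarrow> frechet_derivative f (at x) = f'"
  by (metis frechet_derivative_at)

lemma Ck_on_cong:
  assumes "open S" "\<And>x. x \<in> S \<Longrightarrow> f x = g x" "Ck_on k S f"
  shows "Ck_on k S g"
  using assms(2,3)
proof (induction k arbitrary: f g)
  case 0
  then show ?case by (auto cong: continuous_on_cong)
next
  case (Suc k)
  have d: "g differentiable (at x) \<and> frechet_derivative g (at x) = frechet_derivative f (at x)"
    if "x \<in> S" for x
  proof -
    have "(f has_derivative frechet_derivative f (at x)) (at x)"
      using Suc.prems(2) that by (simp add: has_derivative_frechet)
    then have "(g has_derivative frechet_derivative f (at x)) (at x)"
      using has_derivative_transform_within_open[OF _ \<open>open S\<close> that, of f _ UNIV g] Suc.prems(1) by auto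
    then show ?thesis by (auto simp: differentiable_def frechet_derivative_eqI)
  qed
  have "Ck_on k S (\<lambda>x. frechet_derivative g (at x) v)" for v
    by (rule Suc.IH[of "\<lambda>x. frechet_derivative f (at x) v"]) (use d Suc.prems(2) in auto)
  with d show ?case by auto
qed

lemma Ck_on_Suc_imp: "Ck_on (Suc k) S f \<Longrightarrow> Ck_on k S f"
proof (induction k arbitrary: f)
  case 0
  then have "f differentiable_on S"
    by (auto simp: differentiable_on_def intro: differentiable_at_withinI)
  then show ?case by (simp add: differentiable_imp_continuous_on)
next
  case (Suc k)
  then show ?case by (metis Ck_on.simps(2))
qed

lemma Ck_on_continuous: "Ck_on k S f \<Longrightarrow> continuous_on S f"
proof (induction k)
  case (Suc k)
  then show ?case using Ck_on_Suc_imp by blast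
qed simp

lemma Ck_on_const: "Ck_on k S (\<lambda>x. c)"
  by (induction k arbitrary: c) (auto simp: continuous_on_const)

lemma Ck_on_linear:
  fixes f :: "'a::euclidean_space \<Rightarrow> 'b::real_normed_vector" and L :: "'b \<Rightarrow> 'c::real_normed_vector"
  assumes "open S" "bounded_linear L" "Ck_on k S f"
  shows "Ck_on k S (\<lambda>x. L (f x))"
  using assms(3)
proof (induction k arbitrary: f)
  case 0
  then show ?case
    using bounded_linear.continuous_on[OF assms(2)] by auto
next
  case (Suc k)
  have d: "((\<lambda>x. L (f x)) has_derivative (\<lambda>v. L (frechet_derivative f (at x) v))) (at x)" if "x \<in> S" for x
    using bounded_linear.has_derivative[OF assms(2) has_derivative_frechet] Suc.prems that by auto
  have e: "frechet_derivative (\<lambda>x. L (f x)) (at x) v = L (frechet_derivative f (at x) v)" if "x \<in> S" for x v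
    using frechet_derivative_eqI[OF d[OF that]] by simp
  have "Ck_on k S (\<lambda>x. frechet_derivative (\<lambda>x. L (f x)) (at x) v)" for v
    by (rule Ck_on_cong[OF assms(1) e[symmetric]]) (use Suc in auto)
  with d show ?case by (auto simp: differentiable_def)
qed

lemma Ck_on_bounded_linear:
  assumes "open S" "bounded_linear L"
  shows "Ck_on k S L"
proof (cases k)
  case 0
  then show ?thesis using assms(2) by (simp add: linear_continuous_on)
next
  case (Suc j)
  have d: "(L has_derivative L) (at x)" for x
    using assms(2) bounded_linear_imp_has_derivative by blast
  have e: "frechet_derivative L (at x) = L" for x
    by (rule frechet_derivative_eqI[OF d])
  show ?thesis unfolding Suc
    using d by (auto simp: differentiable_def e intro!: Ck_on_const)
qed

lemma Ck_on_id: "open S \<Longrightarrow> Ck_on k S (\<lambda>x. x)"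
  by (rule Ck_on_bounded_linear) (auto simp: bounded_linear_ident)

lemma Ck_on_add:
  assumes "open S" "Ck_on k S f" "Ck_on k S g"
  shows "Ck_on k S (\<lambda>x. f x + g x)"
  using assms(2,3)
proof (induction k arbitrary: f g)
  case 0
  then show ?case by (auto intro: continuous_on_add)
next
  case (Suc k)
  have d: "((\<lambda>x. f x + g x) has_derivative
      (\<lambda>v. frechet_derivative f (at x) v + frechet_derivative g (at x) v)) (at x)" if "x \<in> S" for x
    using Suc.prems that by (auto intro!: has_derivative_add has_derivative_frechet)
  have e: "frechet_derivative (\<lambda>x. f x + g x) (at x) v =
      frechet_derivative f (at x) v + frechet_derivative g (at x) v" if "x \<in> S" for x v
    using frechet_derivative_eqI[OF d[OF that]] by simp
  have "Ck_on k S (\<lambda>x. frechet_derivative (\<lambda>x. f x + g x) (at x) v)" for v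
    by (rule Ck_on_cong[OF assms(1) e[symmetric]]) (use Suc in auto)
  with d show ?case by (auto simp: differentiable_def)
qed

lemma Ck_on_scaleR:
  fixes f :: "'a::euclidean_space \<Rightarrow> real"
  assumes "open S" "Ck_on k S f" "Ck_on k S g"
  shows "Ck_on k S (\<lambda>x. f x *\<^sub>R g x)"
  using assms(2,3)
proof (induction k arbitrary: f g)
  case 0
  then show ?case by (auto intro: continuous_on_scaleR)
next
  case (Suc k)
  have d: "((\<lambda>x. f x *\<^sub>R g x) has_derivative
      (\<lambda>v. f x *\<^sub>R frechet_derivative g (at x) v + frechet_derivative f (at x) v *\<^sub>R g x)) (at x)" if "x \<in> S" for x
    by (rule has_derivative_scaleR[OF has_derivative_frechet has_derivative_frechet]) (use Suc.prems that in simp_all)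
  have e: "frechet_derivative (\<lambda>x. f x *\<^sub>R g x) (at x) v =
      f x *\<^sub>R frechet_derivative g (at x) v + frechet_derivative f (at x) v *\<^sub>R g x" if "x \<in> S" for x v
    using frechet_derivative_eqI[OF d[OF that]] by simp
  have fg: "Ck_on k S f" "Ck_on k S g"
    using Ck_on_Suc_imp[OF Suc.prems(1)] Ck_on_Suc_imp[OF Suc.prems(2)] by simp_all
  have dfg: "Ck_on k S (\<lambda>x. frechet_derivative f (at x) v)" "Ck_on k S (\<lambda>x. frechet_derivative g (at x) v)" for v
    using Suc.prems by simp_all
  have "Ck_on k S (\<lambda>x. frechet_derivative (\<lambda>x. f x *\<^sub>R g x) (at x) v)" for v
    by (rule Ck_on_cong[OF assms(1) e[symmetric]
        Ck_on_add[OF assms(1) Suc.IH[OF fg(1) dfg(2)] Suc.IH[OF dfg(1) fg(2)]]])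
  with d show ?case by (auto simp: differentiable_def)
qed

lemma Ck_on_sum:
  assumes "open S" "\<And>i. i \<in> I \<Longrightarrow> Ck_on k S (f i)"
  shows "Ck_on k S (\<lambda>x. \<Sum>i\<in>I. f i x)"
  using assms(2)
  by (induction I rule: infinite_finite_induct) (auto intro!: Ck_on_const Ck_on_add assms(1))

lemma Ck_on_compose:
  fixes g :: "'a::euclidean_space \<Rightarrow> 'b::euclidean_space" and f :: "'b \<Rightarrow> 'c::real_normed_vector"
  assumes "open S" "Ck_on k S g" "Ck_on k T f" "g ` S \<subseteq> T"
  shows "Ck_on k S (\<lambda>x. f (g x))"
  using assms(2,3)
proof (induction k arbitrary: f)
  case 0
  then show ?case using assms(4) by (auto intro: continuous_on_compose2)
next
  case (Suc k)
  have d: "((\<lambda>x. f (g x)) has_derivative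
     (\<lambda>v. frechet_derivative f (at (g x)) (frechet_derivative g (at x) v))) (at x)" if "x \<in> S" for x
    using has_derivative_compose[OF has_derivative_frechet[of g x] has_derivative_frechet[of f "g x"]]
      Suc.prems that assms(4) by auto
  have e: "frechet_derivative (\<lambda>x. f (g x)) (at x) v =
     (\<Sum>b\<in>Basis. (frechet_derivative g (at x) v \<bullet> b) *\<^sub>R frechet_derivative f (at (g x)) b)" if "x \<in> S" for x v
  proof -
    have lin: "linear (frechet_derivative f (at (g x)))"
      by (rule linear_frechet_derivative) (use Suc.prems(2) that assms(4) in auto)
    have "frechet_derivative (\<lambda>x. f (g x)) (at x) v
      = frechet_derivative f (at (g x)) (\<Sum>b\<in>Basis. (frechet_derivative g (at x) v \<bullet> b) *\<^sub>R b)"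
      using frechet_derivative_eqI[OF d[OF that]] by (simp add: euclidean_representation)
    then show ?thesis
      by (simp add: linear_sum[OF lin] linear_cmul[OF lin])
  qed
  have g: "Ck_on k S g" using Suc.prems(1) by (rule Ck_on_Suc_imp)
  have dg: "Ck_on k S (\<lambda>x. frechet_derivative g (at x) v)" for v
    using Suc.prems by simp
  have df: "Ck_on k T (\<lambda>y. frechet_derivative f (at y) v)" for v
    using Suc.prems by simp
  have "Ck_on k S (\<lambda>x. frechet_derivative (\<lambda>x. f (g x)) (at x) v)" for v
    by (rule Ck_on_cong[OF assms(1) e[symmetric]], assumption,
        rule Ck_on_sum[OF assms(1)],
        rule Ck_on_scaleR[OF assms(1) Ck_on_linear[OF assms(1) bounded_linear_inner_left dg] Suc.IH[OF g df]])
  with d show ?case by (auto simp: differentiable_def)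
qed

lemma Ck_on_Un:
  assumes "open S" "open T" "Ck_on k S f" "Ck_on k T f"
  shows "Ck_on k (S \<union> T) f"
  using assms(3,4)
proof (induction k arbitrary: f)
  case 0
  then show ?case using assms(1,2) by (simp add: continuous_on_open_Un)
next
  case (Suc k)
  then show ?case by (metis Ck_on.simps(2) Un_iff)
qed

subsection \<open>Smooth functions\<close>

named_theorems smooth_intros

lemma smooth_on_cong:
  assumes "open S" "\<And>x. x \<in> S \<Longrightarrow> f x = g x" "smooth_on S f"
  shows "smooth_on S g"
  using assms(3) Ck_on_cong[OF assms(1,2)] by (simp add: smooth_on_def)

lemma smooth_on_imp_Ck: "smooth_on S f \<Longrightarrow> Ck_on k S f"
  by (simp add: smooth_on_def)

lemma smooth_on_continuous: "smooth_on S f \<Longrightarrow> continuous_on S f"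
  unfolding smooth_on_def using Ck_on.simps(1) by blast

lemma smooth_on_differentiable: "smooth_on S f \<Longrightarrow> x \<in> S \<Longrightarrow> f differentiable (at x)"
  unfolding smooth_on_def using Ck_on.simps(2) by blast

lemma smooth_on_has_derivative:
  "smooth_on S f \<Longrightarrow> x \<in> S \<Longrightarrow> (f has_derivative frechet_derivative f (at x)) (at x)"
  by (rule has_derivative_frechet) (rule smooth_on_differentiable)

lemma smooth_on_deriv[smooth_intros]: "smooth_on S f \<Longrightarrow> smooth_on S (\<lambda>x. frechet_derivative f (at x) v)"
  unfolding smooth_on_def using Ck_on.simps(2) by blast

lemma smooth_on_const[smooth_intros]: "smooth_on S (\<lambda>x. c)"
  by (simp add: smooth_on_def Ck_on_const)

lemma smooth_on_id[smooth_intros]: "open S \<Longrightarrow> smooth_on S (\<lambda>x. x)"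
  by (simp add: smooth_on_def Ck_on_id)

lemma smooth_on_add[smooth_intros]:
  "open S \<Longrightarrow> smooth_on S f \<Longrightarrow> smooth_on S g \<Longrightarrow> smooth_on S (\<lambda>x. f x + g x)"
  by (simp add: smooth_on_def Ck_on_add)

lemma smooth_on_scaleR[smooth_intros]:
  fixes f :: "'a::euclidean_space \<Rightarrow> real"
  shows "open S \<Longrightarrow> smooth_on S f \<Longrightarrow> smooth_on S g \<Longrightarrow> smooth_on S (\<lambda>x. f x *\<^sub>R g x)"
  by (simp add: smooth_on_def Ck_on_scaleR)

lemma smooth_on_mult[smooth_intros]:
  fixes f :: "'a::euclidean_space \<Rightarrow> real"
  shows "open S \<Longrightarrow> smooth_on S f \<Longrightarrow> smooth_on S g \<Longrightarrow> smooth_on S (\<lambda>x. f x * g x)"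
  using smooth_on_scaleR[of S f g] by simp

lemma smooth_on_linear:
  "open S \<Longrightarrow> bounded_linear L \<Longrightarrow> smooth_on S f \<Longrightarrow> smooth_on S (\<lambda>x. L (f x))"
  by (simp add: smooth_on_def Ck_on_linear)

lemma smooth_on_bounded_linear: "open S \<Longrightarrow> bounded_linear L \<Longrightarrow> smooth_on S L"
  by (simp add: smooth_on_def Ck_on_bounded_linear)

lemma smooth_on_diff[smooth_intros]:
  fixes f :: "'a::euclidean_space \<Rightarrow> real"
  shows "open S \<Longrightarrow> smooth_on S f \<Longrightarrow> smooth_on S g \<Longrightarrow> smooth_on S (\<lambda>x. f x - g x)"
  using smooth_on_add[of S f "\<lambda>x. (-1) * g x"] smooth_on_mult[OF _ smooth_on_const[of S "-1::real"], of g] by simp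

lemma smooth_on_sum[smooth_intros]:
  "open S \<Longrightarrow> (\<And>i. i \<in> I \<Longrightarrow> smooth_on S (f i)) \<Longrightarrow> smooth_on S (\<lambda>x. \<Sum>i\<in>I. f i x)"
  by (simp add: smooth_on_def Ck_on_sum)

lemma smooth_on_prod[smooth_intros]:
  fixes f :: "'i \<Rightarrow> 'a::euclidean_space \<Rightarrow> real"
  shows "open S \<Longrightarrow> (\<And>i. i \<in> I \<Longrightarrow> smooth_on S (f i)) \<Longrightarrow> smooth_on S (\<lambda>x. \<Prod>i\<in>I. f i x)"
  by (induction I rule: infinite_finite_induct) (simp_all add: smooth_on_const smooth_on_mult)

lemma smooth_on_power[smooth_intros]:
  fixes f :: "'a::euclidean_space \<Rightarrow> real"
  shows "open S \<Longrightarrow> smooth_on S f \<Longrightarrow> smooth_on S (\<lambda>x. f x ^ n)"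
  by (induction n) (simp_all add: smooth_on_const smooth_on_mult)

lemma smooth_on_compose:
  fixes g :: "'a::euclidean_space \<Rightarrow> 'b::euclidean_space"
  shows "open S \<Longrightarrow> smooth_on S g \<Longrightarrow> smooth_on T f \<Longrightarrow> g ` S \<subseteq> T \<Longrightarrow> smooth_on S (\<lambda>x. f (g x))"
  unfolding smooth_on_def using Ck_on_compose[of S _ g T f] by blast

lemma smooth_on_vec_nth[smooth_intros]:
  fixes f :: "'a::euclidean_space \<Rightarrow> ('b::real_normed_vector)^'n"
  shows "open S \<Longrightarrow> smooth_on S f \<Longrightarrow> smooth_on S (\<lambda>x. f x $ i)"
  by (rule smooth_on_linear) (auto simp: bounded_linear_vec_nth)

text \<open>A bootstrap for functions that satisfy a differential equation \<open>f' = F(f)\<close>: the equation turns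
  each order of differentiability of \<open>f\<close> into one more.\<close>

lemma Ck_on_real_SucI:
  fixes f :: "real \<Rightarrow> real"
  assumes "open S" "\<And>x. x \<in> S \<Longrightarrow> (f has_real_derivative f' x) (at x)" "Ck_on k S f'"
  shows "Ck_on (Suc k) S f"
proof -
  have d: "(f has_derivative (\<lambda>v. f' x * v)) (at x)" if "x \<in> S" for x
    using assms(2)[OF that] by (simp add: has_field_derivative_def)
  have e: "v *\<^sub>R f' x = frechet_derivative f (at x) v" if "x \<in> S" for x v
    using frechet_derivative_eqI[OF d[OF that]] by simp
  have "Ck_on k S (\<lambda>x. frechet_derivative f (at x) v)" for v
    by (rule Ck_on_cong[OF assms(1) e Ck_on_linear[OF assms(1) bounded_linear_scaleR_right assms(3)]])
  with d show ?thesis by (auto simp: differentiable_def)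
qed

lemma smooth_on_inverse_real: "smooth_on (-{0::real}) inverse"
proof -
  have o: "open (-{0::real})" by (intro open_Compl closed_singleton)
  have "Ck_on k (-{0::real}) inverse" for k
  proof (induction k)
    case 0
    then show ?case by (auto intro!: continuous_intros)
  next
    case (Suc k)
    have "Ck_on k (-{0::real}) (\<lambda>x. - (inverse x * inverse x))"
      using Ck_on_linear[OF o bounded_linear_minus[OF bounded_linear_ident] Ck_on_scaleR[OF o Suc Suc]]
      by simp
    moreover have "(inverse has_real_derivative - (inverse x * inverse x)) (at x)" if "x \<in> -{0::real}" for x
      using that DERIV_inverse'[OF DERIV_ident, of x] by simp
    ultimately show ?case by (intro Ck_on_real_SucI) (auto simp: o)
  qed
  then show ?thesis by (simp add: smooth_on_def)
qed

lemma smooth_on_inverse[smooth_intros]: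
  fixes f :: "'a::euclidean_space \<Rightarrow> real"
  assumes "open S" "smooth_on S f" "\<And>x. x \<in> S \<Longrightarrow> f x \<noteq> 0"
  shows "smooth_on S (\<lambda>x. inverse (f x))"
  by (rule smooth_on_compose[OF assms(1,2) smooth_on_inverse_real]) (use assms(3) in auto)

lemma smooth_on_divide[smooth_intros]:
  fixes f :: "'a::euclidean_space \<Rightarrow> real"
  assumes "open S" "smooth_on S f" "smooth_on S g" "\<And>x. x \<in> S \<Longrightarrow> g x \<noteq> 0"
  shows "smooth_on S (\<lambda>x. f x / g x)"
  using smooth_on_mult[OF assms(1,2) smooth_on_inverse[OF assms(1,3,4)]] by (simp add: divide_inverse)

lemma smooth_on_sqrt_real: "smooth_on {0<..} sqrt"
proof -
  have "Ck_on k {0<..} sqrt" for k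
  proof (induction k)
    case 0
    then show ?case by (simp add: continuous_on_real_sqrt[OF continuous_on_id])
  next
    case (Suc k)
    have "Ck_on k {0<..} (\<lambda>x. inverse (sqrt x))"
      by (rule Ck_on_compose[OF _ Suc smooth_on_imp_Ck[OF smooth_on_inverse_real]]) auto
    then have "Ck_on k {0<..} (\<lambda>x. inverse (sqrt x) *\<^sub>R (1/2))"
      by (intro Ck_on_scaleR Ck_on_const) auto
    moreover have "(sqrt has_real_derivative inverse (sqrt x) *\<^sub>R (1/2)) (at x)" if "x \<in> {0<..}" for x
      using that DERIV_real_sqrt[of x] by simp
    ultimately show ?case by (intro Ck_on_real_SucI) auto
  qed
  then show ?thesis by (simp add: smooth_on_def)
qed

lemma smooth_on_sqrt[smooth_intros]:
  fixes f :: "'a::euclidean_space \<Rightarrow> real"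
  assumes "open S" "smooth_on S f" "\<And>x. x \<in> S \<Longrightarrow> f x > 0"
  shows "smooth_on S (\<lambda>x. sqrt (f x))"
  by (rule smooth_on_compose[OF assms(1,2) smooth_on_sqrt_real]) (use assms(3) in auto)

lemma smooth_on_det[smooth_intros]:
  fixes f :: "'a::euclidean_space \<Rightarrow> real^'n^'n"
  assumes "open S" "\<And>i j. smooth_on S (\<lambda>x. f x $ i $ j)"
  shows "smooth_on S (\<lambda>x. det (f x))"
  unfolding det_def by (intro smooth_intros assms)

lemma matrix_inv_mult:
  assumes "invertible A"
  shows "A ** matrix_inv A = mat 1" "matrix_inv A ** A = mat 1"
  using someI_ex[OF assms[unfolded invertible_def]] by (simp_all add: matrix_inv_def)

text \<open>Cramer's rule makes the entries of the inverse rational functions of the entries, hence smooth.\<close>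

lemma matrix_inv_cramer:
  fixes A :: "real^'n^'n"
  assumes "det A \<noteq> 0"
  shows "matrix_inv A $ k $ l = det (\<chi> i j. if j = k then axis l 1 $ i else A $ i $ j) / det A"
proof -
  have "invertible A" using assms invertible_det_nz by blast
  then have "A *v (matrix_inv A *v axis l 1) = axis l 1"
    by (simp add: matrix_vector_mul_assoc matrix_inv_mult)
  then have "(matrix_inv A *v axis l 1) $ k = det (\<chi> i j. if j = k then axis l 1 $ i else A $ i $ j) / det A"
    unfolding cramer[OF assms] by simp
  then show ?thesis by (simp add: matrix_vector_mult_basis column_def)
qed

lemma smooth_on_matrix_inv[smooth_intros]:
  fixes f :: "'a::euclidean_space \<Rightarrow> real^'n^'n"
  assumes S: "open S" and f: "\<And>i j. smooth_on S (\<lambda>x. f x $ i $ j)" and d: "\<And>x. x \<in> S \<Longrightarrow> det (f x) \<noteq> 0"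
  shows "smooth_on S (\<lambda>x. matrix_inv (f x) $ k $ l)"
proof (rule smooth_on_cong[OF S])
  show "det (\<chi> i j. if j = k then axis l 1 $ i else f x $ i $ j) / det (f x) = matrix_inv (f x) $ k $ l"
    if "x \<in> S" for x using matrix_inv_cramer[OF d[OF that]] by simp
  have "smooth_on S (\<lambda>x. (\<chi> i j. if j = k then axis l 1 $ i else f x $ i $ j) $ i $ j)" for i j
    by (cases "j = k") (simp_all add: f smooth_on_const)
  then have "smooth_on S (\<lambda>x. det (\<chi> i j. if j = k then axis l 1 $ i else f x $ i $ j))"
    by (rule smooth_on_det[OF S])
  then show "smooth_on S (\<lambda>x. det (\<chi> i j. if j = k then axis l 1 $ i else f x $ i $ j) / det (f x))"
    by (rule smooth_on_divide[OF S _ smooth_on_det[OF S f] d])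
qed

subsection \<open>Symmetry of second derivatives\<close>

text \<open>Schwarz's theorem, by differentiating \<open>f (x + s u + t v) - f (x + s u)\<close>, written as the integral of the
  derivative along \<open>v\<close>, under the integral sign in \<open>s\<close>, and then in \<open>t\<close>.\<close>

lemma frechet_derivative_commute:
  fixes f :: "'a::euclidean_space \<Rightarrow> real"
  assumes S: "open S" and f: "smooth_on S f" and x: "x \<in> S"
  shows "frechet_derivative (\<lambda>y. frechet_derivative f (at y) u) (at x) v
       = frechet_derivative (\<lambda>y. frechet_derivative f (at y) v) (at x) u"
proof -
  obtain e where e: "e > 0" "ball x e \<subseteq> S" using S x openE by blast
  define c where "c = 2 * (norm u + norm v + 1)"
  have c: "norm u + norm v < c" "0 < c"
    by (simp_all add: c_def distrib_left add_nonneg_pos)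
  define \<delta> where "\<delta> = e / c"
  have dp: "\<delta> > 0" and dc: "\<delta> * c = e" using e c by (simp_all add: \<delta>_def)
  have inS: "x + s *\<^sub>R u + t *\<^sub>R v \<in> S" if "\<bar>s\<bar> \<le> \<delta>" "\<bar>t\<bar> \<le> \<delta>" for s t
  proof -
    have "norm (s *\<^sub>R u + t *\<^sub>R v) \<le> \<delta> * norm u + \<delta> * norm v"
      by (rule order_trans[OF norm_triangle_ineq]) (use that in \<open>auto intro!: add_mono mult_right_mono\<close>)
    also have "\<dots> < \<delta> * c"
      using mult_strict_left_mono[OF c(1) dp] by (simp add: distrib_left)
    also note dc
    finally have "dist (x + (s *\<^sub>R u + t *\<^sub>R v)) x < e" by (simp add: dist_norm)
    then have "x + (s *\<^sub>R u + t *\<^sub>R v) \<in> ball x e" by (simp add: dist_commute)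
    with e show ?thesis by (auto simp: add.assoc)
  qed
  define D where "D w y = frechet_derivative f (at y) w" for w y
  define DD where "DD w z y = frechet_derivative (D w) (at y) z" for w z y
  have smD: "smooth_on S (D w)" for w unfolding D_def by (intro smooth_intros f)
  have smDD: "smooth_on S (DD w z)" for w z unfolding DD_def by (intro smooth_intros smD)
  have dir: "((\<lambda>s. h (y + s *\<^sub>R w)) has_real_derivative frechet_derivative h (at (y + s *\<^sub>R w)) w) (at s within T)"
    if h: "smooth_on S h" and yS: "y + s *\<^sub>R w \<in> S" for h :: "'a \<Rightarrow> real" and y w s T
  proof -
    have "((\<lambda>s. h (y + s *\<^sub>R w)) has_derivative (\<lambda>r. frechet_derivative h (at (y + s *\<^sub>R w)) (r *\<^sub>R w))) (at s within T)"
      by (rule has_derivative_compose[where f = "\<lambda>s. y + s *\<^sub>R w", OF _ smooth_on_has_derivative[OF h yS]])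
        (auto intro!: derivative_eq_intros)
    then show ?thesis
      using linear_cmul[OF linear_frechet_derivative[OF smooth_on_differentiable[OF h yS]]]
      by (simp add: has_field_derivative_def mult_commute_abs)
  qed
  let ?I = "{-\<delta>..\<delta>}"
  let ?J = "\<lambda>t. integral {0..t} (\<lambda>\<tau>. DD v u (x + \<tau> *\<^sub>R v))"
  have key: "D u (x + t *\<^sub>R v) - D u x = ?J t" if t: "0 \<le> t" "t \<le> \<delta>" for t
  proof -
    have fi: "((\<lambda>\<tau>. D v (x + s *\<^sub>R u + \<tau> *\<^sub>R v)) has_integral f (x + s *\<^sub>R u + t *\<^sub>R v) - f (x + s *\<^sub>R u + 0 *\<^sub>R v)) {0..t}"
      if "s \<in> ?I" for s
      by (rule fundamental_theorem_of_calculus)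
        (use t that inS in \<open>auto simp: D_def has_real_derivative_iff_has_vector_derivative[symmetric] intro!: dir f\<close>)
    have "((\<lambda>s. integral (cbox 0 t) (\<lambda>\<tau>. D v (x + s *\<^sub>R u + \<tau> *\<^sub>R v))) has_field_derivative
        integral (cbox 0 t) (\<lambda>\<tau>. DD v u (x + 0 *\<^sub>R u + \<tau> *\<^sub>R v))) (at 0 within ?I)"
    proof (rule leibniz_rule_field_derivative)
      show "((\<lambda>s. D v (x + s *\<^sub>R u + \<tau> *\<^sub>R v)) has_field_derivative DD v u (x + s *\<^sub>R u + \<tau> *\<^sub>R v)) (at s within ?I)"
        if "s \<in> ?I" "\<tau> \<in> cbox 0 t" for s \<tau>
        using dir[OF smD, of "x + \<tau> *\<^sub>R v" s u v] inS[of s \<tau>] that t by (simp add: DD_def add_ac abs_le_iff)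
      show "(\<lambda>\<tau>. D v (x + s *\<^sub>R u + \<tau> *\<^sub>R v)) integrable_on cbox 0 t" if "s \<in> ?I" for s
        using fi[OF that] by auto
      show "continuous_on (?I \<times> cbox 0 t) (\<lambda>(s, \<tau>). DD v u (x + s *\<^sub>R u + \<tau> *\<^sub>R v))"
        unfolding split_beta
        by (rule continuous_on_compose2[OF smooth_on_continuous[OF smDD]])
          (use inS t in \<open>auto intro!: continuous_intros\<close>)
    qed (use dp in auto)
    moreover have "((\<lambda>s. integral (cbox 0 t) (\<lambda>\<tau>. D v (x + s *\<^sub>R u + \<tau> *\<^sub>R v))) has_field_derivative
        D u (x + t *\<^sub>R v) - D u x) (at 0 within ?I)"
    proof (rule has_field_derivative_transform_within[where d = \<delta>])
      show "((\<lambda>s. f (x + t *\<^sub>R v + s *\<^sub>R u) - f (x + s *\<^sub>R u)) has_field_derivative D u (x + t *\<^sub>R v) - D u x) (at 0 within ?I)"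
        using dir[OF f, of "x + t *\<^sub>R v" 0 u] dir[OF f, of x 0 u] inS[of 0 t] t dp x
        by (intro DERIV_diff) (auto simp: D_def)
      show "f (x + t *\<^sub>R v + s *\<^sub>R u) - f (x + s *\<^sub>R u) = integral (cbox 0 t) (\<lambda>\<tau>. D v (x + s *\<^sub>R u + \<tau> *\<^sub>R v))"
        if "s \<in> ?I" for s
        using integral_unique[OF fi[OF that]] by (simp add: add_ac)
    qed (use dp in auto)
    moreover have "at (0::real) within ?I \<noteq> bot"
      using dp by (simp add: trivial_limit_within islimpt_Icc)
    ultimately show ?thesis
      using has_field_derivative_unique by fastforce
  qed
  have "((\<lambda>t. ?J t) has_real_derivative DD v u (x + 0 *\<^sub>R v)) (at 0 within {0..\<delta>})"
    by (rule integral_has_real_derivative)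
      (use inS[of 0] dp in \<open>auto intro!: continuous_intros continuous_on_compose2[OF smooth_on_continuous[OF smDD]]\<close>)
  then have "((\<lambda>t. ?J t) has_real_derivative DD v u x) (at 0 within {0..\<delta>})"
    by simp
  then have "((\<lambda>t. D u (x + t *\<^sub>R v) - D u x) has_real_derivative DD v u x) (at 0 within {0..\<delta>})"
    by (rule has_field_derivative_transform_within[where d = \<delta>]) (use key dp in auto)
  moreover have "((\<lambda>t. D u (x + t *\<^sub>R v) - D u x) has_real_derivative DD u v x - 0) (at 0 within {0..\<delta>})"
    using dir[OF smD, of x 0 v u] x by (intro DERIV_diff) (auto simp: DD_def)
  moreover have "at (0::real) within {0..\<delta>} \<noteq> bot"
    using dp by (simp add: trivial_limit_within islimpt_Icc)
  ultimately have "DD v u x = DD u v x"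
    using has_field_derivative_unique by fastforce
  then show ?thesis by (simp add: DD_def D_def[abs_def])
qed

lemma frechet_derivative_nth:
  fixes f :: "'a::real_normed_vector \<Rightarrow> ('b::real_normed_vector)^'n"
  assumes "f differentiable (at x)"
  shows "frechet_derivative (\<lambda>x. f x $ i) (at x) v = frechet_derivative f (at x) v $ i"
  using frechet_derivative_eqI[OF bounded_linear.has_derivative[OF bounded_linear_vec_nth has_derivative_frechet[OF assms]]]
  by simp

lemma frechet_derivative_commute_vec:
  fixes f :: "'a::euclidean_space \<Rightarrow> real^'n"
  assumes S: "open S" and f: "smooth_on S f" and x: "x \<in> S"
  shows "frechet_derivative (\<lambda>y. frechet_derivative f (at y) u) (at x) v
       = frechet_derivative (\<lambda>y. frechet_derivative f (at y) v) (at x) u"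
proof -
  have *: "frechet_derivative (\<lambda>y. frechet_derivative f (at y) u) (at x) v $ i
     = frechet_derivative (\<lambda>y. frechet_derivative (\<lambda>x. f x $ i) (at y) u) (at x) v" for u v i
  proof -
    have "frechet_derivative (\<lambda>y. frechet_derivative f (at y) u) (at x) v $ i
       = frechet_derivative (\<lambda>y. frechet_derivative f (at y) u $ i) (at x) v"
      by (simp add: frechet_derivative_nth smooth_on_differentiable[OF smooth_on_deriv[OF f] x])
    also have "\<dots> = frechet_derivative (\<lambda>y. frechet_derivative (\<lambda>x. f x $ i) (at y) u) (at x) v"
      by (rule arg_cong[where f = "\<lambda>h. h v"], rule frechet_derivative_transform_within_open[OF _ S x])
        (auto simp: frechet_derivative_nth smooth_on_differentiable[OF f]
          intro!: smooth_on_differentiable[OF smooth_on_vec_nth[OF S smooth_on_deriv[OF f]] x])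
    finally show ?thesis .
  qed
  show ?thesis
    unfolding vec_eq_iff * using frechet_derivative_commute[OF S smooth_on_vec_nth[OF S f] x] by blast
qed

lemma smooth_on_vecI:
  fixes f :: "'a::euclidean_space \<Rightarrow> ('b::euclidean_space)^'n"
  assumes "open S" "\<And>i. smooth_on S (\<lambda>x. f x $ i)"
  shows "smooth_on S f"
proof (rule smooth_on_cong[OF assms(1)])
  show "(\<Sum>i\<in>UNIV. axis i (f x $ i)) = f x" for x
    by (simp add: vec_eq_iff axis_def if_distrib cong: if_cong)
  have "bounded_linear (axis i :: 'b \<Rightarrow> 'b^'n)" for i
    by (auto simp: linear_conv_bounded_linear[symmetric] linear_iff vec_eq_iff axis_def)
  then show "smooth_on S (\<lambda>x. \<Sum>i\<in>UNIV. axis i (f x $ i))"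
    by (intro smooth_on_sum smooth_on_linear[where L = "axis i" for i] assms)
qed

section \<open>Curvature in coordinates\<close>

abbreviation dd :: "('a::real_normed_vector \<Rightarrow> 'b::real_normed_vector) \<Rightarrow> 'a \<Rightarrow> 'a \<Rightarrow> 'b" where
  "dd f x \<equiv> frechet_derivative f (at x)"

definition pos_sym :: "real^'n^'n \<Rightarrow> bool" where
  "pos_sym B \<longleftrightarrow> transpose B = B \<and> (\<forall>v. v \<noteq> 0 \<longrightarrow> v \<bullet> (B *v v) > 0)"

lemma sym_inner:
  fixes B :: "real^'n^'n"
  assumes "transpose B = B" shows "u \<bullet> (B *v v) = v \<bullet> (B *v u)"
  by (metis assms dot_lmul_matrix inner_commute vector_transpose_matrix)

lemma inner_transpose: "u \<bullet> ((transpose A ** B ** C) *v v) = (A *v u) \<bullet> (B *v (C *v v))"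
  for A B C :: "real^'n^'n"
  by (metis matrix_vector_mul_assoc dot_lmul_matrix vector_transpose_matrix)

text \<open>The determinant is positive at the identity and has no zero on the segment from there to \<open>B\<close>,
  because every matrix on the segment is positive definite.\<close>

lemma pos_sym_det: assumes "pos_sym B" shows "det B > 0"
proof -
  define A where "A t = (1 - t) *\<^sub>R mat 1 + t *\<^sub>R B" for t :: real
  have pos: "v \<bullet> (A t *v v) > 0" if "v \<noteq> 0" "0 \<le> t" "t \<le> 1" for v t
  proof -
    have "v \<bullet> (A t *v v) = (1 - t) * (v \<bullet> v) + t * (v \<bullet> (B *v v))"
      by (simp add: A_def matrix_vector_mult_add_rdistrib scaleR_matrix_vector_assoc[symmetric] inner_add_right)
    moreover have "v \<bullet> v > 0" "v \<bullet> (B *v v) > 0" using that assms by (auto simp: pos_sym_def)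
    ultimately show ?thesis using that
      by (cases "t = 0") (auto intro: add_nonneg_pos)
  qed
  have nz: "det (A t) \<noteq> 0" if "0 \<le> t" "t \<le> 1" for t
  proof
    assume "det (A t) = 0"
    then have "\<not> invertible (A t)" using invertible_det_nz by blast
    then obtain v where "v \<noteq> 0" "A t *v v = 0"
      using matrix_left_invertible_ker[of "A t"] by (auto simp: invertible_left_inverse)
    with pos[of v t] that show False by simp
  qed
  have cont: "continuous_on {0..1} (\<lambda>t. det (A t))"
    unfolding det_def A_def by (auto intro!: continuous_intros)
  show ?thesis
  proof (rule ccontr)
    assume "\<not> det B > 0"
    then have "det (A 1) \<le> 0" "0 \<le> det (A 0)" by (simp_all add: A_def det_I)
    then obtain t where "0 \<le> t" "t \<le> 1" "det (A t) = 0"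
      using IVT2'[of "\<lambda>t. det (A t)" 1 0 0] cont by auto
    with nz show False by blast
  qed
qed

lemma pos_sym_invertible: "pos_sym B \<Longrightarrow> invertible B"
  using pos_sym_det[of B] by (simp add: invertible_det_nz)

lemma bounded_bilinear_matrix_vector:
  "bounded_bilinear ((*v) :: real^'n^'m \<Rightarrow> real^'n \<Rightarrow> real^'m)"
  unfolding bilinear_conv_bounded_bilinear[symmetric]
  by (auto simp: bilinear_def linear_iff algebra_simps matrix_vector_mult_add_rdistrib
      matrix_vector_mult_scaleR scaleR_matrix_vector_assoc)

lemma has_derivative_form:
  fixes a b :: "'a::real_normed_vector \<Rightarrow> real^'n" and N :: "'a \<Rightarrow> real^'n^'n"
  assumes "(a has_derivative a') (at x)" "(b has_derivative b') (at x)" "(N has_derivative N') (at x)"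
  shows "((\<lambda>x. a x \<bullet> (N x *v b x)) has_derivative
      (\<lambda>w. a x \<bullet> (N x *v b' w + N' w *v b x) + a' w \<bullet> (N x *v b x))) (at x)"
  by (rule has_derivative_inner[OF assms(1) bounded_bilinear.FDERIV[OF bounded_bilinear_matrix_vector assms(3,2)]])

lemma vec_eq_inner_invertible:
  fixes B :: "real^'n^'n"
  assumes B: "pos_sym B" and eq: "\<And>w. w \<bullet> (B *v a) = w \<bullet> (B *v b)"
  shows "a = b"
proof (rule ccontr)
  assume "a \<noteq> b"
  then have "(a - b) \<bullet> (B *v (a - b)) > 0" using B by (simp add: pos_sym_def)
  with eq[of "a - b"] show False by (simp add: matrix_vector_mult_diff_distrib inner_diff_right)
qed

definition local_metric :: "(real^'n) set \<Rightarrow> (real^'n \<Rightarrow> real^'n^'n) \<Rightarrow> bool" where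
  "local_metric U M \<longleftrightarrow> open U \<and> smooth_on U M \<and> (\<forall>x\<in>U. pos_sym (M x))"

text \<open>The Christoffel symbol \<open>\<Gamma>(u, v)\<close> and the curvature \<open>R(u, w) v\<close> as vector-valued multilinear maps;
  working with vectors instead of indices makes the change of coordinates a computation with
  derivatives rather than with sums.\<close>

definition chr :: "(real^'n \<Rightarrow> real^'n^'n) \<Rightarrow> real^'n \<Rightarrow> real^'n \<Rightarrow> real^'n \<Rightarrow> real^'n" where
  "chr M x u v = (1/2) *\<^sub>R (matrix_inv (M x) *v
     (dd M x u *v v + dd M x v *v u - (\<chi> l. u \<bullet> (dd M x (axis l 1) *v v))))"

definition riem :: "(real^'n \<Rightarrow> real^'n^'n) \<Rightarrow> real^'n \<Rightarrow> real^'n \<Rightarrow> real^'n \<Rightarrow> real^'n \<Rightarrow> real^'n" where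
  "riem M x u w v = dd (\<lambda>y. chr M y w v) x u - dd (\<lambda>y. chr M y u v) x w
     + chr M x u (chr M x w v) - chr M x w (chr M x u v)"

context
  fixes U :: "(real^'n) set" and M :: "real^'n \<Rightarrow> real^'n^'n"
  assumes lm: "local_metric U M"
begin

lemma lm_open: "open U" and lm_smooth: "smooth_on U M" and lm_pos: "x \<in> U \<Longrightarrow> pos_sym (M x)"
  using lm by (auto simp: local_metric_def)

lemma lm_inv: "x \<in> U \<Longrightarrow> M x *v (matrix_inv (M x) *v v) = v"
  using matrix_inv_mult(1)[OF pos_sym_invertible[OF lm_pos]] by (simp add: matrix_vector_mul_assoc)

lemma lm_differentiable: "x \<in> U \<Longrightarrow> M differentiable (at x)"
  by (rule smooth_on_differentiable[OF lm_smooth])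

lemma lm_linear: "x \<in> U \<Longrightarrow> linear (dd M x)"
  by (rule linear_frechet_derivative[OF lm_differentiable])

lemma dd_sym:
  assumes x: "x \<in> U" shows "transpose (dd M x w) = dd M x w"
proof -
  have lin: "bounded_linear (transpose :: real^'n^'n \<Rightarrow> _)"
    by (auto simp: linear_conv_bounded_linear[symmetric] linear_iff transpose_def vec_eq_iff)
  have "((\<lambda>y. transpose (M y)) has_derivative (\<lambda>w. transpose (dd M x w))) (at x)"
    by (rule bounded_linear.has_derivative[OF lin has_derivative_frechet[OF lm_differentiable[OF x]]])
  moreover have "((\<lambda>y. transpose (M y)) has_derivative dd M x) (at x)"
    by (rule has_derivative_transform_within_open[OF has_derivative_frechet[OF lm_differentiable[OF x]] lm_open x])
      (use lm_pos in \<open>auto simp: pos_sym_def\<close>)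
  ultimately show ?thesis by (metis has_derivative_unique)
qed

text \<open>The Koszul formula, free of the inverse matrix.\<close>

lemma chr_inner:
  assumes x: "x \<in> U"
  shows "w \<bullet> (M x *v chr M x u v) =
    (1/2) * (w \<bullet> (dd M x u *v v) + w \<bullet> (dd M x v *v u) - u \<bullet> (dd M x w *v v))"
proof -
  have w: "w \<bullet> (\<chi> l. u \<bullet> (dd M x (axis l 1) *v v)) = u \<bullet> (dd M x w *v v)"
  proof -
    have lin: "linear (\<lambda>w. u \<bullet> (dd M x w *v v))"
      using lm_linear[OF x] by (auto simp: linear_iff matrix_vector_mult_add_rdistrib inner_add_right
          scaleR_matrix_vector_assoc[symmetric])
    have "w = (\<Sum>l\<in>UNIV. w $ l *\<^sub>R axis l 1)"
      by (simp add: vec_eq_iff axis_def if_distrib cong: if_cong)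
    then have "u \<bullet> (dd M x w *v v) = u \<bullet> (dd M x (\<Sum>l\<in>UNIV. w $ l *\<^sub>R axis l 1) *v v)"
      by simp
    also have "\<dots> = (\<Sum>l\<in>UNIV. w $ l * (u \<bullet> (dd M x (axis l 1) *v v)))"
      using linear_sum[OF lin, of "\<lambda>l. w $ l *\<^sub>R axis l 1" UNIV] by (simp add: linear_cmul[OF lin])
    finally show ?thesis by (simp add: inner_vec_def)
  qed
  show ?thesis
    unfolding chr_def
    by (simp add: matrix_vector_mult_scaleR lm_inv[OF x] w[symmetric] inner_add_right inner_diff_right)
qed

lemma chr_sym: assumes "x \<in> U" shows "chr M x u v = chr M x v u"
  by (rule vec_eq_inner_invertible[OF lm_pos[OF assms]])
    (simp add: chr_inner[OF assms] sym_inner[OF dd_sym[OF assms], of u _ v])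

lemma chr_bilinear: assumes "x \<in> U" shows "bilinear (chr M x)"
proof -
  have add: "chr M x (u + u') v = chr M x u v + chr M x u' v" for u u' v
    by (rule vec_eq_inner_invertible[OF lm_pos[OF assms]])
      (simp add: chr_inner[OF assms] matrix_vector_right_distrib inner_add_right inner_add_left
        linear_add[OF lm_linear[OF assms]] matrix_vector_mult_add_rdistrib field_simps)
  have scale: "chr M x (c *\<^sub>R u) v = c *\<^sub>R chr M x u v" for u v c
    by (rule vec_eq_inner_invertible[OF lm_pos[OF assms]])
      (simp add: chr_inner[OF assms] matrix_vector_mult_scaleR linear_cmul[OF lm_linear[OF assms]]
        scaleR_matrix_vector_assoc[symmetric] field_simps)
  show ?thesis
    unfolding bilinear_def linear_iff using add scale chr_sym[OF assms] by auto
qed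

lemma smooth_on_inv_entry: "smooth_on U (\<lambda>x. matrix_inv (M x) $ k $ l)"
  using pos_sym_det[OF lm_pos]
  by (intro smooth_on_matrix_inv[OF lm_open] smooth_on_vec_nth[OF lm_open] lm_smooth) force

lemma smooth_chr: "smooth_on U (\<lambda>x. chr M x u v)"
proof (rule smooth_on_vecI[OF lm_open])
  fix k
  have mv: "smooth_on U (\<lambda>x. (dd M x a *v b) $ l)" for a b l
    unfolding matrix_vector_mult_def
    by (simp, intro smooth_on_sum[OF lm_open] smooth_on_mult[OF lm_open] smooth_on_const
        smooth_on_vec_nth[OF lm_open] smooth_on_deriv lm_smooth)
  show "smooth_on U (\<lambda>x. chr M x u v $ k)"
    unfolding chr_def matrix_vector_mult_def[of "matrix_inv _"] inner_vec_def
    by (simp, intro smooth_on_sum[OF lm_open] smooth_on_mult[OF lm_open] smooth_on_const smooth_on_divide[OF lm_open]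
        smooth_on_diff[OF lm_open] smooth_on_add[OF lm_open] smooth_on_inv_entry mv; simp)
qed

lemma chr_deriv_linear: "x \<in> U \<Longrightarrow> linear (\<lambda>z. dd (\<lambda>y. chr M y u v) x z)"
  by (rule linear_frechet_derivative[OF smooth_on_differentiable[OF smooth_chr]])

lemma chr_deriv_bilinear:
  assumes x: "x \<in> U" shows "bilinear (\<lambda>u v. dd (\<lambda>y. chr M y u v) x z)"
proof -
  have D: "((\<lambda>y. chr M y u v) has_derivative dd (\<lambda>y. chr M y u v) x) (at x)" for u v
    by (rule smooth_on_has_derivative[OF smooth_chr x])
  have 1: "dd (\<lambda>y. chr M y (u + u') v) x = (\<lambda>z. dd (\<lambda>y. chr M y u v) x z + dd (\<lambda>y. chr M y u' v) x z)" for u u' v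
    by (rule frechet_derivative_eqI, rule has_derivative_transform_within_open[OF has_derivative_add[OF D D] lm_open x])
      (simp add: bilinear_ladd[OF chr_bilinear])
  have 2: "dd (\<lambda>y. chr M y (c *\<^sub>R u) v) x = (\<lambda>z. c *\<^sub>R dd (\<lambda>y. chr M y u v) x z)" for u v c
    by (rule frechet_derivative_eqI, rule has_derivative_transform_within_open[OF has_derivative_scaleR_right[OF D] lm_open x])
      (simp add: bilinear_lmul[OF chr_bilinear])
  have 3: "dd (\<lambda>y. chr M y u v) x = dd (\<lambda>y. chr M y v u) x" for u v
    by (rule frechet_derivative_eqI, rule has_derivative_transform_within_open[OF D lm_open x])
      (rule chr_sym)
  have 4: "dd (\<lambda>y. chr M y v (u + u')) x = (\<lambda>z. dd (\<lambda>y. chr M y v u) x z + dd (\<lambda>y. chr M y v u') x z)" for u u' v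
    using 1[of u u' v] 3[of v] by simp
  have 5: "dd (\<lambda>y. chr M y v (c *\<^sub>R u)) x = (\<lambda>z. c *\<^sub>R dd (\<lambda>y. chr M y v u) x z)" for u v c
    using 2[of c u v] 3[of v] by simp
  show ?thesis
    unfolding bilinear_def linear_iff by (simp add: 1 2 4 5)
qed

lemma riem_linear1: assumes "x \<in> U" shows "linear (\<lambda>u. riem M x u w v)"
  using linear_add[OF chr_deriv_linear[OF assms]] linear_cmul[OF chr_deriv_linear[OF assms]]
    bilinear_ladd[OF chr_deriv_bilinear[OF assms]] bilinear_lmul[OF chr_deriv_bilinear[OF assms]]
    bilinear_ladd[OF chr_bilinear[OF assms]] bilinear_lmul[OF chr_bilinear[OF assms]]
    bilinear_radd[OF chr_bilinear[OF assms]] bilinear_rmul[OF chr_bilinear[OF assms]]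
  by (auto simp: linear_iff riem_def algebra_simps)

lemma riem_linear2: assumes "x \<in> U" shows "linear (\<lambda>w. riem M x u w v)"
  using linear_add[OF chr_deriv_linear[OF assms]] linear_cmul[OF chr_deriv_linear[OF assms]]
    bilinear_ladd[OF chr_deriv_bilinear[OF assms]] bilinear_lmul[OF chr_deriv_bilinear[OF assms]]
    bilinear_ladd[OF chr_bilinear[OF assms]] bilinear_lmul[OF chr_bilinear[OF assms]]
    bilinear_radd[OF chr_bilinear[OF assms]] bilinear_rmul[OF chr_bilinear[OF assms]]
  by (auto simp: linear_iff riem_def algebra_simps)

lemma riem_linear3: assumes "x \<in> U" shows "linear (\<lambda>v. riem M x u w v)"
  using bilinear_radd[OF chr_deriv_bilinear[OF assms]] bilinear_rmul[OF chr_deriv_bilinear[OF assms]]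
    bilinear_radd[OF chr_bilinear[OF assms]] bilinear_rmul[OF chr_bilinear[OF assms]]
  by (auto simp: linear_iff riem_def algebra_simps)

end

subsection \<open>Change of coordinates\<close>

lemma vec_axis_sum: "(v :: real^'n) = (\<Sum>l\<in>UNIV. v $ l *\<^sub>R axis l 1)"
  by (simp add: vec_eq_iff axis_def if_distrib cong: if_cong)

lemma bilinear_axis_sum:
  fixes B :: "real^'n \<Rightarrow> real^'n \<Rightarrow> 'b::real_vector"
  assumes "bilinear B"
  shows "B u v = (\<Sum>i\<in>UNIV. \<Sum>j\<in>UNIV. (u $ i * v $ j) *\<^sub>R B (axis i 1) (axis j 1))"
proof -
  have "B u v = B (\<Sum>l\<in>UNIV. u $ l *\<^sub>R axis l 1) (\<Sum>l\<in>UNIV. v $ l *\<^sub>R axis l 1)"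
    using vec_axis_sum[of u] vec_axis_sum[of v] by metis
  also have "\<dots> = (\<Sum>i\<in>UNIV. \<Sum>j\<in>UNIV. (u $ i * v $ j) *\<^sub>R B (axis i 1) (axis j 1))"
    by (simp add: bilinear_sum[OF assms] bilinear_lmul[OF assms] bilinear_rmul[OF assms] sum.cartesian_product mult.commute)
  finally show ?thesis .
qed

text \<open>The product rule when the coefficients and both arguments move with \<open>x\<close>. It is what differentiating
  the right-hand side of the transformation law \<open>chr_law\<close> takes.\<close>

lemma has_derivative_bilinear_moving:
  fixes B :: "real^'n \<Rightarrow> real^'n \<Rightarrow> real^'n \<Rightarrow> real^'n" and \<phi> a b :: "real^'n \<Rightarrow> real^'n"
  assumes "open V" and B: "\<And>y. y \<in> V \<Longrightarrow> bilinear (B y)"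
    and DB: "\<And>u v. (\<lambda>y. B y u v) differentiable (at (\<phi> x))"
    and DBb: "\<And>z. bilinear (\<lambda>u v. dd (\<lambda>y. B y u v) (\<phi> x) z)"
    and \<phi>: "(\<phi> has_derivative \<phi>') (at x)" "open S" "x \<in> S" "\<phi> ` S \<subseteq> V"
    and a: "(a has_derivative a') (at x)" and b: "(b has_derivative b') (at x)"
  shows "((\<lambda>x. B (\<phi> x) (a x) (b x)) has_derivative
     (\<lambda>w. dd (\<lambda>y. B y (a x) (b x)) (\<phi> x) (\<phi>' w) + B (\<phi> x) (a' w) (b x) + B (\<phi> x) (a x) (b' w))) (at x)"
proof -
  let ?e = "\<lambda>i. axis i 1 :: real^'n"
  let ?S = "\<lambda>x. \<Sum>i\<in>UNIV. \<Sum>j\<in>UNIV. (a x $ i * b x $ j) *\<^sub>R B (\<phi> x) (?e i) (?e j)"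
  have xV: "\<phi> x \<in> V" using \<phi> by auto
  have comp: "((\<lambda>x. B (\<phi> x) u v) has_derivative (\<lambda>w. dd (\<lambda>y. B y u v) (\<phi> x) (\<phi>' w))) (at x)" for u v
    by (rule has_derivative_compose[OF \<phi>(1) has_derivative_frechet[OF DB]])
  have ai: "((\<lambda>x. a x $ i) has_derivative (\<lambda>w. a' w $ i)) (at x)" for i
    by (rule bounded_linear.has_derivative[OF bounded_linear_vec_nth a])
  have bi: "((\<lambda>x. b x $ i) has_derivative (\<lambda>w. b' w $ i)) (at x)" for i
    by (rule bounded_linear.has_derivative[OF bounded_linear_vec_nth b])
  have "(?S has_derivative (\<lambda>w. \<Sum>i\<in>UNIV. \<Sum>j\<in>UNIV.
      (a x $ i * b x $ j) *\<^sub>R dd (\<lambda>y. B y (?e i) (?e j)) (\<phi> x) (\<phi>' w)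
      + (a x $ i * b' w $ j + a' w $ i * b x $ j) *\<^sub>R B (\<phi> x) (?e i) (?e j))) (at x)"
    by (intro has_derivative_sum has_derivative_scaleR has_derivative_mult ai bi comp)
  moreover have "(\<Sum>i\<in>UNIV. \<Sum>j\<in>UNIV.
      (a x $ i * b x $ j) *\<^sub>R dd (\<lambda>y. B y (?e i) (?e j)) (\<phi> x) (\<phi>' w)
      + (a x $ i * b' w $ j + a' w $ i * b x $ j) *\<^sub>R B (\<phi> x) (?e i) (?e j))
     = dd (\<lambda>y. B y (a x) (b x)) (\<phi> x) (\<phi>' w) + B (\<phi> x) (a' w) (b x) + B (\<phi> x) (a x) (b' w)" for w
    unfolding bilinear_axis_sum[OF DBb, of "a x" "b x"] bilinear_axis_sum[OF B[OF xV], of "a' w"]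
      bilinear_axis_sum[OF B[OF xV], of _ "b' w"]
    by (simp add: sum.distrib[symmetric] scaleR_add_left algebra_simps)
  ultimately have "(?S has_derivative (\<lambda>w. dd (\<lambda>y. B y (a x) (b x)) (\<phi> x) (\<phi>' w)
      + B (\<phi> x) (a' w) (b x) + B (\<phi> x) (a x) (b' w))) (at x)" by simp
  then show ?thesis
    by (rule has_derivative_transform_within_open[OF _ \<phi>(2,3)])
      (use \<phi>(4) in \<open>auto intro!: bilinear_axis_sum[OF B, symmetric]\<close>)
qed

locale chart_change =
  fixes U U' O1 :: "(real^'n) set" and M M' :: "real^'n \<Rightarrow> real^'n^'n" and \<phi> :: "real^'n \<Rightarrow> real^'n"
  assumes lm: "local_metric U M" and lm': "local_metric U' M'"
    and O: "open O1" "O1 \<subseteq> U" "\<phi> ` O1 \<subseteq> U'" and \<phi>: "smooth_on O1 \<phi>"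
    and law: "\<And>x. x \<in> O1 \<Longrightarrow> M x = transpose (matrix (dd \<phi> x)) ** M' (\<phi> x) ** matrix (dd \<phi> x)"
begin

abbreviation "J x u \<equiv> dd \<phi> x u"
abbreviation "H x w u \<equiv> dd (\<lambda>y. dd \<phi> y u) x w"

lemma J_linear: "x \<in> O1 \<Longrightarrow> linear (dd \<phi> x)"
  by (rule linear_frechet_derivative[OF smooth_on_differentiable[OF \<phi>]])

lemma matrix_J: "x \<in> O1 \<Longrightarrow> matrix (dd \<phi> x) *v u = J x u"
  using J_linear[of x] by (simp add: matrix_works linear_matrix_vector_mul_eq)

lemma inner_law: "x \<in> O1 \<Longrightarrow> u \<bullet> (M x *v v) = J x u \<bullet> (M' (\<phi> x) *v J x v)"
  by (simp add: law inner_transpose matrix_J)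

lemma J_invertible: assumes "x \<in> O1" shows "invertible (matrix (dd \<phi> x))"
proof -
  have "det (M x) > 0" using pos_sym_det[OF lm_pos[OF lm]] assms O by blast
  then have "det (matrix (dd \<phi> x)) \<noteq> 0" by (auto simp: law[OF assms] det_mul)
  then show ?thesis by (simp add: invertible_det_nz)
qed

lemma J_surj: assumes "x \<in> O1" obtains w where "J x w = z"
proof -
  have "matrix (dd \<phi> x) *v (matrix_inv (matrix (dd \<phi> x)) *v z) = z"
    using matrix_inv_mult(1)[OF J_invertible[OF assms]] by (simp add: matrix_vector_mul_assoc)
  with that matrix_J[OF assms] show ?thesis by metis
qed

lemma J_has_derivative: "x \<in> O1 \<Longrightarrow> ((\<lambda>y. J y u) has_derivative (\<lambda>w. H x w u)) (at x)"
  by (rule smooth_on_has_derivative[OF smooth_on_deriv[OF \<phi>]])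

lemma H_sym: "x \<in> O1 \<Longrightarrow> H x w u = H x u w"
  by (rule frechet_derivative_commute_vec[OF O(1) \<phi>])

lemma deriv_law:
  assumes x: "x \<in> O1"
  shows "u \<bullet> (dd M x w *v v) = H x w u \<bullet> (M' (\<phi> x) *v J x v)
    + J x u \<bullet> (dd M' (\<phi> x) (J x w) *v J x v) + J x u \<bullet> (M' (\<phi> x) *v H x w v)"
proof -
  have xU: "x \<in> U" "\<phi> x \<in> U'" using x O by auto
  have "((\<lambda>y. u \<bullet> (M y *v v)) has_derivative (\<lambda>w. u \<bullet> (dd M x w *v v))) (at x)"
    using has_derivative_form[OF has_derivative_const has_derivative_const
        has_derivative_frechet[OF lm_differentiable[OF lm xU(1)]], of u v] by simp
  moreover have "((\<lambda>y. u \<bullet> (M y *v v)) has_derivative (\<lambda>w. J x u \<bullet> (M' (\<phi> x) *v H x w v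
      + dd M' (\<phi> x) (J x w) *v J x v) + H x w u \<bullet> (M' (\<phi> x) *v J x v))) (at x)"
    by (rule has_derivative_transform_within_open[OF has_derivative_form[OF J_has_derivative[OF x] J_has_derivative[OF x]
       has_derivative_compose[OF smooth_on_has_derivative[OF \<phi> x]
         has_derivative_frechet[OF lm_differentiable[OF lm' xU(2)]]]] O(1) x])
      (simp add: inner_law)
  ultimately have "(\<lambda>w. u \<bullet> (dd M x w *v v)) = (\<lambda>w. J x u \<bullet> (M' (\<phi> x) *v H x w v
      + dd M' (\<phi> x) (J x w) *v J x v) + H x w u \<bullet> (M' (\<phi> x) *v J x v))"
    by (rule has_derivative_unique)
  from fun_cong[OF this, of w] show ?thesis by (simp add: inner_add_right)
qed

text \<open>Because \<open>J\<close> is surjective the identity may be tested against vectors \<open>J x z\<close>, where the Koszul formula applies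
  on both sides. Of the second derivatives of \<open>\<phi>\<close> in the three instances of \<open>deriv_law\<close> only
  \<open>H x u v\<close> survives.\<close>

lemma chr_law:
  assumes x: "x \<in> O1"
  shows "J x (chr M x u v) = chr M' (\<phi> x) (J x u) (J x v) + H x u v"
proof (rule vec_eq_inner_invertible[OF lm_pos[OF lm']])
  have xU: "x \<in> U" "\<phi> x \<in> U'" using x O by auto
  show "\<phi> x \<in> U'" by fact
  fix z
  obtain w where z: "J x w = z" using J_surj[OF x] .
  have sym: "a \<bullet> (M' (\<phi> x) *v b) = b \<bullet> (M' (\<phi> x) *v a)" for a b
    using lm_pos[OF lm' xU(2)] by (intro sym_inner) (simp add: pos_sym_def)
  show "z \<bullet> (M' (\<phi> x) *v J x (chr M x u v))
     = z \<bullet> (M' (\<phi> x) *v (chr M' (\<phi> x) (J x u) (J x v) + H x u v))"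
    unfolding z[symmetric] inner_law[OF x, symmetric] chr_inner[OF lm xU(1)]
      matrix_vector_right_distrib inner_add_right chr_inner[OF lm' xU(2)] deriv_law[OF x]
    using sym[of "H x w u" "J x v"] sym[of "H x v w" "J x u"]
    by (simp add: H_sym[OF x, where w = v and u = u] H_sym[OF x, where w = w and u = u]
        H_sym[OF x, where w = w and u = v] sym[of "H x u w" "J x v"])
qed

text \<open>Differentiate \<open>chr_law\<close> once more and antisymmetrise: the third derivatives of \<open>\<phi>\<close> cancel by symmetry, and
  \<open>chr_law\<close> itself eliminates the second derivatives.\<close>

lemma riem_law:
  assumes x: "x \<in> O1"
  shows "J x (riem M x u w v) = riem M' (\<phi> x) (J x u) (J x w) (J x v)"
proof -
  have xU: "x \<in> U" "\<phi> x \<in> U'" using x O by auto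
  let ?\<Gamma> = "chr M x" and ?\<Gamma>' = "chr M' (\<phi> x)"
  let ?D' = "\<lambda>w u v. dd (\<lambda>y. chr M' y u v) (\<phi> x) w"
  let ?K = "\<lambda>w u v. dd (\<lambda>y. H y u v) x w"
  have Jlin: "J x (a + b) = J x a + J x b" "J x (a - b) = J x a - J x b" for a b
    using J_linear[OF x] by (simp_all add: linear_add linear_diff)
  have key: "H x w (?\<Gamma> u v) + J x (dd (\<lambda>y. chr M y u v) x w)
     = ?D' (J x w) (J x u) (J x v) + ?\<Gamma>' (H x w u) (J x v) + ?\<Gamma>' (J x u) (H x w v) + ?K w u v" for w u v
  proof -
    have smH: "smooth_on O1 (\<lambda>y. H y u v)"
      by (rule smooth_on_deriv[OF smooth_on_deriv[OF \<phi>]])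
    have 1: "((\<lambda>y. J y (chr M y u v)) has_derivative
        (\<lambda>w. H x w (?\<Gamma> u v) + J x (dd (\<lambda>y. chr M y u v) x w))) (at x)"
    proof -
      have "((\<lambda>y. \<Sum>i\<in>UNIV. chr M y u v $ i *\<^sub>R J y (axis i 1)) has_derivative
        (\<lambda>w. \<Sum>i\<in>UNIV. ?\<Gamma> u v $ i *\<^sub>R H x w (axis i 1) + dd (\<lambda>y. chr M y u v) x w $ i *\<^sub>R J x (axis i 1))) (at x)"
        by (intro has_derivative_sum has_derivative_scaleR J_has_derivative x
            bounded_linear.has_derivative[OF bounded_linear_vec_nth smooth_on_has_derivative[OF smooth_chr[OF lm] xU(1)]])
      moreover have Jsum: "(\<Sum>i\<in>UNIV. a $ i *\<^sub>R J y (axis i 1)) = J y a" if "y \<in> O1" for a y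
        using linear_sum[OF J_linear[OF that], of "\<lambda>i. a $ i *\<^sub>R axis i 1" UNIV] vec_axis_sum[of a]
        by (simp add: linear_cmul[OF J_linear[OF that]])
      moreover have "(\<Sum>i\<in>UNIV. a $ i *\<^sub>R H x w (axis i 1)) = H x w a" for a w
      proof -
        have "H x w a = H x a w" by (rule H_sym[OF x])
        also have "\<dots> = (\<Sum>i\<in>UNIV. a $ i *\<^sub>R H x (axis i 1) w)"
          using linear_sum[OF has_derivative_linear[OF J_has_derivative[OF x]], of w "\<lambda>i. a $ i *\<^sub>R axis i 1" UNIV] vec_axis_sum[of a]
          by (simp add: linear_cmul[OF has_derivative_linear[OF J_has_derivative[OF x]]])
        finally show ?thesis by (simp add: H_sym[OF x, of w])
      qed
      ultimately have "((\<lambda>y. \<Sum>i\<in>UNIV. chr M y u v $ i *\<^sub>R J y (axis i 1)) has_derivative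
        (\<lambda>w. H x w (?\<Gamma> u v) + J x (dd (\<lambda>y. chr M y u v) x w))) (at x)"
        using x by (simp add: sum.distrib)
      then show ?thesis
        by (rule has_derivative_transform_within_open[OF _ O(1) x]) (rule Jsum)
    qed
    have 2: "((\<lambda>y. chr M' (\<phi> y) (J y u) (J y v) + H y u v) has_derivative
       (\<lambda>w. (?D' (J x w) (J x u) (J x v) + ?\<Gamma>' (H x w u) (J x v) + ?\<Gamma>' (J x u) (H x w v)) + ?K w u v)) (at x)"
      by (rule has_derivative_add[OF has_derivative_bilinear_moving[OF lm_open[OF lm'] chr_bilinear[OF lm']
          smooth_on_differentiable[OF smooth_chr[OF lm'] xU(2)] chr_deriv_bilinear[OF lm' xU(2)]
          smooth_on_has_derivative[OF \<phi> x] O(1) x O(3) J_has_derivative[OF x] J_has_derivative[OF x]]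
          smooth_on_has_derivative[OF smH x]])
    have "((\<lambda>y. J y (chr M y u v)) has_derivative
       (\<lambda>w. (?D' (J x w) (J x u) (J x v) + ?\<Gamma>' (H x w u) (J x v) + ?\<Gamma>' (J x u) (H x w v)) + ?K w u v)) (at x)"
      by (rule has_derivative_transform_within_open[OF 2 O(1) x]) (simp add: chr_law)
    from has_derivative_unique[OF 1 this] show ?thesis by (rule fun_cong)
  qed
  have K: "?K w u v = ?K u w v"
    by (rule frechet_derivative_commute_vec[OF O(1) smooth_on_deriv[OF \<phi>] x])
  have HG: "H x w a = J x (?\<Gamma> w a) - ?\<Gamma>' (J x w) (J x a)" for w a
    using chr_law[OF x, of w a] by simp
  have bl: "?\<Gamma>' (J x w) (a + b) = ?\<Gamma>' (J x w) a + ?\<Gamma>' (J x w) b" for w a b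
    by (rule bilinear_radd[OF chr_bilinear[OF lm' xU(2)]])
  have 3: "H x w (?\<Gamma> u v) = J x (?\<Gamma> w (?\<Gamma> u v)) - ?\<Gamma>' (J x w) (?\<Gamma>' (J x u) (J x v)) - ?\<Gamma>' (J x w) (H x u v)" for w u v
  proof -
    have "?\<Gamma>' (J x w) (J x (?\<Gamma> u v)) = ?\<Gamma>' (J x w) (?\<Gamma>' (J x u) (J x v)) + ?\<Gamma>' (J x w) (H x u v)"
      by (simp only: chr_law[OF x, of u v] bl)
    then show ?thesis using HG[where w = w and a = "?\<Gamma> u v"] by (simp add: algebra_simps)
  qed
  show ?thesis
    using key[where w = u and u = w and v = v] key[where w = w and u = u and v = v] K
      H_sym[OF x, where w = w and u = u] unfolding 3
    by (simp add: riem_def Jlin algebra_simps)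
qed

end

section \<open>Curvature on the manifold\<close>

subsection \<open>Traces\<close>

definition Ric :: "(real^'n \<Rightarrow> real^'n^'n) \<Rightarrow> real^'n \<Rightarrow> real^'n \<Rightarrow> real^'n \<Rightarrow> real" where
  "Ric M x w v = (\<Sum>i\<in>UNIV. riem M x (axis i 1) w v $ i)"

lemma linear_trace_conj:
  fixes f h J :: "real^'n \<Rightarrow> real^'n"
  assumes f: "linear f" and h: "linear h" and J: "linear J" and inv: "invertible (matrix J)"
    and eq: "\<And>u. J (f u) = h (J u)"
  shows "(\<Sum>i\<in>UNIV. f (axis i 1) $ i) = (\<Sum>i\<in>UNIV. h (axis i 1) $ i)"
proof -
  have tr: "(\<Sum>i\<in>UNIV. k (axis i 1) $ i) = trace (matrix k)" for k :: "real^'n \<Rightarrow> real^'n"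
    by (simp add: trace_def matrix_def)
  have m: "matrix k *v u = k u" if "linear k" for k :: "real^'n \<Rightarrow> real^'n" and u
    using that by (simp add: matrix_works linear_matrix_vector_mul_eq)
  have c: "matrix J ** matrix f = matrix h ** matrix J"
    by (rule matrix_eq[THEN iffD2]) (simp add: matrix_vector_mul_assoc[symmetric] m f h J eq)
  have "matrix f = matrix_inv (matrix J) ** (matrix J ** matrix f)"
    by (simp add: matrix_mul_assoc matrix_inv_mult[OF inv])
  then have "trace (matrix f) = trace (matrix_inv (matrix J) ** (matrix h ** matrix J))"
    by (simp add: c)
  also have "\<dots> = trace ((matrix h ** matrix J) ** matrix_inv (matrix J))"
    by (rule trace_mul_sym)
  also have "\<dots> = trace (matrix h)"
    by (simp add: matrix_mul_assoc[symmetric] matrix_inv_mult[OF inv])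
  finally show ?thesis by (simp add: tr)
qed

lemma matrix_inv_eqI:
  fixes B X :: "real^'n^'n"
  assumes "X ** B = mat 1" shows "matrix_inv B = X"
proof -
  have "invertible B" using assms invertible_left_inverse by blast
  then have "X ** (B ** matrix_inv B) = X" by (simp add: matrix_inv_mult)
  then show ?thesis by (simp add: matrix_mul_assoc assms)
qed

lemma matrix_inv_congruence:
  fixes J B :: "real^'n^'n"
  assumes J: "invertible J" and B: "invertible B"
  shows "matrix_inv (transpose J ** B ** J) = matrix_inv J ** matrix_inv B ** transpose (matrix_inv J)"
proof (rule matrix_inv_eqI)
  have t: "transpose (matrix_inv J) ** transpose J = mat 1"
    by (simp add: matrix_transpose_mul[symmetric] matrix_inv_mult[OF J] transpose_mat)
  have "matrix_inv J ** matrix_inv B ** transpose (matrix_inv J) ** (transpose J ** B ** J)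
     = matrix_inv J ** (matrix_inv B ** ((transpose (matrix_inv J) ** transpose J) ** B)) ** J"
    by (simp only: matrix_mul_assoc)
  also have "\<dots> = mat 1" by (simp add: t matrix_inv_mult[OF J] matrix_inv_mult[OF B])
  finally show "matrix_inv J ** matrix_inv B ** transpose (matrix_inv J) ** (transpose J ** B ** J) = mat 1" .
qed

lemma raise_index_congruence:
  fixes J B R :: "real^'n^'n"
  assumes J: "invertible J" and B: "invertible B"
  shows "matrix_inv (transpose J ** B ** J) ** (transpose J ** R ** J) = matrix_inv J ** (matrix_inv B ** R) ** J"
proof -
  have t: "transpose (matrix_inv J) ** transpose J = mat 1"
    by (simp add: matrix_transpose_mul[symmetric] matrix_inv_mult[OF J] transpose_mat)
  have "matrix_inv (transpose J ** B ** J) ** (transpose J ** R ** J)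
     = matrix_inv J ** (matrix_inv B ** ((transpose (matrix_inv J) ** transpose J) ** R)) ** J"
    by (simp only: matrix_inv_congruence[OF J B] matrix_mul_assoc)
  then show ?thesis by (simp add: t)
qed

lemma trace_conj:
  fixes J X :: "real^'n^'n"
  assumes J: "invertible J" shows "trace (matrix_inv J ** X ** J) = trace X"
  using trace_mul_sym[of "matrix_inv J" "X ** J"]
  by (simp add: matrix_mul_assoc[symmetric] matrix_inv_mult[OF J])

lemma trace_raise2_congruence:
  fixes J B R K :: "real^'n^'n"
  assumes J: "invertible J" and B: "invertible B"
  shows "trace (matrix_inv (transpose J ** B ** J) ** (transpose J ** R ** J)
     ** matrix_inv (transpose J ** B ** J) ** (transpose J ** K ** J))
   = trace (matrix_inv B ** R ** matrix_inv B ** K)"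
proof -
  have "matrix_inv (transpose J ** B ** J) ** (transpose J ** R ** J)
     ** matrix_inv (transpose J ** B ** J) ** (transpose J ** K ** J)
   = (matrix_inv J ** (matrix_inv B ** R) ** J) ** (matrix_inv J ** (matrix_inv B ** K) ** J)"
    using raise_index_congruence[OF J B, of R] raise_index_congruence[OF J B, of K]
    by (simp add: matrix_mul_assoc[symmetric])
  also have "\<dots> = matrix_inv J ** ((matrix_inv B ** R) ** (J ** matrix_inv J) ** (matrix_inv B ** K)) ** J"
    by (simp only: matrix_mul_assoc)
  finally have e: "matrix_inv (transpose J ** B ** J) ** (transpose J ** R ** J)
     ** matrix_inv (transpose J ** B ** J) ** (transpose J ** K ** J)
   = matrix_inv J ** ((matrix_inv B ** R) ** (J ** matrix_inv J) ** (matrix_inv B ** K)) ** J" .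
  show ?thesis
    unfolding e trace_conj[OF J] matrix_inv_mult[OF J] by (simp add: matrix_mul_assoc)
qed

context chart_change begin

lemma Ric_law:
  assumes x: "x \<in> O1"
  shows "Ric M x w v = Ric M' (\<phi> x) (J x w) (J x v)"
proof -
  have xU: "x \<in> U" "\<phi> x \<in> U'" using x O by auto
  show ?thesis unfolding Ric_def
    by (rule linear_trace_conj[where f = "\<lambda>u. riem M x u w v" and h = "\<lambda>u. riem M' (\<phi> x) u (J x w) (J x v)",
          OF riem_linear1[OF lm xU(1)] riem_linear1[OF lm' xU(2)] J_linear[OF x] J_invertible[OF x]])
      (rule riem_law[OF x])
qed

end

subsection \<open>Charts\<close>

abbreviation loc :: "('m, 'n::finite) tensor \<Rightarrow> ('m, 'n) chart \<Rightarrow> real^'n \<Rightarrow> real^'n^'n" where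
  "loc g c \<equiv> \<lambda>x. g c (point c x)"

context
  fixes A :: "('m::t2_space, 'n::finite) chart set"
  assumes atlas: "smooth_atlas A"
begin

lemma atlas_homeo: "c \<in> A \<Longrightarrow> homeomorphism (dom_c c) (img_c c) (coord c) (point c)"
  and open_img: "c \<in> A \<Longrightarrow> open (img_c c)"
  and open_dom: "c \<in> A \<Longrightarrow> open (dom_c c)"
  and transition_smooth: "c \<in> A \<Longrightarrow> d \<in> A \<Longrightarrow>
     smooth_on (coord c ` (dom_c c \<inter> dom_c d)) (coord d \<circ> point c)"
  using atlas by (auto simp: smooth_atlas_def)

lemma point_coord: "c \<in> A \<Longrightarrow> p \<in> dom_c c \<Longrightarrow> point c (coord c p) = p"
  using homeomorphism_apply1[OF atlas_homeo] .

lemma coord_point: "c \<in> A \<Longrightarrow> x \<in> img_c c \<Longrightarrow> coord c (point c x) = x"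
  using homeomorphism_apply2[OF atlas_homeo] .

lemma point_in_dom: "c \<in> A \<Longrightarrow> x \<in> img_c c \<Longrightarrow> point c x \<in> dom_c c"
  using homeomorphism_image2[OF atlas_homeo] by blast

lemma coord_in_img: "p \<in> dom_c c \<Longrightarrow> coord c p \<in> img_c c"
  by (simp add: img_c_def)

lemma open_overlap: assumes "c \<in> A" "d \<in> A" shows "open (coord c ` (dom_c c \<inter> dom_c d))"
proof -
  have "openin (top_of_set (img_c c)) (coord c ` (dom_c c \<inter> dom_c d))"
    by (rule homeomorphism_imp_open_map[OF atlas_homeo[OF assms(1)]])
      (simp add: open_dom assms openin_open_Int)
  then show ?thesis using open_img[OF assms(1)] by (simp add: openin_open_eq)
qed

lemma chart_at: "chart_at A p \<in> A" "p \<in> dom_c (chart_at A p)"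
proof -
  have "\<exists>c. c \<in> A \<and> p \<in> dom_c c" using atlas by (force simp: smooth_atlas_def)
  then have "chart_at A p \<in> A \<and> p \<in> dom_c (chart_at A p)"
    unfolding chart_at_def by (rule someI_ex)
  then show "chart_at A p \<in> A" "p \<in> dom_c (chart_at A p)" by auto
qed

lemma Met_pos: "g \<in> Met A \<Longrightarrow> c \<in> A \<Longrightarrow> p \<in> dom_c c \<Longrightarrow> pos_sym (g c p)"
  unfolding Met_def sym_tensor_field_def pos_sym_def by blast

lemma Met_law: "g \<in> Met A \<Longrightarrow> c \<in> A \<Longrightarrow> d \<in> A \<Longrightarrow> p \<in> dom_c c \<Longrightarrow> p \<in> dom_c d \<Longrightarrow>
    g c p = transpose (jacobian c d p) ** g d p ** jacobian c d p"
  unfolding Met_def sym_tensor_field_def by blast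

lemma Met_smooth: "g \<in> Met A \<Longrightarrow> c \<in> A \<Longrightarrow> smooth_on (img_c c) (loc g c)"
  unfolding Met_def sym_tensor_field_def by blast

lemma local_metric_loc:
  assumes "g \<in> Met A" "c \<in> A" shows "local_metric (img_c c) (loc g c)"
  using open_img[OF assms(2)] Met_smooth[OF assms] Met_pos[OF assms point_in_dom[OF assms(2)]]
  by (simp add: local_metric_def)

lemma chart_change_loc:
  assumes g: "g \<in> Met A" and c: "c \<in> A" and d: "d \<in> A"
  shows "chart_change (img_c c) (img_c d) (coord c ` (dom_c c \<inter> dom_c d)) (loc g c) (loc g d) (coord d \<circ> point c)"
proof
  show "local_metric (img_c c) (loc g c)" "local_metric (img_c d) (loc g d)"
    using local_metric_loc g c d by auto
  show "open (coord c ` (dom_c c \<inter> dom_c d))" by (rule open_overlap[OF c d])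
  show "coord c ` (dom_c c \<inter> dom_c d) \<subseteq> img_c c" by (auto simp: img_c_def)
  show "(coord d \<circ> point c) ` coord c ` (dom_c c \<inter> dom_c d) \<subseteq> img_c d"
    by (auto simp: img_c_def point_coord[OF c])
  show "smooth_on (coord c ` (dom_c c \<inter> dom_c d)) (coord d \<circ> point c)"
    by (rule transition_smooth[OF c d])
  fix x assume "x \<in> coord c ` (dom_c c \<inter> dom_c d)"
  then obtain p where p: "p \<in> dom_c c" "p \<in> dom_c d" "x = coord c p" by auto
  have "g c p = transpose (jacobian c d p) ** g d p ** jacobian c d p"
    by (rule Met_law[OF g c d p(1,2)])
  then show "g c (point c x) = transpose (matrix (dd (coord d \<circ> point c) x)) **
      g d (point d ((coord d \<circ> point c) x)) ** matrix (dd (coord d \<circ> point c) x)"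
    by (simp add: p point_coord c d jacobian_def)
qed

lemma jacobian_invertible:
  assumes g: "g \<in> Met A" and c: "c \<in> A" and d: "d \<in> A" and p: "p \<in> dom_c c" "p \<in> dom_c d"
  shows "invertible (jacobian c d p)"
  unfolding jacobian_def
  by (rule chart_change.J_invertible[OF chart_change_loc[OF g c d]]) (use p in auto)

lemma partial_entry:
  assumes "g \<in> Met A" "c \<in> A" "x \<in> img_c c"
  shows "partial i (entry g c j l) x = dd (loc g c) x (axis i 1) $ j $ l"
proof -
  have d: "loc g c differentiable (at x)"
    by (rule lm_differentiable[OF local_metric_loc]) (use assms in auto)
  then have d2: "(\<lambda>x. g c (point c x) $ j) differentiable (at x)"
    using bounded_linear.has_derivative[OF bounded_linear_vec_nth has_derivative_frechet[OF d]]
    by (auto simp: differentiable_def)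
  show ?thesis
    unfolding partial_def entry_def[abs_def] by (simp add: frechet_derivative_nth d d2)
qed

lemma christoffel_chr:
  assumes g: "g \<in> Met A" and c: "c \<in> A" and x: "x \<in> img_c c"
  shows "christoffel g c k i j x = chr (loc g c) x (axis i 1) (axis j 1) $ k"
proof -
  have s: "transpose (dd (loc g c) x w) = dd (loc g c) x w" for w
    by (rule dd_sym[OF local_metric_loc[OF g c] x])
  have s': "dd (loc g c) x w $ a $ b = dd (loc g c) x w $ b $ a" for w a b
    using arg_cong[OF s[of w], of "\<lambda>B. B $ b $ a"] by (simp add: transpose_def)
  have t: "(dd (loc g c) x (axis i 1) *v axis j 1 + dd (loc g c) x (axis j 1) *v axis i 1
      - (\<chi> l. axis i 1 \<bullet> (dd (loc g c) x (axis l 1) *v axis j 1))) $ l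
     = dd (loc g c) x (axis i 1) $ j $ l + dd (loc g c) x (axis j 1) $ i $ l - dd (loc g c) x (axis l 1) $ i $ j" for l
    using s'[of "axis i 1" l j] s'[of "axis j 1" l i]
    by (simp add: matrix_vector_mult_basis column_def inner_axis')
  show ?thesis
    unfolding christoffel_def chr_def partial_entry[OF assms] vector_scaleR_component
      matrix_vector_mult_def[of "matrix_inv _"] t by simp
qed

lemma riemann_riem:
  assumes g: "g \<in> Met A" and c: "c \<in> A" and x: "x \<in> img_c c"
  shows "riemann g c l k i j x = riem (loc g c) x (axis i 1) (axis j 1) (axis k 1) $ l"
proof -
  note lm = local_metric_loc[OF g c]
  have p: "partial a (christoffel g c l b k) x = dd (\<lambda>y. chr (loc g c) y (axis b 1) (axis k 1)) x (axis a 1) $ l" for a b k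
  proof -
    have sm: "smooth_on (img_c c) (\<lambda>y. chr (loc g c) y (axis b 1) (axis k 1))"
      by (rule smooth_chr[OF lm])
    have "dd (christoffel g c l b k) x = dd (\<lambda>y. chr (loc g c) y (axis b 1) (axis k 1) $ l) x"
      by (rule frechet_derivative_transform_within_open[OF _ open_img[OF c] x, symmetric])
        (simp_all add: christoffel_chr[OF g c] smooth_on_differentiable[OF smooth_on_vec_nth[OF open_img[OF c] sm] x])
    then show ?thesis
      by (simp add: partial_def frechet_derivative_nth smooth_on_differentiable[OF sm x])
  qed
  have q: "(\<Sum>m\<in>UNIV. christoffel g c l a m x * christoffel g c m b k x) =
     chr (loc g c) x (axis a 1) (chr (loc g c) x (axis b 1) (axis k 1)) $ l" for a b
  proof -
    let ?v = "chr (loc g c) x (axis b 1) (axis k 1)"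
    have lin: "linear (chr (loc g c) x (axis a 1))"
      using chr_bilinear[OF lm x] by (simp add: bilinear_def)
    have "chr (loc g c) x (axis a 1) ?v = chr (loc g c) x (axis a 1) (\<Sum>m\<in>UNIV. ?v $ m *\<^sub>R axis m 1)"
      using vec_axis_sum[of ?v] by metis
    also have "\<dots> = (\<Sum>m\<in>UNIV. ?v $ m *\<^sub>R chr (loc g c) x (axis a 1) (axis m 1))"
      by (simp add: linear_sum[OF lin] linear_cmul[OF lin])
    finally show ?thesis
      by (simp add: christoffel_chr[OF g c x] mult.commute)
  qed
  show ?thesis
    unfolding riemann_def riem_def sum_subtractf q p by simp
qed

lemma ricci_Ric:
  assumes g: "g \<in> Met A" and c: "c \<in> A" and p: "p \<in> dom_c c"
  shows "w \<bullet> (ricci g c p *v v) = Ric (loc g c) (coord c p) w v"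
proof -
  let ?x = "coord c p"
  have x: "?x \<in> img_c c" using p by (rule coord_in_img)
  note lm = local_metric_loc[OF g c]
  have bil: "bilinear (Ric (loc g c) ?x)"
    unfolding bilinear_def linear_iff Ric_def
    using riem_linear2[OF lm x] riem_linear3[OF lm x]
    by (auto simp: linear_iff sum.distrib sum_distrib_left)
  have "w \<bullet> (ricci g c p *v v) = (\<Sum>i\<in>UNIV. \<Sum>j\<in>UNIV. (w $ i * v $ j) * Ric (loc g c) ?x (axis i 1) (axis j 1))"
    by (simp add: inner_vec_def matrix_vector_mult_def ricci_def Ric_def riemann_riem[OF g c x] sum_distrib_left mult_ac)
  then show ?thesis using bilinear_axis_sum[OF bil, of w v] by simp
qed

lemma ricci_law:
  assumes g: "g \<in> Met A" and c: "c \<in> A" and d: "d \<in> A" and p: "p \<in> dom_c c" "p \<in> dom_c d"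
  shows "ricci g c p = transpose (jacobian c d p) ** ricci g d p ** jacobian c d p"
proof -
  interpret chart_change "img_c c" "img_c d" "coord c ` (dom_c c \<inter> dom_c d)" "loc g c" "loc g d" "coord d \<circ> point c"
    by (rule chart_change_loc[OF g c d])
  have x: "coord c p \<in> coord c ` (dom_c c \<inter> dom_c d)" using p by auto
  have "u \<bullet> (ricci g c p *v v) = u \<bullet> ((transpose (jacobian c d p) ** ricci g d p ** jacobian c d p) *v v)" for u v
    unfolding inner_transpose jacobian_def matrix_J[OF x] ricci_Ric[OF g c p(1)] ricci_Ric[OF g d p(2)] Ric_law[OF x]
    by (simp add: point_coord[OF c p(1)])
  then have "ricci g c p *v v = (transpose (jacobian c d p) ** ricci g d p ** jacobian c d p) *v v" for v
    by - (rule vector_eq_ldot[THEN iffD1], rule allI)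
  then show ?thesis unfolding matrix_eq by (rule allI)
qed

text \<open>The definitions of \<open>scal\<close> and \<open>g02\<close> pick an arbitrary chart; the choice drops out because full contractions
  are invariant under congruence by the Jacobian matrix.\<close>

lemma scal_chart:
  assumes g: "g \<in> Met A" and c: "c \<in> A" and p: "p \<in> dom_c c"
  shows "scal A g p = trace (matrix_inv (g c p) ** ricci g c p)"
proof -
  let ?d = "chart_at A p"
  note J = jacobian_invertible[OF g c chart_at(1) p chart_at(2)]
  have B: "invertible (g ?d p)"
    by (rule pos_sym_invertible[OF Met_pos[OF g chart_at]])
  show ?thesis
    unfolding scal_def Let_def Met_law[OF g c chart_at(1) p chart_at(2)] ricci_law[OF g c chart_at(1) p chart_at(2)]
      raise_index_congruence[OF J B] trace_conj[OF J] ..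
qed

lemma g02_chart:
  assumes g: "g \<in> Met A" and c: "c \<in> A" and p: "p \<in> dom_c c"
    and h: "\<And>d. d \<in> A \<Longrightarrow> p \<in> dom_c d \<Longrightarrow> h c p = transpose (jacobian c d p) ** h d p ** jacobian c d p"
    and k: "\<And>d. d \<in> A \<Longrightarrow> p \<in> dom_c d \<Longrightarrow> k c p = transpose (jacobian c d p) ** k d p ** jacobian c d p"
  shows "g02 A g h k p = trace (matrix_inv (g c p) ** h c p ** matrix_inv (g c p) ** k c p)"
proof -
  let ?d = "chart_at A p"
  note J = jacobian_invertible[OF g c chart_at(1) p chart_at(2)]
  have B: "invertible (g ?d p)"
    by (rule pos_sym_invertible[OF Met_pos[OF g chart_at]])
  show ?thesis
    unfolding g02_def Let_def Met_law[OF g c chart_at(1) p chart_at(2)] h[OF chart_at] k[OF chart_at]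
      trace_raise2_congruence[OF J B] ..
qed

end

section \<open>The volume measure\<close>

subsection \<open>Change of variables for an arbitrary finite index type\<close>

text \<open>The formula \<open>has_absolute_integral_change_of_variables\<close> is about well-ordered index types. Renumbering the
  coordinates by \<open>idx\<close>, an initial segment of the natural numbers, carries it over to every finite index
  type, since it preserves Lebesgue measure and determinants.\<close>

typedef 'n idx = "{i::nat. i < CARD('n::finite)}"
  by (rule exI[of _ 0]) simp

instantiation idx :: (finite) linorder
begin
definition "i \<le> j \<longleftrightarrow> Rep_idx i \<le> Rep_idx j"
definition "i < j \<longleftrightarrow> Rep_idx i < Rep_idx j"
instance
  by standard (auto simp: less_eq_idx_def less_idx_def Rep_idx_inject)
end

instance idx :: (finite) wellorder
proof
  fix P :: "'a idx \<Rightarrow> bool" and a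
  assume *: "\<And>x. (\<And>y. y < x \<Longrightarrow> P y) \<Longrightarrow> P x"
  show "P a"
    by (induction a rule: measure_induct_rule[of Rep_idx]) (rule *, simp add: less_idx_def)
qed

lemma card_idx: "CARD('n::finite idx) = CARD('n)"
  using type_definition.card[OF type_definition_idx] by simp

instance idx :: (finite) finite
proof
  have "(UNIV :: 'a idx set) = Abs_idx ` {i. i < CARD('a)}"
    by (rule type_definition.Abs_image[OF type_definition_idx, symmetric])
  then show "finite (UNIV :: 'a idx set)" by (metis finite_imageI finite_Collect_less_nat)
qed

definition renum :: "'n::finite idx \<Rightarrow> 'n" where
  "renum = (SOME f. bij f)"

lemma bij_renum: "bij (renum :: 'n::finite idx \<Rightarrow> 'n)"
proof -
  have "\<exists>f :: 'n idx \<Rightarrow> 'n. bij f"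
    using finite_same_card_bij[of "UNIV :: 'n idx set" "UNIV :: 'n set"] by (auto simp: card_idx)
  then show ?thesis unfolding renum_def by (rule someI_ex)
qed

definition renum_vec :: "real^'n \<Rightarrow> real^('n::finite idx)" where
  "renum_vec v = (\<chi> i. v $ renum i)"

definition unrenum_vec :: "real^('n::finite idx) \<Rightarrow> real^'n" where
  "unrenum_vec v = (\<chi> i. v $ inv renum i)"

lemma renum_inv [simp]: "unrenum_vec (renum_vec v) = v" "renum_vec (unrenum_vec w) = w"
  by (simp_all add: vec_eq_iff renum_vec_def unrenum_vec_def surj_f_inv_f[OF bij_is_surj[OF bij_renum]]
      inv_f_f[OF bij_is_inj[OF bij_renum]])

lemma linear_renum: "linear renum_vec" and linear_unrenum: "linear unrenum_vec"
  by (simp_all add: linear_iff vec_eq_iff renum_vec_def unrenum_vec_def)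

lemma unrenum_vec_measurable: "unrenum_vec \<in> borel_measurable borel"
  by (auto intro!: borel_measurable_continuous_onI linear_continuous_on
      simp: linear_unrenum linear_conv_bounded_linear[symmetric])

lemma prod_Basis_vec: "(\<Prod>b\<in>(Basis :: (real^'n) set). f b) = (\<Prod>i\<in>UNIV. f (axis i 1))"
proof -
  have B: "(Basis :: (real^'n) set) = (\<lambda>i. axis i 1) ` UNIV" by (auto simp: Basis_vec_def)
  have "inj (\<lambda>i::'n. axis i (1::real))" by (auto simp: inj_on_def axis_eq_axis)
  from prod.reindex[OF this, of f] show ?thesis unfolding B by (simp add: o_def)
qed

lemma lborel_unrenum: "(lborel :: (real^'n) measure) = distr lborel borel unrenum_vec"
proof (rule lborel_eqI)
  fix l u :: "real^'n"
  assume le: "\<And>b. b \<in> Basis \<Longrightarrow> l \<bullet> b \<le> u \<bullet> b"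
  have le': "l $ i \<le> u $ i" for i using le[of "axis i 1"] by (simp add: inner_axis)
  have "unrenum_vec -` box l u = box (renum_vec l) (renum_vec u)"
  proof -
    have "(\<forall>i. P (inv renum i :: 'n idx) (i :: 'n)) \<longleftrightarrow> (\<forall>j. P j (renum j))" for P
      by (metis bij_renum bij_inv_eq_iff)
    from this[of "\<lambda>j i. l $ i < x $ j \<and> x $ j < u $ i" for x]
    show ?thesis by (auto simp: mem_box Basis_vec_def inner_axis unrenum_vec_def renum_vec_def)
  qed
  then have "emeasure (distr lborel borel unrenum_vec) (box l u) = emeasure lborel (box (renum_vec l) (renum_vec u))"
    by (simp add: emeasure_distr unrenum_vec_measurable)
  also have "\<dots> = (\<Prod>b\<in>Basis. (renum_vec u - renum_vec l) \<bullet> b)"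
  proof (rule emeasure_lborel_box)
    fix b :: "real^('n idx)" assume "b \<in> Basis"
    then obtain i where "b = axis i 1" by (auto simp: Basis_vec_def)
    then show "renum_vec l \<bullet> b \<le> renum_vec u \<bullet> b" by (simp add: renum_vec_def inner_axis le')
  qed
  also have "(\<Prod>b\<in>Basis. (renum_vec u - renum_vec l) \<bullet> b) = (\<Prod>i\<in>UNIV. (u - l) $ renum i)"
    by (simp add: prod_Basis_vec inner_axis renum_vec_def)
  also have "\<dots> = (\<Prod>i\<in>UNIV. (u - l) $ i)"
    by (rule prod.reindex_bij_betw[OF bij_renum])
  also have "\<dots> = (\<Prod>b\<in>Basis. (u - l) \<bullet> b)"
    by (simp add: prod_Basis_vec inner_axis)
  finally show "emeasure (distr lborel borel unrenum_vec) (box l u) = ennreal (\<Prod>b\<in>Basis. (u - l) \<bullet> b)" .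
qed simp

lemma nn_integral_unrenum:
  fixes h :: "real^'n \<Rightarrow> ennreal"
  assumes "h \<in> borel_measurable borel"
  shows "(\<integral>\<^sup>+y. h y \<partial>lborel) = (\<integral>\<^sup>+z. h (unrenum_vec z) \<partial>lborel)"
  by (subst lborel_unrenum, subst nn_integral_distr) (use assms unrenum_vec_measurable in auto)

lemma det_renum:
  fixes B :: "real^'n^'n"
  shows "det (\<chi> i j. B $ renum i $ renum j) = det B"
proof -
  let ?r = "renum :: 'n idx \<Rightarrow> 'n"
  let ?F = "map_permutation UNIV ?r"
  have bij: "bij_betw ?F {p. p permutes UNIV} {p. p permutes UNIV}"
  proof (rule bij_betwI[where g = "map_permutation UNIV (inv ?r)"])
    show "?F \<in> {p. p permutes UNIV} \<rightarrow> {p. p permutes UNIV}"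
      using map_permutation_permutes[OF bij_renum] by auto
    show "map_permutation UNIV (inv ?r) \<in> {p. p permutes UNIV} \<rightarrow> {p. p permutes UNIV}"
      using map_permutation_permutes[OF bij_imp_bij_inv[OF bij_renum]] by auto
    show "map_permutation UNIV (inv ?r) (?F p) = p" if "p \<in> {p. p permutes UNIV}" for p
      by (rule map_permutation_compose_inv[OF bij_renum]) (use that in \<open>auto simp: inv_f_f[OF bij_is_inj[OF bij_renum]]\<close>)
    show "?F (map_permutation UNIV (inv ?r) p) = p" if "p \<in> {p. p permutes UNIV}" for p
      by (rule map_permutation_compose_inv[OF bij_imp_bij_inv[OF bij_renum]])
        (use that in \<open>auto simp: surj_f_inv_f[OF bij_is_surj[OF bij_renum]]\<close>)
  qed
  have "det B = (\<Sum>p\<in>{p. p permutes UNIV}. of_int (sign (?F p)) * (\<Prod>i\<in>UNIV. B $ i $ ?F p i))"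
    unfolding det_def by (rule sum.reindex_bij_betw[OF bij, symmetric])
  also have "\<dots> = (\<Sum>p\<in>{p. p permutes UNIV}. of_int (sign p) * (\<Prod>i\<in>UNIV. B $ ?r i $ ?r (p i)))"
  proof (rule sum.cong[OF refl])
    fix p :: "'n idx \<Rightarrow> 'n idx" assume "p \<in> {p. p permutes UNIV}"
    then have "sign (?F p) = sign p"
      by (intro sign_map_permutation) (auto simp: bij_is_inj[OF bij_renum])
    moreover have "(\<Prod>i\<in>UNIV. B $ i $ ?F p i) = (\<Prod>i\<in>UNIV. B $ ?r i $ ?F p (?r i))"
      by (rule prod.reindex_bij_betw[OF bij_renum, symmetric])
    moreover have "?F p (?r i) = ?r (p i)" for i
      by (rule map_permutation_apply) (auto simp: bij_is_inj[OF bij_renum])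
    ultimately show "of_int (sign (?F p)) * (\<Prod>i\<in>UNIV. B $ i $ ?F p i) =
        (of_int (sign p) * (\<Prod>i\<in>UNIV. B $ ?r i $ ?r (p i)) :: real)" by simp
  qed
  finally show ?thesis by (simp add: det_def)
qed

text \<open>With this dichotomy an equality of nonnegative Lebesgue integrals follows from the change of variables for
  absolutely integrable functions, even if both sides are infinite.\<close>

lemma nn_integral_set_eq_integral_or_infinity:
  fixes f :: "'a::euclidean_space \<Rightarrow> real"
  assumes m: "(\<lambda>x. ennreal (f x) * indicator S x) \<in> borel_measurable borel" and nn: "\<And>x. x \<in> S \<Longrightarrow> 0 \<le> f x"
  shows "(\<integral>\<^sup>+x\<in>S. f x \<partial>lborel) = (if f absolutely_integrable_on S then ennreal (integral S f) else \<infinity>)"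
proof (cases "f absolutely_integrable_on S")
  case True
  then have "(f has_integral integral S f) S"
    using set_lebesgue_integral_eq_integral(1) integrable_integral by blast
  with nn_integral_has_integral_lebesgue'[of S f] nn True show ?thesis by simp
next
  case False
  let ?F = "\<lambda>x. if x \<in> S then f x else 0"
  have e: "ennreal (f x) * indicator S x = ennreal (?F x)" for x by (auto split: split_indicator)
  have "(\<lambda>x. enn2real (ennreal (f x) * indicator S x)) \<in> borel_measurable borel"
    using m by measurable
  moreover have "enn2real (ennreal (f x) * indicator S x) = ?F x" for x
    using nn by (auto split: split_indicator)
  ultimately have FM: "?F \<in> borel_measurable borel" by simp
  have "(\<integral>\<^sup>+x. ?F x \<partial>lborel) = \<infinity>"
  proof (rule ccontr)
    assume "(\<integral>\<^sup>+x. ?F x \<partial>lborel) \<noteq> \<infinity>"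
    then obtain r where "(\<integral>\<^sup>+x. ?F x \<partial>lborel) = ennreal r" "0 \<le> r"
      by (cases "\<integral>\<^sup>+x. ?F x \<partial>lborel" rule: ennreal_cases) auto
    then have "(?F has_integral r) UNIV"
      using nn by (intro nn_integral_has_integral[OF FM]) auto
    then have "(f has_integral r) S" by (simp add: has_integral_restrict_UNIV)
    then have "f absolutely_integrable_on S"
      using nn by (intro nonnegative_absolutely_integrable_1) auto
    with False show False ..
  qed
  then show ?thesis using False by (simp add: e)
qed

lemma nn_integral_change_of_variables_wellorder:
  fixes f :: "real^'m::{finite,wellorder} \<Rightarrow> real" and \<phi> :: "real^'m::_ \<Rightarrow> real^'m::_"
  assumes S: "S \<in> sets borel" and der: "\<And>x. x \<in> S \<Longrightarrow> (\<phi> has_derivative \<phi>' x) (at x)" and inj: "inj_on \<phi> S"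
    and m: "(\<lambda>x. ennreal (f x) * indicator (\<phi> ` S) x) \<in> borel_measurable borel"
      "(\<lambda>x. ennreal (\<bar>det (matrix (\<phi>' x))\<bar> * f (\<phi> x)) * indicator S x) \<in> borel_measurable borel"
    and nn: "\<And>x. x \<in> \<phi> ` S \<Longrightarrow> 0 \<le> f x"
  shows "(\<integral>\<^sup>+x\<in>\<phi> ` S. f x \<partial>lborel) = (\<integral>\<^sup>+x\<in>S. \<bar>det (matrix (\<phi>' x))\<bar> * f (\<phi> x) \<partial>lborel)"
proof -
  have der': "(\<phi> has_derivative \<phi>' x) (at x within S)" if "x \<in> S" for x
    using der[OF that] by (rule has_derivative_at_withinI)
  have SL: "S \<in> sets lebesgue" using S by auto
  have cov: "(\<lambda>x. \<bar>det (matrix (\<phi>' x))\<bar> * f (\<phi> x)) absolutely_integrable_on S \<and>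
         integral S (\<lambda>x. \<bar>det (matrix (\<phi>' x))\<bar> * f (\<phi> x)) = b
     \<longleftrightarrow> f absolutely_integrable_on (\<phi> ` S) \<and> integral (\<phi> ` S) f = b" for b
  proof -
    have "(\<lambda>x. \<bar>det (matrix (\<phi>' x))\<bar> *\<^sub>R (vec (f (\<phi> x)) :: real^1)) absolutely_integrable_on S \<and>
           integral S (\<lambda>x. \<bar>det (matrix (\<phi>' x))\<bar> *\<^sub>R vec (f (\<phi> x))) = (vec b :: real^1)
         \<longleftrightarrow> (\<lambda>x. vec (f x) :: real^1) absolutely_integrable_on (\<phi> ` S) \<and>
           integral (\<phi> ` S) (\<lambda>x. vec (f x)) = (vec b :: real^1)"
      by (rule has_absolute_integral_change_of_variables[OF SL der' inj])
    then show ?thesis by (simp add: absolutely_integrable_on_1_iff integral_on_1_eq)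
  qed
  have nn': "0 \<le> \<bar>det (matrix (\<phi>' x))\<bar> * f (\<phi> x)" if "x \<in> S" for x
    using nn that by (auto intro!: mult_nonneg_nonneg)
  have iff: "(\<lambda>x. \<bar>det (matrix (\<phi>' x))\<bar> * f (\<phi> x)) absolutely_integrable_on S
      \<longleftrightarrow> f absolutely_integrable_on (\<phi> ` S)" using cov by blast
  have eq: "integral S (\<lambda>x. \<bar>det (matrix (\<phi>' x))\<bar> * f (\<phi> x)) = integral (\<phi> ` S) f"
    if "f absolutely_integrable_on (\<phi> ` S)" using cov that by blast
  have 1: "(\<integral>\<^sup>+x\<in>\<phi> ` S. f x \<partial>lborel) =
      (if f absolutely_integrable_on \<phi> ` S then ennreal (integral (\<phi> ` S) f) else \<infinity>)"
    by (rule nn_integral_set_eq_integral_or_infinity[OF m(1) nn])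
  have 2: "(\<integral>\<^sup>+x\<in>S. \<bar>det (matrix (\<phi>' x))\<bar> * f (\<phi> x) \<partial>lborel) =
      (if (\<lambda>x. \<bar>det (matrix (\<phi>' x))\<bar> * f (\<phi> x)) absolutely_integrable_on S
       then ennreal (integral S (\<lambda>x. \<bar>det (matrix (\<phi>' x))\<bar> * f (\<phi> x))) else \<infinity>)"
    by (rule nn_integral_set_eq_integral_or_infinity[OF m(2) nn'])
  show ?thesis unfolding 1 2 iff using eq by (cases "f absolutely_integrable_on \<phi> ` S") simp_all
qed

lemma nn_integral_change_of_variables:
  fixes f :: "real^'n \<Rightarrow> real" and \<phi> :: "real^'n \<Rightarrow> real^'n"
  assumes S: "S \<in> sets borel" and der: "\<And>x. x \<in> S \<Longrightarrow> (\<phi> has_derivative \<phi>' x) (at x)" and inj: "inj_on \<phi> S"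
    and m: "(\<lambda>x. ennreal (f x) * indicator (\<phi> ` S) x) \<in> borel_measurable borel"
      "(\<lambda>x. ennreal (\<bar>det (matrix (\<phi>' x))\<bar> * f (\<phi> x)) * indicator S x) \<in> borel_measurable borel"
    and nn: "\<And>x. x \<in> \<phi> ` S \<Longrightarrow> 0 \<le> f x"
  shows "(\<integral>\<^sup>+x\<in>\<phi> ` S. f x \<partial>lborel) = (\<integral>\<^sup>+x\<in>S. \<bar>det (matrix (\<phi>' x))\<bar> * f (\<phi> x) \<partial>lborel)"
proof -
  let ?T = "renum_vec :: real^'n \<Rightarrow> _" and ?T' = "unrenum_vec :: _ \<Rightarrow> real^'n"
  let ?\<phi> = "\<lambda>z. ?T (\<phi> (?T' z))" and ?\<phi>' = "\<lambda>z w. ?T (\<phi>' (?T' z) (?T' w))"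
  have bl: "bounded_linear ?T" "bounded_linear ?T'"
    by (simp_all add: linear_conv_bounded_linear[symmetric] linear_renum linear_unrenum)
  have det: "det (matrix (?\<phi>' z)) = det (matrix (\<phi>' (?T' z)))" for z
  proof -
    have "inv renum i = j \<longleftrightarrow> i = renum j" for i :: 'n and j
      by (metis bij_renum bij_inv_eq_iff)
    then have e: "?T' (axis j 1) = axis (renum j) 1" for j
      by (simp add: unrenum_vec_def vec_eq_iff axis_def)
    have "matrix (?\<phi>' z) = (\<chi> i j. matrix (\<phi>' (?T' z)) $ renum i $ renum j)"
      by (intro vec_eq_iff[THEN iffD2] allI) (simp add: matrix_def renum_vec_def e)
    then show ?thesis by (simp add: det_renum)
  qed
  have im: "?\<phi> ` (?T ` S) = ?T ` \<phi> ` S" by (auto simp: image_image)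
  have mem: "z \<in> ?T ` R \<longleftrightarrow> ?T' z \<in> R" for z R by (metis image_iff renum_inv)
  have ind: "indicator (?T ` R) z = (indicator R (?T' z) :: ennreal)" for z R
    by (simp add: indicator_def mem)
  have S': "?T ` S \<in> sets borel"
  proof -
    have "?T ` S = ?T' -` S" using mem by auto
    then show ?thesis using measurable_sets[OF unrenum_vec_measurable S] by simp
  qed
  have "(\<integral>\<^sup>+z\<in>?\<phi> ` (?T ` S). f (?T' z) \<partial>lborel) =
      (\<integral>\<^sup>+z\<in>?T ` S. \<bar>det (matrix (?\<phi>' z))\<bar> * f (?T' (?\<phi> z)) \<partial>lborel)"
  proof (rule nn_integral_change_of_variables_wellorder[OF S'])
    show "(?\<phi> has_derivative ?\<phi>' z) (at z)" if "z \<in> ?T ` S" for z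
      using that by (intro bounded_linear.has_derivative[OF bl(1)] has_derivative_compose[OF
        bounded_linear_imp_has_derivative[OF bl(2)] der]) (simp add: mem)
    show "inj_on ?\<phi> (?T ` S)"
    proof (rule inj_onI)
      fix a b assume "a \<in> ?T ` S" "b \<in> ?T ` S" "?\<phi> a = ?\<phi> b"
      then have "\<phi> (?T' a) = \<phi> (?T' b)" "?T' a \<in> S" "?T' b \<in> S" by (metis renum_inv(1), simp_all add: mem)
      then have "?T' a = ?T' b" using inj by (auto dest: inj_onD)
      then show "a = b" by (metis renum_inv(2))
    qed
    show "(\<lambda>z. ennreal (f (?T' z)) * indicator (?\<phi> ` ?T ` S) z) \<in> borel_measurable borel"
      unfolding im ind using measurable_compose[OF unrenum_vec_measurable m(1)] by simp
    show "(\<lambda>z. ennreal (\<bar>det (matrix (?\<phi>' z))\<bar> * f (?T' (?\<phi> z))) * indicator (?T ` S) z) \<in> borel_measurable borel"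
      unfolding ind det renum_inv using measurable_compose[OF unrenum_vec_measurable m(2)] by simp
    show "0 \<le> f (?T' z)" if "z \<in> ?\<phi> ` ?T ` S" for z
      using that nn unfolding im by (simp add: mem)
  qed
  then show ?thesis
    unfolding im ind det renum_inv
    using nn_integral_unrenum[OF m(1)] nn_integral_unrenum[OF m(2)] by simp
qed

subsection \<open>Existence of the volume measure\<close>

definition sqrt_det :: "('m, 'n::finite) tensor \<Rightarrow> ('m, 'n) chart \<Rightarrow> real^'n \<Rightarrow> real" where
  "sqrt_det g c x = sqrt (det (g c (point c x)))"

text \<open>The density vanishes outside the image of the chart, so the value \<open>undefined\<close> carries no mass.\<close>

definition chart_volume :: "('m::t2_space, 'n::finite) tensor \<Rightarrow> ('m, 'n) chart \<Rightarrow> 'm measure" where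
  "chart_volume g c = distr (density lborel (\<lambda>x. ennreal (sqrt_det g c x) * indicator (img_c c) x)) borel
     (\<lambda>x. if x \<in> img_c c then point c x else undefined)"

context
  fixes A :: "('m::t2_space, 'n::finite) chart set"
  assumes atlas: "smooth_atlas A"
begin

lemma open_coord_image: assumes c: "c \<in> A" and W: "open W" "W \<subseteq> dom_c c" shows "open (coord c ` W)"
proof -
  have "openin (top_of_set (img_c c)) (coord c ` W)"
    by (rule homeomorphism_imp_open_map[OF atlas_homeo[OF atlas c]])
      (use W open_dom[OF atlas c] in \<open>simp add: openin_open_eq\<close>)
  then show ?thesis using open_img[OF atlas c] by (simp add: openin_open_eq)
qed

lemma point_continuous: "c \<in> A \<Longrightarrow> continuous_on (img_c c) (point c)"
  by (rule homeomorphism_cont2[OF atlas_homeo[OF atlas]])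

lemma coord_continuous: "c \<in> A \<Longrightarrow> continuous_on (dom_c c) (coord c)"
  by (rule homeomorphism_cont1[OF atlas_homeo[OF atlas]])

lemma point_measurable:
  assumes c: "c \<in> A"
  shows "(\<lambda>x. if x \<in> img_c c then point c x else undefined) \<in> borel_measurable borel"
  using borel_measurable_continuous_on_restrict[OF point_continuous[OF c]] open_img[OF atlas c]
  by (intro measurable_If_restrict_space_iff[THEN iffD2]) auto

lemma coord_image_eq:
  assumes c: "c \<in> A"
  shows "coord c ` (B \<inter> dom_c c) = (\<lambda>x. if x \<in> img_c c then point c x else undefined) -` B \<inter> img_c c"
  using point_coord[OF atlas c] coord_point[OF atlas c] point_in_dom[OF atlas c]
  by (force simp: img_c_def)

lemma coord_image_borel:
  assumes c: "c \<in> A" and B: "B \<in> sets borel"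
  shows "coord c ` (B \<inter> dom_c c) \<in> sets borel"
  unfolding coord_image_eq[OF c]
  using measurable_sets[OF point_measurable[OF c] B] open_img[OF atlas c] by auto

lemma sqrt_det_continuous:
  assumes g: "g \<in> Met A" and c: "c \<in> A"
  shows "continuous_on (img_c c) (sqrt_det g c)"
  unfolding sqrt_det_def[abs_def]
  by (intro continuous_on_real_sqrt smooth_on_continuous[OF smooth_on_det[OF open_img[OF atlas c]]]
      smooth_on_vec_nth[OF open_img[OF atlas c]] Met_smooth[OF atlas g c])

lemma sqrt_det_measurable:
  assumes g: "g \<in> Met A" and c: "c \<in> A"
  shows "(\<lambda>x. ennreal (sqrt_det g c x) * indicator (img_c c) x) \<in> borel_measurable borel"
proof -
  have "(\<lambda>x. indicator (img_c c) x *\<^sub>R sqrt_det g c x) \<in> borel_measurable borel"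
    by (rule borel_measurable_continuous_on_indicator[OF _ sqrt_det_continuous[OF g c]])
      (use open_img[OF atlas c] in auto)
  then have "(\<lambda>x. ennreal (indicator (img_c c) x *\<^sub>R sqrt_det g c x)) \<in> borel_measurable borel"
    by measurable
  moreover have "ennreal (indicator (img_c c) x *\<^sub>R sqrt_det g c x) = ennreal (sqrt_det g c x) * indicator (img_c c) x" for x
    by (auto split: split_indicator)
  ultimately show ?thesis by simp
qed

lemma emeasure_chart_volume:
  assumes g: "g \<in> Met A" and c: "c \<in> A" and B: "B \<in> sets borel"
  shows "emeasure (chart_volume g c) B = (\<integral>\<^sup>+x\<in>coord c ` (B \<inter> dom_c c). sqrt_det g c x \<partial>lborel)"
proof -
  let ?P = "\<lambda>x. if x \<in> img_c c then point c x else undefined"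
  have m: "?P -` B \<in> sets borel" using measurable_sets[OF point_measurable[OF c] B] by simp
  have "emeasure (chart_volume g c) B
     = emeasure (density lborel (\<lambda>x. ennreal (sqrt_det g c x) * indicator (img_c c) x)) (?P -` B)"
    unfolding chart_volume_def using point_measurable[OF c] B by (subst emeasure_distr) auto
  also have "\<dots> = (\<integral>\<^sup>+x. (ennreal (sqrt_det g c x) * indicator (img_c c) x) * indicator (?P -` B) x \<partial>lborel)"
    using m sqrt_det_measurable[OF g c] by (subst emeasure_density) auto
  also have "\<dots> = (\<integral>\<^sup>+x\<in>coord c ` (B \<inter> dom_c c). sqrt_det g c x \<partial>lborel)"
    unfolding coord_image_eq[OF c] by (intro nn_integral_cong) (auto split: split_indicator)
  finally show ?thesis .
qed

lemma sets_chart_volume: "sets (chart_volume g c) = sets borel"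
  by (simp add: chart_volume_def)

text \<open>The transformation law of the metric gives \<open>sqrt_det\<close> a factor \<open>|det J|\<close>, the one that the change of
  variables formula compensates.\<close>

lemma chart_volume_overlap:
  assumes g: "g \<in> Met A" and c: "c \<in> A" and d: "d \<in> A" and B: "B \<in> sets borel" "B \<subseteq> dom_c c" "B \<subseteq> dom_c d"
  shows "emeasure (chart_volume g c) B = emeasure (chart_volume g d) B"
proof -
  interpret chart_change "img_c c" "img_c d" "coord c ` (dom_c c \<inter> dom_c d)" "loc g c" "loc g d" "coord d \<circ> point c"
    by (rule chart_change_loc[OF atlas g c d])
  let ?\<phi> = "coord d \<circ> point c" and ?S = "coord c ` B"
  have int: "B \<inter> dom_c c = B" "B \<inter> dom_c d = B" using B by auto
  have sub: "x \<in> coord c ` (dom_c c \<inter> dom_c d)" if "x \<in> ?S" for x using that B by auto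
  have im: "?\<phi> ` ?S = coord d ` B" using B by (auto simp: image_image point_coord[OF atlas c] subset_iff)
  have S: "?S \<in> sets borel" "coord d ` B \<in> sets borel"
    using coord_image_borel[OF c B(1)] coord_image_borel[OF d B(1)] by (simp_all add: int)
  have e: "\<bar>det (matrix (dd ?\<phi> x))\<bar> * sqrt_det g d (?\<phi> x) = sqrt_det g c x" if "x \<in> ?S" for x
  proof -
    have "det (g c (point c x)) = (det (matrix (dd ?\<phi> x)))\<^sup>2 * det (g d (point d (?\<phi> x)))"
      using law[OF sub[OF that]] by (simp add: det_mul power2_eq_square)
    then show ?thesis by (simp add: sqrt_det_def real_sqrt_mult)
  qed
  have mm: "(\<lambda>x. ennreal (sqrt_det g c' x) * indicator T x) \<in> borel_measurable borel"
    if "c' \<in> A" "T \<in> sets borel" "T \<subseteq> img_c c'" for c' T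
  proof -
    have "(\<lambda>x. (ennreal (sqrt_det g c' x) * indicator (img_c c') x) * indicator T x) \<in> borel_measurable borel"
      using sqrt_det_measurable[OF g that(1)] that(2) by measurable
    moreover have "(ennreal (sqrt_det g c' x) * indicator (img_c c') x) * indicator T x
       = ennreal (sqrt_det g c' x) * indicator T x" for x
      using that(3) by (auto split: split_indicator)
    ultimately show ?thesis by simp
  qed
  have "(\<integral>\<^sup>+x\<in>?\<phi> ` ?S. sqrt_det g d x \<partial>lborel) = (\<integral>\<^sup>+x\<in>?S. \<bar>det (matrix (dd ?\<phi> x))\<bar> * sqrt_det g d (?\<phi> x) \<partial>lborel)"
  proof (rule nn_integral_change_of_variables[OF S(1)])
    show "(?\<phi> has_derivative dd ?\<phi> x) (at x)" if "x \<in> ?S" for x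
      by (rule smooth_on_has_derivative[OF \<phi> sub[OF that]])
    show "inj_on ?\<phi> ?S"
    proof (rule inj_onI)
      fix x y assume "x \<in> ?S" "y \<in> ?S" and xy: "?\<phi> x = ?\<phi> y"
      then obtain p q where "p \<in> B" "q \<in> B" "x = coord c p" "y = coord c q" by auto
      moreover then have "coord d p = coord d q"
        using xy B by (simp add: point_coord[OF atlas c] subset_iff)
      then have "p = q" using \<open>p \<in> B\<close> \<open>q \<in> B\<close> B by (metis point_coord[OF atlas d] subsetD)
      ultimately show "x = y" by simp
    qed
    show "(\<lambda>x. ennreal (sqrt_det g d x) * indicator (?\<phi> ` ?S) x) \<in> borel_measurable borel"
      unfolding im by (rule mm[OF d S(2)]) (use B in \<open>auto simp: img_c_def\<close>)
    have "(\<lambda>x. ennreal (sqrt_det g c x) * indicator ?S x) \<in> borel_measurable borel"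
      by (rule mm[OF c S(1)]) (use B in \<open>auto simp: img_c_def\<close>)
    moreover have "ennreal (\<bar>det (matrix (dd ?\<phi> x))\<bar> * sqrt_det g d (?\<phi> x)) * indicator ?S x
        = ennreal (sqrt_det g c x) * indicator ?S x" for x
      using e[of x] by (cases "x \<in> ?S") simp_all
    ultimately show "(\<lambda>x. ennreal (\<bar>det (matrix (dd ?\<phi> x))\<bar> * sqrt_det g d (?\<phi> x)) * indicator ?S x) \<in> borel_measurable borel"
      by simp
    show "0 \<le> sqrt_det g d x" if "x \<in> ?\<phi> ` ?S" for x
    proof -
      have "x \<in> img_c d" using that B unfolding im by (auto simp: img_c_def)
      then show ?thesis using pos_sym_det[OF Met_pos[OF atlas g d point_in_dom[OF atlas d]]]
        by (simp add: sqrt_det_def less_imp_le)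
    qed
  qed
  also have "\<dots> = (\<integral>\<^sup>+x\<in>?S. sqrt_det g c x \<partial>lborel)"
  proof (rule nn_integral_cong)
    fix x
    show "ennreal (\<bar>det (matrix (dd ?\<phi> x))\<bar> * sqrt_det g d (?\<phi> x)) * indicator ?S x
        = ennreal (sqrt_det g c x) * indicator ?S x"
      using e[of x] by (cases "x \<in> ?S") simp_all
  qed
  finally have "(\<integral>\<^sup>+x\<in>coord d ` B. sqrt_det g d x \<partial>lborel) = (\<integral>\<^sup>+x\<in>?S. sqrt_det g c x \<partial>lborel)"
    unfolding im .
  then show ?thesis
    by (simp add: emeasure_chart_volume[OF g c B(1)] emeasure_chart_volume[OF g d B(1)] int)
qed

lemma is_volume_iff:
  assumes g: "g \<in> Met A"
  shows "is_volume A g \<mu> \<longleftrightarrow> sets \<mu> = sets borel \<and>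
    (\<forall>c\<in>A. \<forall>B\<in>sets borel. B \<subseteq> dom_c c \<longrightarrow> emeasure \<mu> B = emeasure (chart_volume g c) B)"
proof -
  have "emeasure (chart_volume g c) B = (\<integral>\<^sup>+ x\<in>coord c ` B. ennreal (sqrt (det (g c (point c x)))) \<partial>lborel)"
    if "c \<in> A" "B \<in> sets borel" "B \<subseteq> dom_c c" for c B
    using emeasure_chart_volume[OF g that(1,2)] that(3) by (simp add: sqrt_det_def Int_absorb2)
  then show ?thesis unfolding is_volume_def by auto
qed

text \<open>A finite cover by charts is cut into disjoint Borel pieces; the overlap formula shows that
  the sum of the pieces is right in every chart.\<close>

lemma is_volume_exists:
  assumes g: "g \<in> Met A" and comp: "compact (UNIV :: 'm set)"
  shows "\<exists>\<mu>. is_volume A g \<mu>"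
proof -
  have cover: "(UNIV :: 'm set) \<subseteq> (\<Union>c\<in>A. dom_c c)" using atlas by (simp add: smooth_atlas_def)
  obtain F where F: "F \<subseteq> A" "finite F" "UNIV \<subseteq> (\<Union>c\<in>F. dom_c c)"
    using compactE_image[OF comp open_dom[OF atlas] cover] by metis
  obtain cs where cs: "set cs = F" using finite_list[OF F(2)] by auto
  define N where "N = length cs"
  define E where "E i = (if i < N then dom_c (cs ! i) else {})" for i
  define D where "D = disjointed E"
  have csA: "cs ! i \<in> A" if "i < N" for i using that F(1) cs by (auto simp: N_def)
  have Eb: "E i \<in> sets borel" for i using open_dom[OF atlas csA] by (auto simp: E_def)
  then have Db: "D i \<in> sets borel" for i
    using sets.range_disjointed_sets[of E borel] by (auto simp: D_def)
  have Dsub: "D i \<subseteq> dom_c (cs ! i)" if "i < N" for i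
    using disjointed_subset[of E i] that by (simp add: D_def E_def)
  have Dz: "D i = {}" if "\<not> i < N" for i
    using disjointed_subset[of E i] that by (simp add: D_def E_def)
  have DU: "(\<Union>i<N. D i) = UNIV"
  proof -
    have "(\<Union>i. D i) = (\<Union>i. E i)" by (simp add: D_def UN_disjointed_eq)
    also have "\<dots> = UNIV"
    proof -
      have "p \<in> (\<Union>i. E i)" for p
      proof -
        have "p \<in> (\<Union>c\<in>F. dom_c c)" using F(3) by blast
        then obtain c where "c \<in> set cs" "p \<in> dom_c c" unfolding cs[symmetric] by blast
        then obtain i where "i < N" "c = cs ! i" by (auto simp: in_set_conv_nth N_def)
        with \<open>p \<in> dom_c c\<close> show ?thesis by (auto simp: E_def)
      qed
      then show ?thesis by auto
    qed
    finally have U: "(\<Union>i. D i) = UNIV" .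
    have "x \<in> (\<Union>i<N. D i)" for x
    proof -
      have "x \<in> (\<Union>i. D i)" unfolding U by simp
      then obtain i where i: "x \<in> D i" by blast
      then have "i < N" using Dz[of i] by (cases "i < N") auto
      with i show ?thesis by blast
    qed
    then show ?thesis by blast
  qed
  have Ddisj: "disjoint_family_on D {..<N}"
    using disjoint_family_disjointed[of E] by (auto simp: D_def disjoint_family_on_def)
  let ?\<nu> = "\<lambda>i. chart_volume g (cs ! i)"
  let ?m = "\<lambda>B. \<Sum>i<N. emeasure (?\<nu> i) (B \<inter> D i)"
  define \<mu> where "\<mu> = measure_of UNIV (sets borel) ?m"
  have em: "emeasure \<mu> B = ?m B" if "B \<in> sets borel" for B :: "'m set"
    unfolding \<mu>_def
  proof (rule emeasure_measure_of_sigma)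
    show "sigma_algebra UNIV (sets (borel :: 'm measure))"
      using sets.sigma_algebra_axioms[of "borel :: 'm measure"] by simp
    show "positive (sets borel) ?m" by (simp add: positive_def)
    show "countably_additive (sets borel) ?m"
    proof (rule countably_additiveI)
      fix S :: "nat \<Rightarrow> 'm set"
      assume S: "range S \<subseteq> sets borel" "disjoint_family S" "(\<Union>i. S i) \<in> sets borel"
      have "(\<Sum>n. emeasure (?\<nu> i) (S n \<inter> D i)) = emeasure (?\<nu> i) ((\<Union>n. S n) \<inter> D i)" for i
      proof -
        have "(\<Sum>n. emeasure (?\<nu> i) (S n \<inter> D i)) = emeasure (?\<nu> i) (\<Union>n. S n \<inter> D i)"
          by (rule suminf_emeasure)
            (use S Db in \<open>auto simp: sets_chart_volume disjoint_family_on_def\<close>)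
        then show ?thesis by simp
      qed
      then show "(\<Sum>n. ?m (S n)) = ?m (\<Union>n. S n)"
        by (subst suminf_sum) simp_all
    qed
    show "B \<in> sets borel" by fact
  qed
  have "is_volume A g \<mu>"
    unfolding is_volume_iff[OF g]
  proof (intro conjI ballI impI)
    have "sets \<mu> = sigma_sets UNIV (sets (borel :: 'm measure))"
      unfolding \<mu>_def by (rule sets_measure_of) simp
    then show "sets \<mu> = sets borel"
      using sets.sigma_sets_eq[of "borel :: 'm measure"] by simp
    fix c and B :: "'m set" assume c: "c \<in> A" and B: "B \<in> sets borel" "B \<subseteq> dom_c c"
    have "emeasure \<mu> B = (\<Sum>i<N. emeasure (chart_volume g c) (B \<inter> D i))"
      unfolding em[OF B(1)]
      by (intro sum.cong refl chart_volume_overlap[OF g csA c]) (use B Db Dsub in auto)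
    also have "\<dots> = emeasure (chart_volume g c) (\<Union>i<N. B \<inter> D i)"
    proof (rule sum_emeasure)
      show "(\<lambda>i. B \<inter> D i) ` {..<N} \<subseteq> sets (chart_volume g c)"
        using B Db by (auto simp: sets_chart_volume)
      show "disjoint_family_on (\<lambda>i. B \<inter> D i) {..<N}"
        using Ddisj unfolding disjoint_family_on_def by blast
    qed simp
    also have "(\<Union>i<N. B \<inter> D i) = B" using DU by auto
    finally show "emeasure \<mu> B = emeasure (chart_volume g c) B" .
  qed
  then show ?thesis ..
qed

lemma vol_is_volume:
  assumes "g \<in> Met A" "compact (UNIV :: 'm set)" shows "is_volume A g (vol A g)"
  unfolding vol_def by (rule someI_ex[OF is_volume_exists[OF assms]])

subsection \<open>Integrals of continuous functions\<close>

lemma continuous_on_charts: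
  fixes F :: "'m \<Rightarrow> real"
  assumes "\<And>c. c \<in> A \<Longrightarrow> continuous_on (img_c c) (\<lambda>x. F (point c x))"
  shows "continuous_on UNIV F"
proof -
  have "continuous_on (dom_c c) F" if c: "c \<in> A" for c
  proof -
    have "continuous_on (dom_c c) (\<lambda>p. F (point c (coord c p)))"
      by (rule continuous_on_compose2[OF assms[OF c] coord_continuous[OF c]]) (auto simp: img_c_def)
    then show ?thesis by (rule continuous_on_eq) (simp add: point_coord[OF atlas c])
  qed
  then have "continuous_on (\<Union>c\<in>A. dom_c c) F"
    by (intro continuous_on_open_UN) (auto simp: open_dom[OF atlas])
  then show ?thesis using atlas by (simp add: smooth_atlas_def)
qed

lemma integral_vol_box:
  fixes F :: "'m \<Rightarrow> real"
  assumes g: "g \<in> Met A" and comp: "compact (UNIV :: 'm set)" and c: "c \<in> A"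
    and F: "continuous_on UNIV F" and box: "cbox a b \<subseteq> img_c c"
    and zero: "\<And>p. p \<notin> point c ` cbox a b \<Longrightarrow> F p = 0"
  shows "integrable (vol A g) F"
    and "(\<integral>p. F p \<partial>vol A g) = integral (cbox a b) (\<lambda>x. F (point c x) * sqrt_det g c x)"
proof -
  let ?\<mu> = "vol A g"
  let ?P = "\<lambda>x. if x \<in> img_c c then point c x else undefined"
  let ?k = "\<lambda>x. sqrt_det g c x * indicator (img_c c) x"
  have v: "sets ?\<mu> = sets borel"
    "\<And>B. B \<in> sets borel \<Longrightarrow> B \<subseteq> dom_c c \<Longrightarrow> emeasure ?\<mu> B = emeasure (chart_volume g c) B"
    using vol_is_volume[OF g comp] c unfolding is_volume_iff[OF g] by auto
  have db: "dom_c c \<in> sets borel" using open_dom[OF atlas c] by simp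
  have Fm: "F \<in> borel_measurable borel" by (rule borel_measurable_continuous_onI[OF F])
  have Fm': "F \<in> borel_measurable ?\<mu>" using Fm v(1) by (simp cong: measurable_cong_sets)
  have indm: "(indicator (dom_c c) :: 'm \<Rightarrow> real) \<in> borel_measurable ?\<mu>"
    using db v(1) by (intro borel_measurable_indicator) simp
  have dens: "density ?\<mu> (\<lambda>p. ennreal (indicator (dom_c c) p)) = chart_volume g c"
  proof (rule measure_eqI)
    show "sets (density ?\<mu> (\<lambda>p. ennreal (indicator (dom_c c) p))) = sets (chart_volume g c)"
      by (simp add: v sets_chart_volume)
    fix B assume "B \<in> sets (density ?\<mu> (\<lambda>p. ennreal (indicator (dom_c c) p)))"
    then have B: "B \<in> sets borel" by (simp add: v)
    have "emeasure (density ?\<mu> (\<lambda>p. ennreal (indicator (dom_c c) p))) B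
       = (\<integral>\<^sup>+p. indicator (dom_c c \<inter> B) p \<partial>?\<mu>)"
    proof -
      have "ennreal (indicator (dom_c c) p) * indicator B p = indicator (dom_c c \<inter> B) p" for p
        by (auto split: split_indicator)
      then show ?thesis using B indm v(1) by (subst emeasure_density) simp_all
    qed
    also have "\<dots> = emeasure ?\<mu> (dom_c c \<inter> B)" using B db v(1) by (intro nn_integral_indicator) auto
    also have "\<dots> = emeasure (chart_volume g c) (dom_c c \<inter> B)" using B db by (intro v) auto
    also have "\<dots> = emeasure (chart_volume g c) B"
      using emeasure_chart_volume[OF g c B] emeasure_chart_volume[OF g c, of "dom_c c \<inter> B"] B db
      by (simp add: Int_ac)
    finally show "emeasure (density ?\<mu> (\<lambda>p. ennreal (indicator (dom_c c) p))) B = emeasure (chart_volume g c) B" .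
  qed
  have Fz: "indicator (dom_c c) p *\<^sub>R F p = F p" for p
    using zero[of p] box point_in_dom[OF atlas c] by (auto split: split_indicator)
  have cont: "continuous_on (cbox a b) (\<lambda>x. F (point c x) * sqrt_det g c x)"
    by (intro continuous_intros continuous_on_compose2[OF F] continuous_on_subset[OF point_continuous[OF c] box]
        continuous_on_subset[OF sqrt_det_continuous[OF g c] box]) auto
  have kernel: "?k x *\<^sub>R F (?P x) = indicator (cbox a b) x *\<^sub>R (F (point c x) * sqrt_det g c x)" for x
  proof (cases "x \<in> cbox a b")
    case True
    then show ?thesis using box by auto
  next
    case False
    have "F (point c x) = 0" if x: "x \<in> img_c c"
    proof (rule zero, rule notI)
      assume "point c x \<in> point c ` cbox a b"
      then obtain y where y: "y \<in> cbox a b" "point c x = point c y" by blast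
      then have "x = y" using coord_point[OF atlas c x] coord_point[OF atlas c, of y] box by auto
      with y False show False by simp
    qed
    with False show ?thesis by auto
  qed
  have int: "integrable lborel (\<lambda>x. indicator (cbox a b) x *\<^sub>R (F (point c x) * sqrt_det g c x))"
    by (rule borel_integrable_compact[OF compact_cbox cont])
  have nn: "0 \<le> ?k x" for x
    using pos_sym_det[OF Met_pos[OF atlas g c point_in_dom[OF atlas c]]]
    by (auto simp: sqrt_det_def less_imp_le split: split_indicator)
  have kd: "(\<lambda>x. ennreal (sqrt_det g c x) * indicator (img_c c) x) = (\<lambda>x. ennreal (?k x))"
    by (auto split: split_indicator)
  have km: "?k \<in> borel_measurable lborel"
  proof -
    have "(\<lambda>x. enn2real (ennreal (?k x))) \<in> borel_measurable borel"
      using sqrt_det_measurable[OF g c] unfolding kd by measurable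
    then show ?thesis using nn by simp
  qed
  have Pm: "?P \<in> measurable (density lborel (\<lambda>x. ennreal (?k x))) borel"
    using point_measurable[OF c] by simp
  have FPm: "(\<lambda>x. F (?P x)) \<in> borel_measurable lborel"
    using measurable_compose[OF point_measurable[OF c] Fm] by simp
  have i1: "integrable (chart_volume g c) F"
    unfolding chart_volume_def kd integrable_distr_eq[OF Pm Fm]
    by (subst integrable_density[OF FPm km]) (use nn int in \<open>simp_all only: kernel AE_I2\<close>)
  have e1: "(\<integral>p. F p \<partial>chart_volume g c) = integral (cbox a b) (\<lambda>x. F (point c x) * sqrt_det g c x)"
  proof -
    have "(\<integral>p. F p \<partial>chart_volume g c) = (\<integral>x. ?k x *\<^sub>R F (?P x) \<partial>lborel)"
      unfolding chart_volume_def kd integral_distr[OF Pm Fm]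
      by (rule integral_density[OF FPm km]) (use nn in simp)
    also have "\<dots> = (LINT x:cbox a b|lborel. F (point c x) * sqrt_det g c x)"
      unfolding kernel set_lebesgue_integral_def ..
    also have "\<dots> = integral (cbox a b) (\<lambda>x. F (point c x) * sqrt_det g c x)"
      by (rule set_borel_integral_eq_integral) (use int in \<open>simp only: set_integrable_def\<close>)
    finally show ?thesis .
  qed
  show "integrable ?\<mu> F"
    using i1 unfolding dens[symmetric] by (subst (asm) integrable_density[OF Fm' indm]) (simp_all only: Fz AE_I2 indicator_pos_le)
  have "(\<integral>p. F p \<partial>chart_volume g c) = (\<integral>p. indicator (dom_c c) p *\<^sub>R F p \<partial>?\<mu>)"
    unfolding dens[symmetric] by (rule integral_density[OF Fm' indm]) simp
  then show "(\<integral>p. F p \<partial>?\<mu>) = integral (cbox a b) (\<lambda>x. F (point c x) * sqrt_det g c x)"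
    by (simp only: Fz e1)
qed

end

subsection \<open>Partition of unity and integration by parts\<close>

lemma integral_zero_outside:
  fixes f :: "'a::euclidean_space \<Rightarrow> real"
  assumes "\<And>x. x \<notin> S \<Longrightarrow> f x = 0"
  shows "integral S f = integral UNIV f"
proof -
  have "(\<lambda>x. if x \<in> S then f x else 0) = f" using assms by auto
  then show ?thesis using integral_restrict_UNIV[of S f] by simp
qed

text \<open>The integral of a derivative vanishes because the integral of the translates is constant.\<close>

lemma integral_derivative_compact_support:
  fixes u :: "'a::euclidean_space \<Rightarrow> real"
  assumes u: "Ck_on 1 UNIV u" and K: "compact K" "\<And>x. x \<notin> K \<Longrightarrow> u x = 0" "K \<subseteq> S"
  shows "integral S (\<lambda>x. dd u x e) = 0"
proof -
  have uc: "continuous_on UNIV u" using Ck_on_continuous[OF u] .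
  have du: "u differentiable (at x)" "continuous_on UNIV (\<lambda>x. dd u x v)" for x v
    using u by auto
  have dz: "dd u x v = 0" if "x \<notin> K" for x v
  proof -
    have "(u has_derivative (\<lambda>v. 0)) (at x)"
      by (rule has_derivative_transform_within_open[of "\<lambda>x. 0" _ _ _ "- K"])
        (use that K compact_imp_closed in \<open>auto intro: open_Compl\<close>)
    then show ?thesis by (simp add: frechet_derivative_eqI[OF \<open>(u has_derivative (\<lambda>v. 0)) (at x)\<close>])
  qed
  let ?K' = "(\<lambda>(x, t). x - t *\<^sub>R e) ` (K \<times> {-1..1::real})"
  have "compact ?K'"
    by (rule compact_continuous_image) (auto intro!: continuous_intros compact_Times K simp: split_beta)
  then obtain a where a: "?K' \<subseteq> cbox (-a) a"
    using bounded_subset_cbox_symmetric compact_imp_bounded by blast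
  have KB: "K \<subseteq> cbox (-a) a" using a by (force simp: image_iff)
  have out: "u (x + t *\<^sub>R e) = 0" if "x \<notin> cbox (-a) a" "t \<in> {-1..1}" for x t
  proof (rule K(2), rule notI)
    assume "x + t *\<^sub>R e \<in> K"
    then have "(x + t *\<^sub>R e) - t *\<^sub>R e \<in> ?K'" using that by (intro image_eqI[of _ _ "(x + t *\<^sub>R e, t)"]) auto
    with a that show False by auto
  qed
  \<comment> \<open>the box contains all translates of \<open>K\<close> by \<open>t e\<close> with \<open>|t| \<le> 1\<close>, so that \<open>J\<close> is constant on \<open>[-1, 1]\<close>\<close>
  define J where "J t = integral (cbox (-a) a) (\<lambda>x. u (x + t *\<^sub>R e))" for t
  have J: "J t = (\<integral>x. u x \<partial>lborel)" if "t \<in> {-1..1}" for t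
  proof -
    have c: "continuous_on (cbox (-a) a) (\<lambda>x. u (x + t *\<^sub>R e))"
      by (rule continuous_on_compose2[OF uc]) (auto intro!: continuous_intros)
    have "J t = (LINT x:cbox (-a) a|lborel. u (x + t *\<^sub>R e))"
      unfolding J_def
      by (rule set_borel_integral_eq_integral(2)[symmetric])
        (use borel_integrable_compact[OF compact_cbox c] in \<open>simp only: set_integrable_def\<close>)
    also have "\<dots> = (\<integral>x. u (t *\<^sub>R e + x) \<partial>lborel)"
      unfolding set_lebesgue_integral_def
      using out[OF _ that] by (intro Bochner_Integration.integral_cong) (auto split: split_indicator simp: add.commute)
    also have "\<dots> = (\<integral>x. u x \<partial>distr lborel borel ((+) (t *\<^sub>R e)))"
      by (rule integral_distr[symmetric]) (auto intro!: borel_measurable_continuous_onI uc)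
    finally show ?thesis by (simp add: lborel_distr_plus)
  qed
  have "(J has_field_derivative integral (cbox (-a) a) (\<lambda>x. dd u (x + 0 *\<^sub>R e) e)) (at 0 within {-1..1})"
    unfolding J_def[abs_def]
  proof (rule leibniz_rule_field_derivative)
    show "((\<lambda>t. u (x + t *\<^sub>R e)) has_field_derivative dd u (x + t *\<^sub>R e) e) (at t within {-1..1})" for x t
    proof -
      have "((\<lambda>t. u (x + t *\<^sub>R e)) has_derivative (\<lambda>r. dd u (x + t *\<^sub>R e) (r *\<^sub>R e))) (at t within {-1..1})"
        by (rule has_derivative_compose[where f = "\<lambda>t. x + t *\<^sub>R e", OF _ has_derivative_frechet[OF du(1)]])
          (auto intro!: derivative_eq_intros)
      then show ?thesis
        using linear_cmul[OF linear_frechet_derivative[OF du(1)]]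
        by (simp add: has_field_derivative_def mult_commute_abs)
    qed
    show "(\<lambda>x. u (x + t *\<^sub>R e)) integrable_on cbox (-a) a" for t
      by (intro integrable_continuous continuous_on_compose2[OF uc]) (auto intro!: continuous_intros)
    show "continuous_on ({-1..1} \<times> cbox (-a) a) (\<lambda>(t, x). dd u (x + t *\<^sub>R e) e)"
      unfolding split_beta
      by (rule continuous_on_compose2[OF du(2)]) (auto intro!: continuous_intros)
  qed auto
  moreover have "(J has_field_derivative 0) (at 0 within {-1..1})"
    by (rule has_field_derivative_transform_within[OF DERIV_const, of 1]) (simp_all add: J)
  moreover have "at (0::real) within {-1..1} \<noteq> bot"
    by (simp add: trivial_limit_within islimpt_Icc)
  ultimately have "integral (cbox (-a) a) (\<lambda>x. dd u x e) = 0"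
    using has_field_derivative_unique by fastforce
  then show ?thesis
    using integral_zero_outside[of S "\<lambda>x. dd u x e"] integral_zero_outside[of "cbox (-a) a" "\<lambda>x. dd u x e"] dz K(3) KB
    by (metis (no_types, lifting) subsetD)
qed

text \<open>A bump function that is only continuously differentiable, which is enough for integration by parts.\<close>

definition bump :: "'a::euclidean_space \<Rightarrow> real \<Rightarrow> 'a \<Rightarrow> real" where
  "bump z r x = (max 0 (r\<^sup>2 - (x - z) \<bullet> (x - z)))\<^sup>2"

lemma bump_pos_iff: "0 < r \<Longrightarrow> 0 < bump z r x \<longleftrightarrow> x \<in> ball z r"
proof -
  assume r: "0 < r"
  have "0 < bump z r x \<longleftrightarrow> (x - z) \<bullet> (x - z) < r\<^sup>2" by (auto simp: bump_def max_def)
  also have "\<dots> \<longleftrightarrow> (norm (x - z))\<^sup>2 < r\<^sup>2" by (simp add: power2_norm_eq_inner)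
  also have "\<dots> \<longleftrightarrow> norm (x - z) < r" using r by (meson norm_ge_zero less_imp_le power2_less_imp_less power_strict_mono pos2)
  finally show ?thesis by (simp add: dist_norm norm_minus_commute)
qed

lemma bump_nonneg: "0 \<le> bump z r x" by (simp add: bump_def)

lemma Ck_on_max0_square: "Ck_on 1 UNIV (\<lambda>y::real. (max 0 y)\<^sup>2)"
proof -
  have "((\<lambda>y::real. (max 0 y)\<^sup>2) has_real_derivative 2 * max 0 y) (at y)" for y
  proof -
    consider "y > 0" | "y < 0" | "y = 0" by linarith
    then show ?thesis
    proof cases
      case 1
      have "((\<lambda>y::real. y\<^sup>2) has_real_derivative 2 * max 0 y) (at y)"
        using 1 by (auto intro!: derivative_eq_intros)
      then show ?thesis
        by (rule has_field_derivative_transform_within_open[where S = "{0<..}"]) (use 1 in auto)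
    next
      case 2
      have "((\<lambda>y::real. 0) has_real_derivative 2 * max 0 y) (at y)" using 2 by simp
      then show ?thesis
        by (rule has_field_derivative_transform_within_open[where S = "{..<0}"]) (use 2 in auto)
    next
      case 3
      have "((\<lambda>h::real. max 0 h) \<longlongrightarrow> max 0 0) (at 0)" by (intro tendsto_intros)
      then have "((\<lambda>h::real. max 0 h) \<longlongrightarrow> 0) (at 0)" by simp
      then have "((\<lambda>h::real. ((max 0 (0 + h))\<^sup>2 - (max 0 0)\<^sup>2) / h) \<longlongrightarrow> 0) (at 0)"
        by (rule Lim_transform_eventually[where f = "\<lambda>h. max 0 h"])
          (simp_all add: eventually_at_filter max_def power2_eq_square)
      then show ?thesis using 3 by (simp add: DERIV_def)
    qed
  qed
  moreover have "Ck_on 0 UNIV (\<lambda>y::real. 2 * max 0 y)"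
    by (auto intro!: continuous_intros)
  ultimately show ?thesis
    unfolding One_nat_def by (intro Ck_on_real_SucI) auto
qed

lemma Ck_on_bump: "Ck_on 1 UNIV (bump z r)"
proof -
  have "smooth_on UNIV (\<lambda>x::'a. r\<^sup>2 - (x - z) \<bullet> (x - z))"
  proof -
    have "(\<lambda>x::'a. r\<^sup>2 - (x - z) \<bullet> (x - z)) = (\<lambda>x. r\<^sup>2 - (\<Sum>i\<in>Basis. (x \<bullet> i - z \<bullet> i) * (x \<bullet> i - z \<bullet> i)))"
      by (rule ext, subst euclidean_inner) (simp add: inner_diff_left)
    moreover have "smooth_on UNIV (\<lambda>x::'a. x \<bullet> i)" for i
      by (rule smooth_on_bounded_linear) (auto simp: bounded_linear_inner_left)
    ultimately show ?thesis
      by (simp only:) (intro smooth_on_diff smooth_on_sum smooth_on_mult smooth_on_const open_UNIV; simp)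
  qed
  from Ck_on_compose[OF open_UNIV smooth_on_imp_Ck[OF this] Ck_on_max0_square]
  show ?thesis unfolding bump_def[abs_def] by simp
qed

text \<open>The compact set \<open>K\<close> inside the box makes \<open>\<eta> q\<close>, extended by zero, continuously differentiable on the whole
  coordinate space, so integration over the box produces no boundary terms.\<close>

definition box_partition :: "('m, 'n::finite) chart set \<Rightarrow> 'm set \<Rightarrow> ('m \<Rightarrow> ('m, 'n) chart) \<Rightarrow>
    ('m \<Rightarrow> real^'n) \<Rightarrow> ('m \<Rightarrow> real^'n) \<Rightarrow> ('m \<Rightarrow> 'm \<Rightarrow> real) \<Rightarrow> bool" where
  "box_partition A Q cc a b \<eta> \<longleftrightarrow> finite Q \<and> (\<forall>p. (\<Sum>q\<in>Q. \<eta> q p) = 1) \<and>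
     (\<forall>q\<in>Q. cc q \<in> A \<and> cbox (a q) (b q) \<subseteq> img_c (cc q) \<and>
        (\<exists>K. compact K \<and> K \<subseteq> cbox (a q) (b q) \<and> (\<forall>p. p \<notin> point (cc q) ` K \<longrightarrow> \<eta> q p = 0)) \<and>
        (\<forall>c\<in>A. Ck_on 1 (img_c c) (\<lambda>x. \<eta> q (point c x))))"

context
  fixes A :: "('m::t2_space, 'n::finite) chart set"
  assumes atlas: "smooth_atlas A"
begin

text \<open>In a Hausdorff space the image of the closed ball is closed; hence the domain of \<open>d\<close> is covered by two open
  sets, on one of which the function is the bump in other coordinates and on the other zero.\<close>

lemma Ck_on_bump_chart:
  assumes c: "c \<in> A" and d: "d \<in> A" and K: "cball z r \<subseteq> img_c c" and r: "0 < r"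
  shows "Ck_on 1 (img_c d) (\<lambda>x. if point d x \<in> dom_c c then bump z r (coord c (point d x)) else 0)"
    (is "Ck_on 1 _ ?f")
proof -
  let ?O = "coord d ` (dom_c d \<inter> dom_c c)"
  let ?C = "point c ` cball z r"
  let ?W = "coord d ` (dom_c d - ?C)"
  have Cc: "compact ?C"
    by (rule compact_continuous_image[OF continuous_on_subset[OF point_continuous[OF atlas c] K] compact_cball])
  have "Ck_on 1 ?O (\<lambda>x. bump z r ((coord c \<circ> point d) x))"
    by (rule Ck_on_compose[OF open_overlap[OF atlas d c] smooth_on_imp_Ck[OF transition_smooth[OF atlas d c]] Ck_on_bump]) auto
  then have 1: "Ck_on 1 ?O ?f"
    by (rule Ck_on_cong[OF open_overlap[OF atlas d c], rotated]) (auto simp: point_coord[OF atlas d])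
  have oW: "open ?W"
    by (rule open_coord_image[OF atlas d]) (use open_dom[OF atlas d] Cc compact_imp_closed in auto)
  have 2: "Ck_on 1 ?W ?f"
  proof (rule Ck_on_cong[OF oW _ Ck_on_const])
    fix x assume "x \<in> ?W"
    then obtain p where p: "p \<in> dom_c d" "p \<notin> ?C" "x = coord d p" by auto
    have "bump z r (coord c p) = 0" if "p \<in> dom_c c"
    proof (rule ccontr)
      assume "bump z r (coord c p) \<noteq> 0"
      then have "0 < bump z r (coord c p)" using bump_nonneg[of z r "coord c p"] by linarith
      then have "coord c p \<in> cball z r" using bump_pos_iff[OF r] ball_subset_cball by blast
      then show False using p point_coord[OF atlas c that] by force
    qed
    then show "0 = ?f x" by (simp add: p point_coord[OF atlas d])
  qed
  have "?C \<subseteq> dom_c c" using K point_in_dom[OF atlas c] by blast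
  then have "dom_c d = (dom_c d \<inter> dom_c c) \<union> (dom_c d - ?C)" by blast
  then have "img_c d = ?O \<union> ?W" unfolding img_c_def by (metis image_Un)
  with Ck_on_Un[OF open_overlap[OF atlas d c] oW 1 2] show ?thesis by simp
qed

lemma box_partition_exists:
  assumes comp: "compact (UNIV :: 'm set)"
  obtains Q cc a b \<eta> where "box_partition A Q cc a b \<eta>"
proof -
  define cc where "cc = chart_at A"
  define z where "z q = coord (cc q) q" for q
  note ch = chart_at[OF atlas, folded cc_def]
  have "\<exists>a b r. cbox a b \<subseteq> img_c (cc q) \<and> 0 < r \<and> cball (z q) r \<subseteq> cbox a b" for q
  proof -
    have "z q \<in> img_c (cc q)" using ch by (simp add: z_def img_c_def)
    then obtain a b where ab: "cbox a b \<subseteq> img_c (cc q)" "z q \<in> box a b"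
      using open_contains_cbox[OF open_img[OF atlas ch(1)]] by metis
    then obtain r where "r > 0" "cball (z q) r \<subseteq> box a b"
      using open_contains_cball[of "box a b"] open_box by blast
    with ab box_subset_cbox show ?thesis by blast
  qed
  then obtain a b r where ab: "\<And>q. cbox (a q) (b q) \<subseteq> img_c (cc q)" and r: "\<And>q. 0 < r q"
    and zr: "\<And>q. cball (z q) (r q) \<subseteq> cbox (a q) (b q)" by metis
  define f where "f q p = (if p \<in> dom_c (cc q) then bump (z q) (r q) (coord (cc q) p) else 0)" for q p
  let ?V = "\<lambda>q. point (cc q) ` ball (z q) (r q)"
  have img: "cball (z q) (r q) \<subseteq> img_c (cc q)" for q using ab zr by blast
  have Vo: "open (?V q)" for q
  proof -
    have "openin (top_of_set (dom_c (cc q))) (?V q)"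
      by (rule homeomorphism_imp_open_map[OF homeomorphism_symD[OF atlas_homeo[OF atlas ch(1)]]])
        (use img[of q] ball_subset_cball in \<open>auto simp: open_img[OF atlas ch(1)] openin_open_eq\<close>)
    then show ?thesis using open_dom[OF atlas ch(1)] by (simp add: openin_open_eq)
  qed
  have qV: "q \<in> ?V q" for q
    using r[of q] point_coord[OF atlas ch(1) ch(2)] by (intro image_eqI[of _ _ "z q"]) (auto simp: z_def)
  obtain Q where Q: "finite Q" "UNIV \<subseteq> (\<Union>q\<in>Q. ?V q)"
  proof -
    have cov: "UNIV \<subseteq> (\<Union>q\<in>UNIV. ?V q)" using qV by blast
    obtain Q where "finite Q" "UNIV \<subseteq> (\<Union>q\<in>Q. ?V q)"
      using compactE_image[OF comp Vo cov] by metis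
    then show ?thesis by (rule that)
  qed
  have fpos: "0 < f q p" if pV: "p \<in> ?V q" for q p
  proof -
    obtain x where x: "x \<in> ball (z q) (r q)" "p = point (cc q) x" using pV by blast
    then have "x \<in> img_c (cc q)" using img[of q] ball_subset_cball by blast
    then show ?thesis using x r[of q]
      by (simp add: f_def point_in_dom[OF atlas ch(1)] coord_point[OF atlas ch(1)] bump_pos_iff)
  qed
  have fnn: "0 \<le> f q p" for q p by (simp add: f_def bump_nonneg)
  define F where "F p = (\<Sum>q\<in>Q. f q p)" for p
  have Fpos: "0 < F p" for p
  proof -
    obtain q where "q \<in> Q" "p \<in> ?V q" using Q(2) by blast
    then show ?thesis unfolding F_def using fpos fnn Q(1) by (intro sum_pos2) auto
  qed
  have Cf: "Ck_on 1 (img_c d) (\<lambda>x. f q (point d x))" if "d \<in> A" for d q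
    unfolding f_def by (rule Ck_on_bump_chart[OF ch(1) that img r])
  have CF: "Ck_on 1 (img_c d) (\<lambda>x. F (point d x))" if "d \<in> A" for d
    unfolding F_def by (rule Ck_on_sum[OF open_img[OF atlas that] Cf[OF that]])
  have "box_partition A Q cc a b (\<lambda>q p. inverse (F p) *\<^sub>R f q p)"
    unfolding box_partition_def
  proof (intro conjI allI ballI)
    show "finite Q" by fact
    show "(\<Sum>q\<in>Q. inverse (F p) *\<^sub>R f q p) = 1" for p
      using Fpos[of p] by (simp add: sum_distrib_left[symmetric] F_def[symmetric])
    fix q assume "q \<in> Q"
    show "cc q \<in> A" by (rule ch)
    show "cbox (a q) (b q) \<subseteq> img_c (cc q)" by (rule ab)
    have "f q p = 0" if "p \<notin> point (cc q) ` cball (z q) (r q)" for p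
    proof (rule ccontr)
      assume "f q p \<noteq> 0"
      then have p: "p \<in> dom_c (cc q)" "0 < bump (z q) (r q) (coord (cc q) p)"
        using fnn[of q p] by (auto simp: f_def split: if_splits)
      then have "coord (cc q) p \<in> cball (z q) (r q)" using bump_pos_iff[OF r] ball_subset_cball by blast
      then show False using that point_coord[OF atlas ch(1) p(1)] by force
    qed
    then show "\<exists>K. compact K \<and> K \<subseteq> cbox (a q) (b q) \<and> (\<forall>p. p \<notin> point (cc q) ` K \<longrightarrow> inverse (F p) *\<^sub>R f q p = 0)"
      using zr by (intro exI[of _ "cball (z q) (r q)"]) auto
    fix d assume d: "d \<in> A"
    have "Ck_on 1 (img_c d) (\<lambda>x. inverse (F (point d x)))"
      by (rule Ck_on_compose[OF open_img[OF atlas d] CF[OF d] smooth_on_imp_Ck[OF smooth_on_inverse_real]])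
        (use Fpos in \<open>auto simp: less_le\<close>)
    then show "Ck_on 1 (img_c d) (\<lambda>x. inverse (F (point d x)) *\<^sub>R f q (point d x))"
      by (rule Ck_on_scaleR[OF open_img[OF atlas d] _ Cf[OF d]])
  qed
  then show thesis by (rule that)
qed

context
  fixes Q :: "'m set" and cc :: "'m \<Rightarrow> ('m, 'n) chart" and a b :: "'m \<Rightarrow> real^'n" and \<eta> :: "'m \<Rightarrow> 'm \<Rightarrow> real"
  assumes part: "box_partition A Q cc a b \<eta>"
begin

lemma part_finite: "finite Q" and part_sum: "(\<Sum>q\<in>Q. \<eta> q p) = 1"
  and part_chart: "q \<in> Q \<Longrightarrow> cc q \<in> A"
  and part_box: "q \<in> Q \<Longrightarrow> cbox (a q) (b q) \<subseteq> img_c (cc q)"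
  and part_Ck: "q \<in> Q \<Longrightarrow> c \<in> A \<Longrightarrow> Ck_on 1 (img_c c) (\<lambda>x. \<eta> q (point c x))"
  using part unfolding box_partition_def by blast+

lemma part_zero: "q \<in> Q \<Longrightarrow> p \<notin> point (cc q) ` cbox (a q) (b q) \<Longrightarrow> \<eta> q p = 0"
  using part unfolding box_partition_def by blast

lemma part_continuous: "q \<in> Q \<Longrightarrow> continuous_on UNIV (\<eta> q)"
  by (rule continuous_on_charts[OF atlas], rule Ck_on_continuous[OF part_Ck])

lemma integral_vol_partition:
  assumes g: "g \<in> Met A" and comp: "compact (UNIV :: 'm set)" and F: "continuous_on UNIV F"
  shows "(\<integral>p. F p \<partial>vol A g) = (\<Sum>q\<in>Q. integral (cbox (a q) (b q))
     (\<lambda>x. \<eta> q (point (cc q) x) * (F (point (cc q) x) * sqrt_det g (cc q) x)))"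
proof -
  have c: "continuous_on UNIV (\<lambda>p. \<eta> q p * F p)" if "q \<in> Q" for q
    by (intro continuous_intros part_continuous that F)
  have z: "\<eta> q p * F p = 0" if "q \<in> Q" "p \<notin> point (cc q) ` cbox (a q) (b q)" for q p
    using part_zero[OF that] by simp
  note I = integral_vol_box[OF atlas g comp part_chart c part_box z]
  have "(\<integral>p. F p \<partial>vol A g) = (\<integral>p. (\<Sum>q\<in>Q. \<eta> q p * F p) \<partial>vol A g)"
    by (simp add: sum_distrib_right[symmetric] part_sum)
  also have "\<dots> = (\<Sum>q\<in>Q. \<integral>p. \<eta> q p * F p \<partial>vol A g)"
    by (rule Bochner_Integration.integral_sum) (rule I(1))
  also have "\<dots> = (\<Sum>q\<in>Q. integral (cbox (a q) (b q))
     (\<lambda>x. \<eta> q (point (cc q) x) * (F (point (cc q) x) * sqrt_det g (cc q) x)))"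
    by (rule sum.cong[OF refl]) (simp add: I(2) mult.assoc)
  finally show ?thesis .
qed

lemma part_integration_by_parts:
  assumes q: "q \<in> Q" and w: "Ck_on 1 (img_c (cc q)) w"
  shows "integral (cbox (a q) (b q)) (\<lambda>x. \<eta> q (point (cc q) x) * dd w x e + dd (\<lambda>x. \<eta> q (point (cc q) x)) x e * w x) = 0"
proof -
  let ?c = "cc q"
  let ?X = "\<lambda>x. \<eta> q (point ?c x)"
  obtain K where K: "compact K" "K \<subseteq> cbox (a q) (b q)" "\<And>p. p \<notin> point ?c ` K \<Longrightarrow> \<eta> q p = 0"
    using part q unfolding box_partition_def by blast
  have Kz: "?X x = 0" if "x \<in> img_c ?c" "x \<notin> K" for x
  proof (rule K(3), rule notI)
    assume "point ?c x \<in> point ?c ` K"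
    then obtain y where y: "y \<in> K" "point ?c x = point ?c y" by blast
    then have "y \<in> img_c ?c" using K(2) part_box[OF q] by blast
    then have "x = y" using coord_point[OF atlas part_chart[OF q]] that(1) y(2) by metis
    with y that show False by simp
  qed
  let ?u = "\<lambda>x. if x \<in> img_c ?c then ?X x *\<^sub>R w x else 0"
  have o: "open (img_c ?c)" "open (- K)" using open_img[OF atlas part_chart[OF q]] K(1) compact_imp_closed by auto
  have 1: "Ck_on 1 (img_c ?c) ?u"
    by (rule Ck_on_cong[OF o(1) _ Ck_on_scaleR[OF o(1) part_Ck[OF q part_chart[OF q]] w]]) simp
  have 2: "Ck_on 1 (- K) ?u"
    by (rule Ck_on_cong[OF o(2) _ Ck_on_const[of _ _ 0]]) (simp add: Kz)
  have "img_c ?c \<union> - K = UNIV" using K(2) part_box[OF q] by blast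
  with Ck_on_Un[OF o 1 2] have u: "Ck_on 1 UNIV ?u" by simp
  have "integral (cbox (a q) (b q)) (\<lambda>x. dd ?u x e) = 0"
    by (rule integral_derivative_compact_support[OF u K(1) _ K(2)]) (simp add: Kz)
  moreover have "integral (cbox (a q) (b q)) (\<lambda>x. dd ?u x e)
     = integral (cbox (a q) (b q)) (\<lambda>x. ?X x * dd w x e + dd ?X x e * w x)"
  proof (rule integral_cong)
    fix x assume "x \<in> cbox (a q) (b q)"
    then have x: "x \<in> img_c ?c" using part_box[OF q] by blast
    have d: "(?X has_derivative dd ?X x) (at x)" "(w has_derivative dd w x) (at x)"
      using part_Ck[OF q part_chart[OF q]] w x by (auto intro!: has_derivative_frechet)
    have "(?u has_derivative (\<lambda>e. ?X x *\<^sub>R dd w x e + dd ?X x e *\<^sub>R w x)) (at x)"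
      by (rule has_derivative_transform_within_open[OF has_derivative_scaleR[OF d] o(1) x]) simp
    from frechet_derivative_eqI[OF this] show "dd ?u x e = ?X x * dd w x e + dd ?X x e * w x" by simp
  qed
  ultimately show ?thesis by (simp only:)
qed

end

end

section \<open>Families of metrics\<close>

subsection \<open>Derivatives of the inverse and of the determinant\<close>

lemma smooth_on_matrixI:
  fixes f :: "'a::euclidean_space \<Rightarrow> real^'n^'m"
  assumes "open S" "\<And>i j. smooth_on S (\<lambda>x. f x $ i $ j)"
  shows "smooth_on S f"
  by (intro smooth_on_vecI assms)

lemma bounded_bilinear_matrix_mult:
  "bounded_bilinear ((**) :: real^'n^'m \<Rightarrow> real^'k^'n \<Rightarrow> real^'k^'m)"
  unfolding bilinear_conv_bounded_bilinear[symmetric]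
  by (auto simp: bilinear_def linear_iff matrix_matrix_mult_def vec_eq_iff sum.distrib
      distrib_left distrib_right sum_distrib_left mult_ac)

lemma smooth_on_matrix_mult:
  fixes f :: "'a::euclidean_space \<Rightarrow> real^'n^'m" and h :: "'a \<Rightarrow> real^'k^'n"
  assumes S: "open S" and f: "smooth_on S f" and h: "smooth_on S h"
  shows "smooth_on S (\<lambda>x. f x ** h x)"
proof (rule smooth_on_matrixI[OF S])
  show "smooth_on S (\<lambda>x. (f x ** h x) $ i $ j)" for i j
    unfolding matrix_matrix_mult_def
    by (simp, intro smooth_on_sum smooth_on_mult smooth_on_vec_nth S f h)
qed

lemma smooth_on_trace:
  fixes f :: "'a::euclidean_space \<Rightarrow> real^'n^'n"
  assumes S: "open S" and f: "smooth_on S f"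
  shows "smooth_on S (\<lambda>x. trace (f x))"
  unfolding trace_def by (intro smooth_on_sum smooth_on_vec_nth S f)

lemma bounded_linear_trace: "bounded_linear (trace :: real^'n^'n \<Rightarrow> real)"
  by (auto simp: linear_conv_bounded_linear[symmetric] linear_iff trace_def sum.distrib sum_distrib_left)

lemma has_derivative_matrix_inv:
  fixes M :: "'a::euclidean_space \<Rightarrow> real^'n^'n"
  assumes S: "open S" "x \<in> S" and M: "smooth_on S M" and nz: "\<And>y. y \<in> S \<Longrightarrow> det (M y) \<noteq> 0"
  shows "((\<lambda>y. matrix_inv (M y)) has_derivative (\<lambda>w. - (matrix_inv (M x) ** dd M x w ** matrix_inv (M x)))) (at x)"
proof -
  have sm: "smooth_on S (\<lambda>y. matrix_inv (M y))"
    by (rule smooth_on_matrixI[OF S(1)],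
        rule smooth_on_matrix_inv[OF S(1) smooth_on_vec_nth[OF S(1) smooth_on_vec_nth[OF S(1) M]] nz])
  have inv: "invertible (M y)" if "y \<in> S" for y using nz[OF that] by (simp add: invertible_det_nz)
  have D: "((\<lambda>y. matrix_inv (M y)) has_derivative dd (\<lambda>y. matrix_inv (M y)) x) (at x)"
    by (rule smooth_on_has_derivative[OF sm S(2)])
  have "((\<lambda>y. M y ** matrix_inv (M y)) has_derivative
     (\<lambda>w. M x ** dd (\<lambda>y. matrix_inv (M y)) x w + dd M x w ** matrix_inv (M x))) (at x)"
    by (rule bounded_bilinear.FDERIV[OF bounded_bilinear_matrix_mult smooth_on_has_derivative[OF M S(2)] D])
  moreover have "((\<lambda>y. M y ** matrix_inv (M y)) has_derivative (\<lambda>w. 0)) (at x)"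
    by (rule has_derivative_transform_within_open[OF has_derivative_const[of "mat 1"] S])
      (simp add: matrix_inv_mult[OF inv])
  ultimately have "M x ** dd (\<lambda>y. matrix_inv (M y)) x w + dd M x w ** matrix_inv (M x) = 0" for w
    using has_derivative_unique by (metis (no_types, lifting))
  then have "M x ** dd (\<lambda>y. matrix_inv (M y)) x w = - (dd M x w ** matrix_inv (M x))" for w
    by (simp add: eq_neg_iff_add_eq_0)
  then have "matrix_inv (M x) ** (M x ** dd (\<lambda>y. matrix_inv (M y)) x w)
      = matrix_inv (M x) ** - (dd M x w ** matrix_inv (M x))" for w by simp
  moreover have "matrix_inv (M x) ** - (dd M x w ** matrix_inv (M x)) = - (matrix_inv (M x) ** dd M x w ** matrix_inv (M x))" for w
    by (simp add: bounded_bilinear.minus_right[OF bounded_bilinear_matrix_mult] matrix_mul_assoc)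
  ultimately have "dd (\<lambda>y. matrix_inv (M y)) x = (\<lambda>w. - (matrix_inv (M x) ** dd M x w ** matrix_inv (M x)))"
    by (simp add: fun_eq_iff matrix_mul_assoc matrix_inv_mult[OF inv[OF S(2)]])
  with D show ?thesis by simp
qed

lemma det_replace_row:
  fixes B B' :: "real^'n^'n"
  assumes "invertible B"
  shows "det (\<chi> i. if i = k then B' $ k else B $ i) = (B' ** matrix_inv B) $ k $ k * det B"
proof -
  let ?x = "(B' ** matrix_inv B) $ k"
  have "B' = (B' ** matrix_inv B) ** B"
    by (simp add: matrix_mul_assoc[symmetric] matrix_inv_mult[OF assms])
  then have "B' $ k = ((B' ** matrix_inv B) ** B) $ k" by simp
  also have "\<dots> = (\<Sum>i\<in>UNIV. ?x $ i *s row i B)"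
    by (simp add: vec_eq_iff matrix_matrix_mult_def[of "B' ** matrix_inv B"] row_def)
  finally have "(\<chi> i. if i = k then B' $ k else B $ i) = (\<chi> i. if i = k then \<Sum>i\<in>UNIV. ?x $ i *s row i B else row i B)"
    by (simp add: vec_eq_iff row_def)
  then show ?thesis using cramer_lemma_transpose[of k ?x B] by simp
qed

text \<open>Jacobi's formula; the derivative in row \<open>i\<close> is evaluated by \<open>det_replace_row\<close>.\<close>

lemma has_derivative_det:
  fixes M :: "'a::real_normed_vector \<Rightarrow> real^'n^'n"
  assumes M: "(M has_derivative M') (at x)" and inv: "invertible (M x)"
  shows "((\<lambda>y. det (M y)) has_derivative (\<lambda>w. det (M x) * trace (matrix_inv (M x) ** M' w))) (at x)"
proof -
  have e: "((\<lambda>y. M y $ i $ j) has_derivative (\<lambda>w. M' w $ i $ j)) (at x)" for i j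
    by (intro bounded_linear.has_derivative[OF bounded_linear_vec_nth] M)
  have "((\<lambda>y. det (M y)) has_derivative (\<lambda>w. \<Sum>p\<in>{p. p permutes UNIV}. of_int (sign p) *
      (\<Sum>i\<in>UNIV. M' w $ i $ p i * (\<Prod>j\<in>UNIV - {i}. M x $ j $ p j)))) (at x)"
    unfolding det_def
    by (intro has_derivative_sum has_derivative_mult_right has_derivative_prod e)
  moreover have "(\<Sum>p\<in>{p. p permutes UNIV}. of_int (sign p) *
      (\<Sum>i\<in>UNIV. B' $ i $ p i * (\<Prod>j\<in>UNIV - {i}. M x $ j $ p j))) = det (M x) * trace (matrix_inv (M x) ** B')" for B'
  proof -
    have "(\<Sum>p\<in>{p. p permutes UNIV}. of_int (sign p) *
      (\<Sum>i\<in>UNIV. B' $ i $ p i * (\<Prod>j\<in>UNIV - {i}. M x $ j $ p j)))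
      = (\<Sum>i\<in>UNIV. \<Sum>p\<in>{p. p permutes UNIV}. of_int (sign p) * (B' $ i $ p i * (\<Prod>j\<in>UNIV - {i}. M x $ j $ p j)))"
      by (simp add: sum_distrib_left) (rule sum.swap)
    also have "\<dots> = (\<Sum>i\<in>UNIV. det (\<chi> j. if j = i then B' $ i else M x $ j))"
    proof (rule sum.cong[OF refl])
      fix i :: 'n
      have "(\<Prod>j\<in>UNIV. (\<chi> j. if j = i then B' $ i else M x $ j) $ j $ p j)
          = B' $ i $ p i * (\<Prod>j\<in>UNIV - {i}. M x $ j $ p j)" for p
        by (subst prod.remove[of _ i]) (auto intro!: prod.cong)
      then show "(\<Sum>p\<in>{p. p permutes UNIV}. of_int (sign p) * (B' $ i $ p i * (\<Prod>j\<in>UNIV - {i}. M x $ j $ p j)))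
         = det (\<chi> j. if j = i then B' $ i else M x $ j)"
        by (simp add: det_def)
    qed
    also have "\<dots> = trace (B' ** matrix_inv (M x)) * det (M x)"
      by (simp add: det_replace_row[OF inv] trace_def sum_distrib_right)
    finally show ?thesis using trace_mul_sym[of B' "matrix_inv (M x)"] by simp
  qed
  ultimately show ?thesis by simp
qed

lemma has_derivative_sqrt_det:
  fixes M :: "'a::real_normed_vector \<Rightarrow> real^'n^'n"
  assumes M: "(M has_derivative M') (at x)" and pos: "det (M x) > 0"
  shows "((\<lambda>y. sqrt (det (M y))) has_derivative (\<lambda>w. 1/2 * sqrt (det (M x)) * trace (matrix_inv (M x) ** M' w))) (at x)"
proof -
  have inv: "invertible (M x)" using pos by (simp add: invertible_det_nz)
  have "((\<lambda>y. sqrt (det (M y))) has_derivative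
      (\<lambda>w. (inverse (sqrt (det (M x))) / 2) * (det (M x) * trace (matrix_inv (M x) ** M' w)))) (at x)"
    using has_derivative_compose[OF has_derivative_det[OF M inv]
        DERIV_real_sqrt[OF pos, unfolded has_field_derivative_def]] by simp
  moreover have "inverse (sqrt (det (M x))) / 2 * (det (M x) * t) = 1/2 * sqrt (det (M x)) * t" for t
    using pos real_sqrt_mult_self[of "det (M x)"] by (simp add: field_simps)
  ultimately show ?thesis by (simp only:)
qed

subsection \<open>Partial derivatives in the parameter\<close>

lemma dd_snd:
  assumes "F differentiable (at (z, x))"
  shows "((\<lambda>x. F (z, x)) has_derivative (\<lambda>w. dd F (z, x) (0, w))) (at x)"
  by (rule has_derivative_compose[where f = "\<lambda>x. (z, x)", OF _ has_derivative_frechet[OF assms]])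
    (auto intro!: derivative_eq_intros)

lemma dd_fst:
  assumes "F differentiable (at (z, x))"
  shows "((\<lambda>z. F (z, x)) has_derivative (\<lambda>v. dd F (z, x) (v, 0))) (at z)"
  by (rule has_derivative_compose[where f = "\<lambda>z. (z, x)", OF _ has_derivative_frechet[OF assms]])
    (auto intro!: derivative_eq_intros)

context
  fixes P :: "'p::euclidean_space set" and U :: "'a::euclidean_space set"
  assumes P: "open P" and U: "open U"
begin

lemma smooth_dd_snd:
  assumes F: "smooth_on (P \<times> U) F"
  shows "smooth_on (P \<times> U) (\<lambda>y. dd (\<lambda>x. F (fst y, x)) (snd y) w)"
proof (rule smooth_on_cong[OF open_Times[OF P U] _ smooth_on_deriv[OF F]])
  fix y assume "y \<in> P \<times> U"
  then show "dd F y (0, w) = dd (\<lambda>x. F (fst y, x)) (snd y) w"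
    using frechet_derivative_eqI[OF dd_snd[of F "fst y" "snd y"]] smooth_on_differentiable[OF F] by simp
qed

lemma smooth_dd_fst:
  assumes F: "smooth_on (P \<times> U) F"
  shows "smooth_on (P \<times> U) (\<lambda>y. dd (\<lambda>z. F (z, snd y)) (fst y) v)"
proof (rule smooth_on_cong[OF open_Times[OF P U] _ smooth_on_deriv[OF F]])
  fix y assume "y \<in> P \<times> U"
  then show "dd F y (v, 0) = dd (\<lambda>z. F (z, snd y)) (fst y) v"
    using frechet_derivative_eqI[OF dd_fst[of F "fst y" "snd y"]] smooth_on_differentiable[OF F] by simp
qed

lemma smooth_slice_snd:
  assumes F: "smooth_on (P \<times> U) F" and z: "z \<in> P"
  shows "smooth_on U (\<lambda>x. F (z, x))"
proof (rule smooth_on_compose[OF U _ F])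
  show "smooth_on U (\<lambda>x. (z, x))"
  proof -
    have "smooth_on U (\<lambda>x. (z, 0) + (0, x))"
      by (intro smooth_on_add U smooth_on_const smooth_on_bounded_linear)
        (auto intro!: bounded_linear_Pair bounded_linear_zero bounded_linear_ident)
    then show ?thesis by simp
  qed
qed (use z in auto)

lemma smooth_slice_fst:
  assumes F: "smooth_on (P \<times> U) F" and x: "x \<in> U"
  shows "smooth_on P (\<lambda>z. F (z, x))"
proof (rule smooth_on_compose[OF P _ F])
  show "smooth_on P (\<lambda>z. (z, x))"
  proof -
    have "smooth_on P (\<lambda>z. (0, x) + (z, 0))"
      by (intro smooth_on_add P smooth_on_const smooth_on_bounded_linear)
        (auto intro!: bounded_linear_Pair bounded_linear_zero bounded_linear_ident)
    then show ?thesis by simp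
  qed
qed (use x in auto)

lemma dd_fst_snd_commute:
  fixes F :: "'p \<times> 'a \<Rightarrow> real^'n"
  assumes F: "smooth_on (P \<times> U) F" and z: "z \<in> P" and x: "x \<in> U"
  shows "dd (\<lambda>x. dd (\<lambda>z. F (z, x)) z v) x w = dd (\<lambda>z. dd (\<lambda>x. F (z, x)) x w) z v"
proof -
  note O = open_Times[OF P U]
  have zx: "(z, x) \<in> P \<times> U" using z x by simp
  note d = smooth_on_differentiable[OF F]
  have e1: "dd (\<lambda>z. F (z, x')) z v = dd F (z, x') (v, 0)" if "x' \<in> U" for x'
    by (rule fun_cong[OF frechet_derivative_eqI[OF dd_fst]]) (use d z that in auto)
  have e2: "dd (\<lambda>x. F (z', x)) x w = dd F (z', x) (0, w)" if "z' \<in> P" for z'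
    by (rule fun_cong[OF frechet_derivative_eqI[OF dd_snd]]) (use d x that in auto)
  have D: "(\<lambda>y. dd F y u) differentiable (at (z, x))" for u
    by (rule smooth_on_differentiable[OF smooth_on_deriv[OF F] zx])
  have "dd (\<lambda>x. dd (\<lambda>z. F (z, x)) z v) x = (\<lambda>w. dd (\<lambda>y. dd F y (v, 0)) (z, x) (0, w))"
    by (rule frechet_derivative_eqI, rule has_derivative_transform_within_open[OF dd_snd[OF D] U x]) (simp add: e1)
  moreover have "dd (\<lambda>z. dd (\<lambda>x. F (z, x)) x w) z = (\<lambda>v. dd (\<lambda>y. dd F y (0, w)) (z, x) (v, 0))"
    by (rule frechet_derivative_eqI, rule has_derivative_transform_within_open[OF dd_fst[OF D] P z]) (simp add: e2)
  ultimately show ?thesis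
    using frechet_derivative_commute_vec[OF O F zx] by simp
qed

end

subsection \<open>Smoothness of the curvature in the parameter\<close>

text \<open>The scalar curvature read in one fixed chart, which is the form that can be differentiated; \<open>scal\<close> may use another
  chart at every point, and \<open>scal_chart\<close> says that this makes no difference.\<close>

definition scal_in :: "('m, 'n::finite) tensor \<Rightarrow> ('m, 'n) chart \<Rightarrow> real^'n \<Rightarrow> real" where
  "scal_in g c x = trace (matrix_inv (loc g c x) ** ricci g c (point c x))"

context
  fixes A :: "('m::t2_space, 'n::finite) chart set" and P :: "'p::euclidean_space set" and \<gamma> :: "'p \<Rightarrow> ('m, 'n) tensor"
  assumes atlas: "smooth_atlas A" and P: "open P" and fam: "smooth_family A P \<gamma>"
begin

lemma fam_Met: "z \<in> P \<Longrightarrow> \<gamma> z \<in> Met A"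
  using fam by (simp add: smooth_family_def)

lemma fam_local_metric: "z \<in> P \<Longrightarrow> c \<in> A \<Longrightarrow> local_metric (img_c c) (loc (\<gamma> z) c)"
  by (rule local_metric_loc[OF atlas fam_Met])

context
  fixes c assumes c: "c \<in> A"
begin

private lemma open_param_img: "open (P \<times> img_c c)" by (rule open_Times[OF P open_img[OF atlas c]])

lemma fam_smooth: "smooth_on (P \<times> img_c c) (\<lambda>y. loc (\<gamma> (fst y)) c (snd y))"
  using fam c by (simp add: smooth_family_def case_prod_unfold)

lemma fam_det: "y \<in> P \<times> img_c c \<Longrightarrow> det (loc (\<gamma> (fst y)) c (snd y)) > 0"
  using pos_sym_det[OF lm_pos[OF fam_local_metric[OF _ c]]] by auto

lemma fam_smooth_inv: "smooth_on (P \<times> img_c c) (\<lambda>y. matrix_inv (loc (\<gamma> (fst y)) c (snd y)))"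
  by (rule smooth_on_matrixI[OF open_param_img],
      rule smooth_on_matrix_inv[OF open_param_img smooth_on_vec_nth[OF open_param_img smooth_on_vec_nth[OF open_param_img fam_smooth]]],
      use fam_det in force)

lemma fam_smooth_sqrt_det: "smooth_on (P \<times> img_c c) (\<lambda>y. sqrt_det (\<gamma> (fst y)) c (snd y))"
  unfolding sqrt_det_def
  by (rule smooth_on_sqrt[OF open_param_img smooth_on_det[OF open_param_img] fam_det])
    (intro smooth_on_vec_nth open_param_img fam_smooth)

lemma fam_smooth_dd: "smooth_on (P \<times> img_c c) (\<lambda>y. dd (loc (\<gamma> (fst y)) c) (snd y) w)"
  using smooth_dd_snd[OF P open_img[OF atlas c] fam_smooth] by simp

lemma fam_smooth_chr: "smooth_on (P \<times> img_c c) (\<lambda>y. chr (loc (\<gamma> (fst y)) c) (snd y) u v)"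
proof (rule smooth_on_vecI[OF open_param_img])
  fix k
  have mv: "smooth_on (P \<times> img_c c) (\<lambda>y. (dd (loc (\<gamma> (fst y)) c) (snd y) a *v b) $ l)" for a b l
    unfolding matrix_vector_mult_def
    by (simp, intro smooth_on_sum[OF open_param_img] smooth_on_mult[OF open_param_img] smooth_on_const
        smooth_on_vec_nth[OF open_param_img] fam_smooth_dd)
  show "smooth_on (P \<times> img_c c) (\<lambda>y. chr (loc (\<gamma> (fst y)) c) (snd y) u v $ k)"
    unfolding chr_def matrix_vector_mult_def[of "matrix_inv _"] inner_vec_def
    by (simp, intro smooth_on_sum[OF open_param_img] smooth_on_mult[OF open_param_img] smooth_on_const smooth_on_divide[OF open_param_img]
        smooth_on_diff[OF open_param_img] smooth_on_add[OF open_param_img] smooth_on_vec_nth[OF open_param_img] fam_smooth_inv mv; simp)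
qed

text \<open>The curvature is a polynomial in the inverse metric and the first two coordinate derivatives of the metric, so it is
  smooth jointly in the parameter and the point.\<close>

lemma fam_smooth_riem: "smooth_on (P \<times> img_c c) (\<lambda>y. riem (loc (\<gamma> (fst y)) c) (snd y) u w v)"
proof -
  have d: "smooth_on (P \<times> img_c c) (\<lambda>y. dd (\<lambda>x. chr (loc (\<gamma> (fst y)) c) x a b) (snd y) e)" for a b e
    using smooth_dd_snd[OF P open_img[OF atlas c] fam_smooth_chr] by simp
  have cc: "smooth_on (P \<times> img_c c) (\<lambda>y. chr (loc (\<gamma> (fst y)) c) (snd y) a (chr (loc (\<gamma> (fst y)) c) (snd y) b e))" for a b e
  proof (rule smooth_on_cong[OF open_param_img])
    show "smooth_on (P \<times> img_c c) (\<lambda>y. \<Sum>m\<in>UNIV. chr (loc (\<gamma> (fst y)) c) (snd y) b e $ m *\<^sub>R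
        chr (loc (\<gamma> (fst y)) c) (snd y) a (axis m 1))"
      by (intro smooth_on_sum[OF open_param_img] smooth_on_scaleR[OF open_param_img] smooth_on_vec_nth[OF open_param_img] fam_smooth_chr)
    fix y assume y: "y \<in> P \<times> img_c c"
    have lin: "linear (chr (loc (\<gamma> (fst y)) c) (snd y) a)"
      using chr_bilinear[OF fam_local_metric[OF _ c]] y by (auto simp: bilinear_def)
    let ?v = "chr (loc (\<gamma> (fst y)) c) (snd y) b e"
    have "chr (loc (\<gamma> (fst y)) c) (snd y) a ?v = chr (loc (\<gamma> (fst y)) c) (snd y) a (\<Sum>m\<in>UNIV. ?v $ m *\<^sub>R axis m 1)"
      using vec_axis_sum[of ?v] by metis
    then show "(\<Sum>m\<in>UNIV. ?v $ m *\<^sub>R chr (loc (\<gamma> (fst y)) c) (snd y) a (axis m 1)) = chr (loc (\<gamma> (fst y)) c) (snd y) a ?v"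
      by (simp add: linear_sum[OF lin] linear_cmul[OF lin])
  qed
  show ?thesis
    by (rule smooth_on_vecI[OF open_param_img], unfold riem_def vector_add_component vector_minus_component)
      (intro smooth_on_diff[OF open_param_img] smooth_on_add[OF open_param_img] smooth_on_vec_nth[OF open_param_img] d cc)
qed

lemma fam_smooth_ricci: "smooth_on (P \<times> img_c c) (\<lambda>y. ricci (\<gamma> (fst y)) c (point c (snd y)))"
proof (rule smooth_on_matrixI[OF open_param_img], rule smooth_on_cong[OF open_param_img])
  fix j k
  show "smooth_on (P \<times> img_c c) (\<lambda>y. \<Sum>i\<in>UNIV. riem (loc (\<gamma> (fst y)) c) (snd y) (axis i 1) (axis j 1) (axis k 1) $ i)"
    by (intro smooth_on_sum[OF open_param_img] smooth_on_vec_nth[OF open_param_img] fam_smooth_riem)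
  show "(\<Sum>i\<in>UNIV. riem (loc (\<gamma> (fst y)) c) (snd y) (axis i 1) (axis j 1) (axis k 1) $ i)
      = ricci (\<gamma> (fst y)) c (point c (snd y)) $ j $ k" if "y \<in> P \<times> img_c c" for y
    using that by (auto simp: ricci_def coord_point[OF atlas c] riemann_riem[OF atlas fam_Met c])
qed

lemma fam_smooth_scal: "smooth_on (P \<times> img_c c) (\<lambda>y. scal_in (\<gamma> (fst y)) c (snd y))"
  unfolding scal_in_def
  by (intro smooth_on_trace[OF open_param_img] smooth_on_matrix_mult[OF open_param_img] fam_smooth_inv fam_smooth_ricci)

end

end

section \<open>The first variation of the scalar curvature\<close>

subsection \<open>The Palatini identity\<close>

text \<open>In index notation \<open>I\<^sup>j\<^sup>k C\<^sup>i\<^sub>j\<^sub>k - I\<^sup>i\<^sup>j C\<^sup>k\<^sub>k\<^sub>j\<close>: the vector field whose divergence is the trace of the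
  variation of the Ricci tensor, when the Christoffel symbols vary by \<open>C\<close>.\<close>

definition palatini_vec :: "real^'n^'n \<Rightarrow> (real^'n \<Rightarrow> real^'n \<Rightarrow> real^'n) \<Rightarrow> real^'n" where
  "palatini_vec I C = (\<Sum>j\<in>UNIV. \<Sum>k\<in>UNIV. I $ j $ k *\<^sub>R C (axis j 1) (axis k 1))
     - I *v (\<chi> j. \<Sum>k\<in>UNIV. C (axis k 1) (axis j 1) $ k)"

lemma sum4_permute:
  fixes f :: "'n::finite \<times> 'n \<times> 'n \<times> 'n \<Rightarrow> real" and \<pi> :: "'n \<times> 'n \<times> 'n \<times> 'n \<Rightarrow> 'n \<times> 'n \<times> 'n \<times> 'n"
  assumes "bij \<pi>"
  shows "(\<Sum>i\<in>UNIV. \<Sum>j\<in>UNIV. \<Sum>k\<in>UNIV. \<Sum>m\<in>UNIV. f (\<pi> (i, j, k, m)))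
       = (\<Sum>i\<in>UNIV. \<Sum>j\<in>UNIV. \<Sum>k\<in>UNIV. \<Sum>m\<in>UNIV. f (i, j, k, m))"
proof -
  have *: "(\<Sum>i\<in>UNIV. \<Sum>j\<in>UNIV. \<Sum>k\<in>UNIV. \<Sum>m\<in>UNIV. h (i, j, k, m)) = (\<Sum>x\<in>UNIV. h x)"
    for h :: "'n \<times> 'n \<times> 'n \<times> 'n \<Rightarrow> real"
    by (simp add: sum.cartesian_product flip: UNIV_Times_UNIV)
  show ?thesis
    using *[of "\<lambda>x. f (\<pi> x)"] *[of f] sum.reindex_bij_betw[OF assms, of f] by simp
qed

text \<open>The terms of \<open>palatini\<close> without derivatives of \<open>C\<close>, where \<open>G\<close> stands for the Christoffel symbols, \<open>a\<close> for the logarithmic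
  derivative of the density and \<open>dI\<close> for the derivative of the inverse metric. After expansion every term on the left
  is one on the right with its indices renamed, or cancels.\<close>

lemma palatini_index:
  fixes I :: "'n::finite \<Rightarrow> 'n \<Rightarrow> real" and G C :: "'n \<Rightarrow> 'n \<Rightarrow> 'n \<Rightarrow> real"
  assumes I: "\<And>i j. I i j = I j i" and G: "\<And>l i j. G l i j = G l j i" and C: "\<And>l i j. C l i j = C l j i"
  defines "a \<equiv> \<lambda>i. \<Sum>m\<in>UNIV. G m i m"
    and "dI \<equiv> \<lambda>i j k. - (\<Sum>m\<in>UNIV. I j m * G k i m + G j i m * I m k)"
  shows "(\<Sum>i\<in>UNIV. \<Sum>j\<in>UNIV. \<Sum>k\<in>UNIV. (a i * I j k + dI i j k) * C i j k - (a i * I i j + dI i i j) * C k k j)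
    = (\<Sum>j\<in>UNIV. \<Sum>k\<in>UNIV. \<Sum>i\<in>UNIV. \<Sum>m\<in>UNIV. I k j * (C i i m * G m j k + G i i m * C m j k - C i j m * G m i k - G i j m * C m i k))"
proof -
  let ?S = "\<lambda>f. \<Sum>i\<in>UNIV. \<Sum>j\<in>UNIV. \<Sum>k\<in>UNIV. \<Sum>m\<in>UNIV. (f i j k m :: real)"
  have perm: "?S f = ?S h" if "bij \<pi>" "\<And>i j k m. f i j k m = (\<lambda>(i, j, k, m). h i j k m) (\<pi> (i, j, k, m))"
    for f h :: "'n \<Rightarrow> 'n \<Rightarrow> 'n \<Rightarrow> 'n \<Rightarrow> real" and \<pi>
    using sum4_permute[OF that(1), of "\<lambda>(i, j, k, m). h i j k m"] that(2) by simp
  have lhs: "(\<Sum>i\<in>UNIV. \<Sum>j\<in>UNIV. \<Sum>k\<in>UNIV. (a i * I j k + dI i j k) * C i j k - (a i * I i j + dI i i j) * C k k j)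
    = ?S (\<lambda>i j k m. G m i m * I j k * C i j k) - ?S (\<lambda>i j k m. I j m * G k i m * C i j k)
      - ?S (\<lambda>i j k m. G j i m * I m k * C i j k) - ?S (\<lambda>i j k m. G m i m * I i j * C k k j)
      + ?S (\<lambda>i j k m. I i m * G j i m * C k k j) + ?S (\<lambda>i j k m. G i i m * I m j * C k k j)"
    unfolding a_def dI_def
    by (simp add: sum_distrib_right sum_distrib_left sum.distrib sum_subtractf sum_negf algebra_simps)
  have rhs: "(\<Sum>j\<in>UNIV. \<Sum>k\<in>UNIV. \<Sum>i\<in>UNIV. \<Sum>m\<in>UNIV. I k j * (C i i m * G m j k + G i i m * C m j k - C i j m * G m i k - G i j m * C m i k))
    = ?S (\<lambda>j k i m. I k j * C i i m * G m j k) + ?S (\<lambda>j k i m. I k j * G i i m * C m j k)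
      - ?S (\<lambda>j k i m. I k j * C i j m * G m i k) - ?S (\<lambda>j k i m. I k j * G i j m * C m i k)"
    by (simp add: sum.distrib sum_subtractf algebra_simps)
  have 1: "?S (\<lambda>i j k m. G m i m * I j k * C i j k) = ?S (\<lambda>j k i m. I k j * G i i m * C m j k)"
    by (rule perm[of "\<lambda>(i, j, k, m). (j, k, m, i)"])
      (auto simp: bij_def inj_on_def surj_def I G mult_ac)
  have 2: "?S (\<lambda>i j k m. I j m * G k i m * C i j k) = ?S (\<lambda>j k i m. I k j * C i j m * G m i k)"
    by (rule perm[of "\<lambda>(i, j, k, m). (j, m, i, k)"]) (auto simp: bij_def inj_on_def surj_def I mult_ac)
  have 3: "?S (\<lambda>i j k m. G j i m * I m k * C i j k) = ?S (\<lambda>j k i m. I k j * G i j m * C m i k)"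
    by (rule perm[of "\<lambda>(i, j, k, m). (m, k, j, i)"]) (auto simp: bij_def inj_on_def surj_def I G mult_ac)
  have 4: "?S (\<lambda>i j k m. G m i m * I i j * C k k j) = ?S (\<lambda>i j k m. G i i m * I m j * C k k j)"
    by (rule perm[of "\<lambda>(i, j, k, m). (m, j, k, i)"]) (auto simp: bij_def inj_on_def surj_def I G mult_ac)
  have 5: "?S (\<lambda>i j k m. I i m * G j i m * C k k j) = ?S (\<lambda>j k i m. I k j * C i i m * G m j k)"
    by (rule perm[of "\<lambda>(i, j, k, m). (i, m, k, j)"]) (auto simp: bij_def inj_on_def surj_def I G mult_ac)
  show ?thesis unfolding lhs rhs 1 2 3 4 5 by simp
qed

context
  fixes U :: "(real^'n) set" and M :: "real^'n \<Rightarrow> real^'n^'n"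
  assumes lm: "local_metric U M"
begin

text \<open>The metric is parallel. This expresses the derivatives of the metric, and with it those of its inverse and
  of the volume density, by Christoffel symbols.\<close>

lemma dd_metric:
  assumes x: "x \<in> U"
  shows "dd M x u = transpose (matrix (chr M x u)) ** M x + M x ** matrix (chr M x u)"
proof -
  have lin: "linear (chr M x u)" using chr_bilinear[OF lm x] by (simp add: bilinear_def)
  have mat: "matrix (chr M x u) *v v = chr M x u v" for v
    using lin by (simp add: matrix_works linear_matrix_vector_mul_eq)
  have sym: "a \<bullet> (M x *v b) = b \<bullet> (M x *v a)" for a b
    using lm_pos[OF lm x] by (intro sym_inner) (simp add: pos_sym_def)
  have "a \<bullet> (dd M x u *v b) = a \<bullet> ((transpose (matrix (chr M x u)) ** M x + M x ** matrix (chr M x u)) *v b)" for a b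
  proof -
    have "a \<bullet> ((transpose (matrix (chr M x u)) ** M x + M x ** matrix (chr M x u)) *v b)
      = chr M x u a \<bullet> (M x *v b) + a \<bullet> (M x *v chr M x u b)"
      using inner_transpose[of a "matrix (chr M x u)" "M x" "mat 1" b]
      by (simp add: matrix_vector_mult_add_rdistrib inner_add_right matrix_vector_mul_assoc[symmetric] mat)
    also have "\<dots> = b \<bullet> (M x *v chr M x u a) + a \<bullet> (M x *v chr M x u b)"
      using sym[of "chr M x u a" b] by simp
    also have "\<dots> = a \<bullet> (dd M x u *v b)"
      unfolding chr_inner[OF lm x]
      using sym_inner[OF dd_sym[OF lm x], of b u a] sym_inner[OF dd_sym[OF lm x], of b a u]
        sym_inner[OF dd_sym[OF lm x], of a b u] by (simp add: field_simps)
    finally show ?thesis ..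
  qed
  then have "dd M x u *v b = (transpose (matrix (chr M x u)) ** M x + M x ** matrix (chr M x u)) *v b" for b
    by - (rule vector_eq_ldot[THEN iffD1], rule allI)
  then show ?thesis unfolding matrix_eq by (rule allI)
qed

lemma lm_det: "x \<in> U \<Longrightarrow> det (M x) > 0"
  by (rule pos_sym_det[OF lm_pos[OF lm]])

lemma inv_has_derivative:
  assumes x: "x \<in> U"
  shows "((\<lambda>y. matrix_inv (M y)) has_derivative
     (\<lambda>u. - (matrix_inv (M x) ** transpose (matrix (chr M x u)) + matrix (chr M x u) ** matrix_inv (M x)))) (at x)"
proof -
  note inv = matrix_inv_mult[OF pos_sym_invertible[OF lm_pos[OF lm x]]]
  have "matrix_inv (M x) ** dd M x u ** matrix_inv (M x) =
     matrix_inv (M x) ** transpose (matrix (chr M x u)) + matrix (chr M x u) ** matrix_inv (M x)" for u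
  proof -
    have "matrix_inv (M x) ** dd M x u ** matrix_inv (M x) =
      (matrix_inv (M x) ** transpose (matrix (chr M x u))) ** (M x ** matrix_inv (M x))
      + (matrix_inv (M x) ** M x) ** matrix (chr M x u) ** matrix_inv (M x)"
      unfolding dd_metric[OF x] by (simp only: matrix_add_ldistrib bounded_bilinear.add_left[OF bounded_bilinear_matrix_mult] matrix_mul_assoc)
    then show ?thesis by (simp only: inv matrix_mul_rid matrix_mul_lid)
  qed
  moreover have "((\<lambda>y. matrix_inv (M y)) has_derivative (\<lambda>u. - (matrix_inv (M x) ** dd M x u ** matrix_inv (M x)))) (at x)"
    by (rule has_derivative_matrix_inv[OF lm_open[OF lm] x lm_smooth[OF lm]]) (use lm_det in force)
  ultimately show ?thesis by simp
qed

lemma sqrt_det_has_derivative: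
  assumes x: "x \<in> U"
  shows "((\<lambda>y. sqrt (det (M y))) has_derivative (\<lambda>u. sqrt (det (M x)) * trace (matrix (chr M x u)))) (at x)"
proof -
  note inv = matrix_inv_mult[OF pos_sym_invertible[OF lm_pos[OF lm x]]]
  have "trace (matrix_inv (M x) ** dd M x u) = 2 * trace (matrix (chr M x u))" for u
  proof -
    let ?G = "matrix (chr M x u)"
    have "trace (matrix_inv (M x) ** dd M x u) = trace (matrix_inv (M x) ** (transpose ?G ** M x))
        + trace ((matrix_inv (M x) ** M x) ** ?G)"
      unfolding dd_metric[OF x] by (simp only: matrix_add_ldistrib trace_add matrix_mul_assoc)
    also have "trace (matrix_inv (M x) ** (transpose ?G ** M x)) = trace (transpose ?G ** (M x ** matrix_inv (M x)))"
      using trace_mul_sym[of "matrix_inv (M x)" "transpose ?G ** M x"] by (simp add: matrix_mul_assoc)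
    also have "\<dots> = trace ?G" by (simp add: inv trace_def transpose_def)
    finally show ?thesis by (simp add: inv)
  qed
  with has_derivative_sqrt_det[OF has_derivative_frechet[OF lm_differentiable[OF lm x]] lm_det[OF x]]
  show ?thesis by (simp add: mult_ac)
qed

text \<open>\<open>DR\<close> is the linearised Ricci tensor when the Christoffel symbols move in the direction \<open>Cf\<close>. The divergence with the
  weight \<open>\<surd>det M\<close> is the covariant one, and \<open>\<nabla>g = 0\<close> lets the contraction with the inverse metric pass
  through it; in coordinates both sides become the contractions compared in \<open>palatini_index\<close>.\<close>

lemma palatini:
  fixes Cf :: "real^'n \<Rightarrow> real^'n \<Rightarrow> real^'n \<Rightarrow> real^'n"
  assumes x: "x \<in> U" and bil: "bilinear (Cf x)" and Csym: "\<And>u v. Cf x u v = Cf x v u"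
    and diff: "\<And>u v. (\<lambda>y. Cf y u v) differentiable (at x)"
  defines "DR \<equiv> \<lambda>j k. \<Sum>i\<in>UNIV. (dd (\<lambda>y. Cf y (axis j 1) (axis k 1)) x (axis i 1)
       - dd (\<lambda>y. Cf y (axis i 1) (axis k 1)) x (axis j 1)
       + (Cf x (axis i 1) (chr M x (axis j 1) (axis k 1)) + chr M x (axis i 1) (Cf x (axis j 1) (axis k 1)))
       - (Cf x (axis j 1) (chr M x (axis i 1) (axis k 1)) + chr M x (axis j 1) (Cf x (axis i 1) (axis k 1)))) $ i"
  shows "(\<Sum>i\<in>UNIV. dd (\<lambda>y. sqrt (det (M y)) * palatini_vec (matrix_inv (M y)) (Cf y) $ i) x (axis i 1))
     = sqrt (det (M x)) * (\<Sum>j\<in>UNIV. \<Sum>k\<in>UNIV. matrix_inv (M x) $ k $ j * DR j k)"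
proof -
  let ?e = "\<lambda>i. axis i 1 :: real^'n"
  let ?q = "sqrt (det (M x))" and ?I = "\<lambda>j k. matrix_inv (M x) $ j $ k"
  define G where "G l i j = chr M x (?e i) (?e j) $ l" for l i j
  define C where "C l i j = Cf x (?e i) (?e j) $ l" for l i j
  define dC where "dC h l i j = dd (\<lambda>y. Cf y (?e i) (?e j)) x (?e h) $ l" for h l i j
  define a where "a i = (\<Sum>m\<in>UNIV. G m i m)" for i
  define dI where "dI i j k = - (\<Sum>m\<in>UNIV. ?I j m * G k i m + G j i m * ?I m k)" for i j k
  have Isym: "?I i j = ?I j i" for i j
  proof -
    have "transpose (matrix_inv (M x)) ** M x = mat 1"
    proof -
      have "transpose (M x) = M x" using lm_pos[OF lm x] by (simp add: pos_sym_def)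
      then have "transpose (matrix_inv (M x)) ** M x = transpose (M x ** matrix_inv (M x))"
        by (simp add: matrix_transpose_mul)
      then show ?thesis by (simp add: matrix_inv_mult[OF pos_sym_invertible[OF lm_pos[OF lm x]]] transpose_mat)
    qed
    from matrix_inv_eqI[OF this] have "matrix_inv (M x) $ i $ j = transpose (matrix_inv (M x)) $ i $ j" by simp
    then show ?thesis by (simp add: transpose_def)
  qed
  have Gsym: "G l i j = G l j i" for l i j unfolding G_def using chr_sym[OF lm x] by metis
  have C_sym: "C l i j = C l j i" for l i j unfolding C_def using Csym by metis
  have ent: "matrix (chr M x (?e i)) $ k $ m = G k i m" for i k m by (simp add: matrix_def G_def)
  have Id: "((\<lambda>y. matrix_inv (M y) $ j $ k) has_derivative
     (\<lambda>u. (- (matrix_inv (M x) ** transpose (matrix (chr M x u)) + matrix (chr M x u) ** matrix_inv (M x))) $ j $ k)) (at x)" for j k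
    using bounded_linear.has_derivative[OF bounded_linear_vec_nth bounded_linear.has_derivative[OF bounded_linear_vec_nth inv_has_derivative[OF x]]]
    by this
  have Ide: "(- (matrix_inv (M x) ** transpose (matrix (chr M x (?e i))) + matrix (chr M x (?e i)) ** matrix_inv (M x))) $ j $ k = dI i j k" for i j k
    by (simp add: matrix_matrix_mult_def transpose_def ent dI_def sum.distrib)
  have Cd: "((\<lambda>y. Cf y u v $ l) has_derivative (\<lambda>w. dd (\<lambda>y. Cf y u v) x w $ l)) (at x)" for u v l
    by (rule bounded_linear.has_derivative[OF bounded_linear_vec_nth has_derivative_frechet[OF diff]])
  have qd: "((\<lambda>y. sqrt (det (M y))) has_derivative (\<lambda>u. ?q * trace (matrix (chr M x u)))) (at x)"
    by (rule sqrt_det_has_derivative[OF x])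
  have qe: "trace (matrix (chr M x (?e i))) = a i" for i by (simp add: trace_def ent a_def)
  have D: "dd (\<lambda>y. sqrt (det (M y)) * palatini_vec (matrix_inv (M y)) (Cf y) $ i) x (?e i)
    = ?q * (\<Sum>j\<in>UNIV. \<Sum>k\<in>UNIV. (a i * ?I j k + dI i j k) * C i j k - (a i * ?I i j + dI i i j) * C k k j)
      + ?q * (\<Sum>j\<in>UNIV. \<Sum>k\<in>UNIV. ?I j k * dC i i j k - ?I i j * dC i k k j)" for i
  proof -
    have W: "palatini_vec (matrix_inv (M y)) (Cf y) $ i = (\<Sum>j\<in>UNIV. \<Sum>k\<in>UNIV. matrix_inv (M y) $ j $ k * Cf y (?e j) (?e k) $ i
        - matrix_inv (M y) $ i $ j * Cf y (?e k) (?e j) $ k)" for y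
      by (simp add: palatini_vec_def matrix_vector_mult_def sum_subtractf sum_distrib_left)
    let ?N = "\<lambda>u. - (matrix_inv (M x) ** transpose (matrix (chr M x u)) + matrix (chr M x u) ** matrix_inv (M x))"
    have "((\<lambda>y. sqrt (det (M y)) * palatini_vec (matrix_inv (M y)) (Cf y) $ i) has_derivative
      (\<lambda>u. ?q * (\<Sum>j\<in>UNIV. \<Sum>k\<in>UNIV. (?I j k * dd (\<lambda>y. Cf y (?e j) (?e k)) x u $ i + (?N u $ j $ k) * Cf x (?e j) (?e k) $ i)
          - (?I i j * dd (\<lambda>y. Cf y (?e k) (?e j)) x u $ k + (?N u $ i $ j) * Cf x (?e k) (?e j) $ k))
        + (?q * trace (matrix (chr M x u))) * (\<Sum>j\<in>UNIV. \<Sum>k\<in>UNIV. ?I j k * Cf x (?e j) (?e k) $ i - ?I i j * Cf x (?e k) (?e j) $ k))) (at x)"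
      unfolding W by (intro has_derivative_mult qd has_derivative_sum has_derivative_diff Id Cd)
    from fun_cong[OF frechet_derivative_eqI[OF this], of "?e i"]
    have "dd (\<lambda>y. sqrt (det (M y)) * palatini_vec (matrix_inv (M y)) (Cf y) $ i) x (?e i)
      = ?q * (\<Sum>j\<in>UNIV. \<Sum>k\<in>UNIV. (?I j k * dC i i j k + dI i j k * C i j k) - (?I i j * dC i k k j + dI i i j * C k k j))
        + (?q * a i) * (\<Sum>j\<in>UNIV. \<Sum>k\<in>UNIV. ?I j k * C i j k - ?I i j * C k k j)"
      unfolding Ide qe C_def[symmetric] dC_def[symmetric] .
    also have "\<dots> = ?q * (\<Sum>j\<in>UNIV. \<Sum>k\<in>UNIV. (a i * ?I j k + dI i j k) * C i j k - (a i * ?I i j + dI i i j) * C k k j)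
      + ?q * (\<Sum>j\<in>UNIV. \<Sum>k\<in>UNIV. ?I j k * dC i i j k - ?I i j * dC i k k j)"
      unfolding sum_distrib_left sum.distrib[symmetric] by (intro sum.cong refl) (simp add: algebra_simps)
    finally show ?thesis .
  qed
  have lin: "linear (Cf x u)" "linear (chr M x u)" for u using bil chr_bilinear[OF lm x] by (auto simp: bilinear_def)
  have ex: "B v $ i = (\<Sum>m\<in>UNIV. B (?e m) $ i * v $ m)" if "linear B" for B :: "real^'n \<Rightarrow> real^'n" and v i
  proof -
    have "B v = B (\<Sum>m\<in>UNIV. v $ m *\<^sub>R ?e m)" using vec_axis_sum[of v] by metis
    then show ?thesis by (simp add: linear_sum[OF that] linear_cmul[OF that] mult.commute)
  qed
  have DR: "DR j k = (\<Sum>i\<in>UNIV. dC i i j k - dC j i i k) +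
     (\<Sum>i\<in>UNIV. \<Sum>m\<in>UNIV. C i i m * G m j k + G i i m * C m j k - C i j m * G m i k - G i j m * C m i k)" for j k
    unfolding DR_def vector_add_component vector_minus_component
      ex[OF lin(1), of _ "chr M x _ _"] ex[OF lin(2), of _ "Cf x _ _"]
    by (simp add: C_def G_def dC_def sum.distrib sum_subtractf)
  have "(\<Sum>i\<in>UNIV. \<Sum>j\<in>UNIV. \<Sum>k\<in>UNIV. ?I j k * dC i i j k - ?I i j * dC i k k j)
     = (\<Sum>j\<in>UNIV. \<Sum>k\<in>UNIV. ?I k j * (\<Sum>i\<in>UNIV. dC i i j k - dC j i i k))"
  proof -
    have "(\<Sum>i\<in>UNIV. \<Sum>j\<in>UNIV. \<Sum>k\<in>UNIV. ?I j k * dC i i j k) = (\<Sum>j\<in>UNIV. \<Sum>i\<in>UNIV. \<Sum>k\<in>UNIV. ?I j k * dC i i j k)"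
      by (rule sum.swap)
    also have "\<dots> = (\<Sum>j\<in>UNIV. \<Sum>k\<in>UNIV. \<Sum>i\<in>UNIV. ?I j k * dC i i j k)"
      by (rule sum.cong[OF refl], rule sum.swap)
    finally have l: "(\<Sum>i\<in>UNIV. \<Sum>j\<in>UNIV. \<Sum>k\<in>UNIV. ?I j k * dC i i j k - ?I i j * dC i k k j)
        = (\<Sum>j\<in>UNIV. \<Sum>k\<in>UNIV. \<Sum>i\<in>UNIV. ?I j k * dC i i j k)
          - (\<Sum>j\<in>UNIV. \<Sum>k\<in>UNIV. \<Sum>i\<in>UNIV. ?I j k * dC j i i k)"
      by (simp only: sum_subtractf)
    have "?I k j * (\<Sum>i\<in>UNIV. dC i i j k - dC j i i k)
        = (\<Sum>i\<in>UNIV. ?I j k * dC i i j k) - (\<Sum>i\<in>UNIV. ?I j k * dC j i i k)" for j k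
      by (simp only: Isym[of k j] sum_distrib_left right_diff_distrib sum_subtractf)
    then show ?thesis unfolding l by (simp only: sum_subtractf)
  qed
  moreover have "(\<Sum>i\<in>UNIV. \<Sum>j\<in>UNIV. \<Sum>k\<in>UNIV. (a i * ?I j k + dI i j k) * C i j k - (a i * ?I i j + dI i i j) * C k k j)
    = (\<Sum>j\<in>UNIV. \<Sum>k\<in>UNIV. \<Sum>i\<in>UNIV. \<Sum>m\<in>UNIV. ?I k j * (C i i m * G m j k + G i i m * C m j k - C i j m * G m i k - G i j m * C m i k))"
    unfolding a_def dI_def by (rule palatini_index[of ?I G C, OF Isym Gsym C_sym])
  moreover have "(\<Sum>i\<in>UNIV. dd (\<lambda>y. sqrt (det (M y)) * palatini_vec (matrix_inv (M y)) (Cf y) $ i) x (?e i))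
     = ?q * (\<Sum>i\<in>UNIV. \<Sum>j\<in>UNIV. \<Sum>k\<in>UNIV. (a i * ?I j k + dI i j k) * C i j k - (a i * ?I i j + dI i i j) * C k k j)
      + ?q * (\<Sum>i\<in>UNIV. \<Sum>j\<in>UNIV. \<Sum>k\<in>UNIV. ?I j k * dC i i j k - ?I i j * dC i k k j)"
    unfolding D sum.distrib by (simp only: sum_distrib_left)
  moreover have "(\<Sum>j\<in>UNIV. \<Sum>k\<in>UNIV. ?I k j * DR j k) = (\<Sum>j\<in>UNIV. \<Sum>k\<in>UNIV. ?I k j * (\<Sum>i\<in>UNIV. dC i i j k - dC j i i k))
     + (\<Sum>j\<in>UNIV. \<Sum>k\<in>UNIV. \<Sum>i\<in>UNIV. \<Sum>m\<in>UNIV. ?I k j * (C i i m * G m j k + G i i m * C m j k - C i j m * G m i k - G i j m * C m i k))"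
    unfolding DR distrib_left sum.distrib by (simp only: sum_distrib_left)
  ultimately show ?thesis by (simp only: distrib_left add.commute)
qed

end

context chart_change begin

lemma palatini_vec_law:
  assumes x: "x \<in> O1" and bil: "bilinear C" "bilinear C'"
    and law: "\<And>u v. J x (C u v) = C' (J x u) (J x v)"
  shows "J x (palatini_vec (matrix_inv (M x)) C) = palatini_vec (matrix_inv (M' (\<phi> x))) C'"
proof -
  let ?J = "matrix (dd \<phi> x)"
  let ?I = "matrix_inv (M x)" and ?I' = "matrix_inv (M' (\<phi> x))"
  have xU: "x \<in> U" "\<phi> x \<in> U'" using x O by auto
  have iM: "invertible (M' (\<phi> x))" by (rule pos_sym_invertible[OF lm_pos[OF lm' xU(2)]])
  note Jinv = matrix_inv_mult[OF J_invertible[OF x]]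
  have II: "?J ** ?I ** transpose ?J = ?I'"
  proof -
    have "?J ** ?I ** transpose ?J
      = (?J ** matrix_inv ?J) ** ?I' ** (transpose (matrix_inv ?J) ** transpose ?J)"
      unfolding chart_change.law[OF chart_change_axioms x] matrix_inv_congruence[OF J_invertible[OF x] iM]
      by (simp only: matrix_mul_assoc)
    moreover have "transpose (matrix_inv ?J) ** transpose ?J = mat 1"
      by (simp add: matrix_transpose_mul[symmetric] Jinv transpose_mat)
    ultimately show ?thesis by (simp add: Jinv)
  qed
  have lin: "linear (dd \<phi> x)" by (rule J_linear[OF x])
  have Je: "J x (axis j 1) $ a = ?J $ a $ j" for a j by (simp add: matrix_def)
  have 1: "J x (\<Sum>j\<in>UNIV. \<Sum>k\<in>UNIV. ?I $ j $ k *\<^sub>R C (axis j 1) (axis k 1))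
     = (\<Sum>a\<in>UNIV. \<Sum>b\<in>UNIV. ?I' $ a $ b *\<^sub>R C' (axis a 1) (axis b 1))"
  proof -
    have "J x (\<Sum>j\<in>UNIV. \<Sum>k\<in>UNIV. ?I $ j $ k *\<^sub>R C (axis j 1) (axis k 1))
      = (\<Sum>j\<in>UNIV. \<Sum>k\<in>UNIV. ?I $ j $ k *\<^sub>R C' (J x (axis j 1)) (J x (axis k 1)))"
      by (simp add: linear_sum[OF lin] linear_cmul[OF lin] law)
    also have "\<dots> = (\<Sum>j\<in>UNIV. \<Sum>k\<in>UNIV. \<Sum>a\<in>UNIV. \<Sum>b\<in>UNIV. (?J $ a $ j * ?I $ j $ k * ?J $ b $ k) *\<^sub>R C' (axis a 1) (axis b 1))"
      by (subst bilinear_axis_sum[OF bil(2)]) (simp add: scaleR_sum_right Je mult_ac)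
    also have "\<dots> = (\<Sum>j\<in>UNIV. \<Sum>a\<in>UNIV. \<Sum>k\<in>UNIV. \<Sum>b\<in>UNIV. (?J $ a $ j * ?I $ j $ k * ?J $ b $ k) *\<^sub>R C' (axis a 1) (axis b 1))"
      by (rule sum.cong[OF refl], rule sum.swap)
    also have "\<dots> = (\<Sum>a\<in>UNIV. \<Sum>j\<in>UNIV. \<Sum>k\<in>UNIV. \<Sum>b\<in>UNIV. (?J $ a $ j * ?I $ j $ k * ?J $ b $ k) *\<^sub>R C' (axis a 1) (axis b 1))"
      by (rule sum.swap)
    also have "\<dots> = (\<Sum>a\<in>UNIV. \<Sum>j\<in>UNIV. \<Sum>b\<in>UNIV. \<Sum>k\<in>UNIV. (?J $ a $ j * ?I $ j $ k * ?J $ b $ k) *\<^sub>R C' (axis a 1) (axis b 1))"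
      by (rule sum.cong[OF refl], rule sum.cong[OF refl], rule sum.swap)
    also have "\<dots> = (\<Sum>a\<in>UNIV. \<Sum>b\<in>UNIV. \<Sum>j\<in>UNIV. \<Sum>k\<in>UNIV. (?J $ a $ j * ?I $ j $ k * ?J $ b $ k) *\<^sub>R C' (axis a 1) (axis b 1))"
      by (rule sum.cong[OF refl], rule sum.swap)
    also have "\<dots> = (\<Sum>a\<in>UNIV. \<Sum>b\<in>UNIV. (?J ** ?I ** transpose ?J) $ a $ b *\<^sub>R C' (axis a 1) (axis b 1))"
    proof (intro sum.cong refl)
      fix a b
      have "(?J ** ?I ** transpose ?J) $ a $ b = (\<Sum>k\<in>UNIV. \<Sum>j\<in>UNIV. ?J $ a $ j * ?I $ j $ k * ?J $ b $ k)"
      proof -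
        have mm: "(A ** B) $ a $ b = (\<Sum>k\<in>UNIV. A $ a $ k * B $ k $ b)" for A B :: "real^'n^'n" and a b
          by (simp add: matrix_matrix_mult_def)
        show ?thesis by (simp add: mm transpose_def sum_distrib_right)
      qed
      also have "\<dots> = (\<Sum>j\<in>UNIV. \<Sum>k\<in>UNIV. ?J $ a $ j * ?I $ j $ k * ?J $ b $ k)" by (rule sum.swap)
      finally show "(\<Sum>j\<in>UNIV. \<Sum>k\<in>UNIV. (?J $ a $ j * ?I $ j $ k * ?J $ b $ k) *\<^sub>R C' (axis a 1) (axis b 1))
         = (?J ** ?I ** transpose ?J) $ a $ b *\<^sub>R C' (axis a 1) (axis b 1)"
        by (simp add: scaleR_sum_left)
    qed
    finally show ?thesis unfolding II .
  qed
  let ?\<theta> = "\<chi> j. \<Sum>k\<in>UNIV. C (axis k 1) (axis j 1) $ k" and ?\<theta>' = "\<chi> j. \<Sum>k\<in>UNIV. C' (axis k 1) (axis j 1) $ k"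
  have tr: "(\<Sum>k\<in>UNIV. C (axis k 1) v $ k) = (\<Sum>k\<in>UNIV. C' (axis k 1) (J x v) $ k)" for v
    by (rule linear_trace_conj[where f = "\<lambda>u. C u v" and h = "\<lambda>u. C' u (J x v)", OF _ _ lin J_invertible[OF x]])
      (use bil law in \<open>auto simp: bilinear_def\<close>)
  have th: "?\<theta> = transpose ?J *v ?\<theta>'"
  proof -
    have "(\<Sum>k\<in>UNIV. C' (axis k 1) w $ k) = w \<bullet> ?\<theta>'" for w
    proof -
      have l: "linear (C' u)" for u using bil by (simp add: bilinear_def)
      have "(\<Sum>k\<in>UNIV. C' (axis k 1) w $ k) = (\<Sum>k\<in>UNIV. C' (axis k 1) (\<Sum>m\<in>UNIV. w $ m *\<^sub>R axis m 1) $ k)"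
        using vec_axis_sum[of w] by metis
      also have "\<dots> = (\<Sum>k\<in>UNIV. \<Sum>m\<in>UNIV. w $ m * C' (axis k 1) (axis m 1) $ k)"
        by (simp add: linear_sum[OF l] linear_cmul[OF l])
      also have "\<dots> = (\<Sum>m\<in>UNIV. \<Sum>k\<in>UNIV. w $ m * C' (axis k 1) (axis m 1) $ k)" by (rule sum.swap)
      finally show ?thesis by (simp add: inner_vec_def sum_distrib_left)
    qed
    then have "?\<theta> $ j = J x (axis j 1) \<bullet> ?\<theta>'" for j
      unfolding vec_lambda_beta by (rule trans[OF tr])
    moreover have "J x (axis j 1) \<bullet> ?\<theta>' = (transpose ?J *v ?\<theta>') $ j" for j
      by (simp add: inner_vec_def matrix_vector_mult_def transpose_def Je)
    ultimately show ?thesis by (simp add: vec_eq_iff)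
  qed
  have 2: "J x (?I *v ?\<theta>) = ?I' *v ?\<theta>'"
  proof -
    have "J x (?I *v ?\<theta>) = ?J *v (?I *v ?\<theta>)" by (rule matrix_J[OF x, symmetric])
    also have "\<dots> = ?J *v (?I *v (transpose ?J *v ?\<theta>'))" by (rule arg_cong[OF th])
    also have "\<dots> = (?J ** ?I ** transpose ?J) *v ?\<theta>'"
      by (simp only: matrix_vector_mul_assoc matrix_mul_assoc)
    finally show ?thesis unfolding II .
  qed
  show ?thesis
    unfolding palatini_vec_def linear_diff[OF lin] 1 2 ..
qed

end

subsection \<open>The divergence theorem for the variation\<close>

context
  fixes A :: "('m::t2_space, 'n::finite) chart set" and P :: "'p::euclidean_space set" and \<gamma> :: "'p \<Rightarrow> ('m, 'n) tensor"
    and z e :: 'p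
  assumes atlas: "smooth_atlas A" and P: "open P" and fam: "smooth_family A P \<gamma>" and z: "z \<in> P"
begin

text \<open>In contrast to the Christoffel symbols, their variation is a tensor. This makes \<open>pal\<close>, defined chart by
  chart, a vector field on the manifold (\<open>pal_law\<close>).\<close>

definition dchr :: "('m, 'n) chart \<Rightarrow> real^'n \<Rightarrow> real^'n \<Rightarrow> real^'n \<Rightarrow> real^'n" where
  "dchr c x u v = dd (\<lambda>z. chr (loc (\<gamma> z) c) x u v) z e"

definition pal :: "('m, 'n) chart \<Rightarrow> real^'n \<Rightarrow> real^'n" where
  "pal c x = palatini_vec (matrix_inv (loc (\<gamma> z) c x)) (dchr c x)"

context
  fixes c assumes c: "c \<in> A"
begin

private lemma lmz: "z' \<in> P \<Longrightarrow> local_metric (img_c c) (loc (\<gamma> z') c)"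
  by (rule fam_local_metric[OF atlas P fam _ c])

lemma chr_param_deriv:
  assumes x: "x \<in> img_c c"
  shows "((\<lambda>z. chr (loc (\<gamma> z) c) x u v) has_derivative dd (\<lambda>z. chr (loc (\<gamma> z) c) x u v) z) (at z)"
  using smooth_on_has_derivative[OF smooth_slice_fst[OF P open_img[OF atlas c] fam_smooth_chr[OF atlas P fam c] x] z]
  by simp

lemma dchr_smooth: "smooth_on (img_c c) (\<lambda>x. dchr c x u v)"
  using smooth_slice_snd[OF P open_img[OF atlas c] smooth_dd_fst[OF P open_img[OF atlas c] fam_smooth_chr[OF atlas P fam c]] z]
  by (simp add: dchr_def)

lemma dchr_sym: assumes x: "x \<in> img_c c" shows "dchr c x u v = dchr c x v u"
proof -
  have "((\<lambda>z. chr (loc (\<gamma> z) c) x v u) has_derivative dd (\<lambda>z. chr (loc (\<gamma> z) c) x u v) z) (at z)"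
    by (rule has_derivative_transform_within_open[OF chr_param_deriv[OF x] P z]) (rule chr_sym[OF lmz x])
  then show ?thesis unfolding dchr_def by (metis frechet_derivative_eqI)
qed

lemma dchr_bilinear: assumes x: "x \<in> img_c c" shows "bilinear (dchr c x)"
proof -
  have 1: "dchr c x (u + u') v = dchr c x u v + dchr c x u' v" for u u' v
    unfolding dchr_def
    by (rule fun_cong[OF frechet_derivative_eqI], rule has_derivative_transform_within_open[OF
          has_derivative_add[OF chr_param_deriv[OF x] chr_param_deriv[OF x]] P z])
      (simp add: bilinear_ladd[OF chr_bilinear[OF lmz x]])
  have 2: "dchr c x (r *\<^sub>R u) v = r *\<^sub>R dchr c x u v" for u v r
    unfolding dchr_def
    by (rule fun_cong[OF frechet_derivative_eqI], rule has_derivative_transform_within_open[OF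
          has_derivative_scaleR_right[OF chr_param_deriv[OF x]] P z])
      (simp add: bilinear_lmul[OF chr_bilinear[OF lmz x]])
  show ?thesis
    unfolding bilinear_def linear_iff using 1 2 dchr_sym[OF x] by metis
qed

lemma riem_param_deriv:
  assumes x: "x \<in> img_c c"
  shows "dd (\<lambda>z. riem (loc (\<gamma> z) c) x u w v) z e = dd (\<lambda>y. dchr c y w v) x u - dd (\<lambda>y. dchr c y u v) x w
     + (dchr c x u (chr (loc (\<gamma> z) c) x w v) + chr (loc (\<gamma> z) c) x u (dchr c x w v))
     - (dchr c x w (chr (loc (\<gamma> z) c) x u v) + chr (loc (\<gamma> z) c) x w (dchr c x u v))"
proof -
  let ?G = "\<lambda>z u v. chr (loc (\<gamma> z) c) x u v"
  note oi = open_img[OF atlas c]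
  note sc = fam_smooth_chr[OF atlas P fam c]
  have d: "((\<lambda>z. dd (\<lambda>y. chr (loc (\<gamma> z) c) y a b) x q) has_derivative
      dd (\<lambda>z. dd (\<lambda>y. chr (loc (\<gamma> z) c) y a b) x q) z) (at z)" for a b q
    using smooth_on_has_derivative[OF smooth_slice_fst[OF P oi smooth_dd_snd[OF P oi sc] x] z] by simp
  have de: "dd (\<lambda>z. dd (\<lambda>y. chr (loc (\<gamma> z) c) y a b) x q) z e = dd (\<lambda>y. dchr c y a b) x q" for a b q
    using dd_fst_snd_commute[OF P oi sc z x, of a b e q] by (simp add: dchr_def)
  have m: "((\<lambda>z. ?G z a (?G z b q)) has_derivative
      (\<lambda>r. dd (\<lambda>z. ?G z a (?G z' b q)) z r + ?G z' a (dd (\<lambda>z. ?G z b q) z r))) (at z)" if "z' = z" for a b q z'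
  proof -
    have ex: "B w = (\<Sum>m\<in>UNIV. w $ m *\<^sub>R B (axis m 1))" if "linear B" for B :: "real^'n \<Rightarrow> real^'n" and w
    proof -
      have "B w = B (\<Sum>m\<in>UNIV. w $ m *\<^sub>R axis m 1)" using vec_axis_sum[of w] by metis
      then show ?thesis by (simp add: linear_sum[OF that] linear_cmul[OF that])
    qed
    have lin: "linear (?G z a)" if "z \<in> P" for z a
      using chr_bilinear[OF lmz[OF that] x] by (simp add: bilinear_def)
    have 1: "((\<lambda>z. \<Sum>m\<in>UNIV. ?G z b q $ m *\<^sub>R ?G z a (axis m 1)) has_derivative
       (\<lambda>r. \<Sum>m\<in>UNIV. ?G z b q $ m *\<^sub>R dd (\<lambda>z. ?G z a (axis m 1)) z r
           + dd (\<lambda>z. ?G z b q) z r $ m *\<^sub>R ?G z a (axis m 1))) (at z)"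
      by (intro has_derivative_sum has_derivative_scaleR chr_param_deriv x
          bounded_linear.has_derivative[OF bounded_linear_vec_nth chr_param_deriv])
    have 2: "(\<Sum>m\<in>UNIV. w $ m *\<^sub>R dd (\<lambda>z. ?G z a (axis m 1)) z r) = dd (\<lambda>z. ?G z a w) z r" for w r
    proof -
      have "((\<lambda>z. ?G z a w) has_derivative (\<lambda>r. \<Sum>m\<in>UNIV. w $ m *\<^sub>R dd (\<lambda>z. ?G z a (axis m 1)) z r)) (at z)"
        by (rule has_derivative_transform_within_open[OF has_derivative_sum[OF has_derivative_scaleR_right[OF chr_param_deriv[OF x]]] P z])
          (rule ex[OF lin, symmetric])
      from fun_cong[OF frechet_derivative_eqI[OF this]] show ?thesis by simp
    qed
    have "((\<lambda>z. \<Sum>m\<in>UNIV. ?G z b q $ m *\<^sub>R ?G z a (axis m 1)) has_derivative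
      (\<lambda>r. dd (\<lambda>z. ?G z a (?G z' b q)) z r + ?G z' a (dd (\<lambda>z. ?G z b q) z r))) (at z)"
      using 1 unfolding sum.distrib 2 ex[OF lin[OF z], symmetric] that .
    then show ?thesis
      by (rule has_derivative_transform_within_open[OF _ P z]) (rule ex[OF lin, symmetric])
  qed
  have "((\<lambda>z. riem (loc (\<gamma> z) c) x u w v) has_derivative (\<lambda>r.
       dd (\<lambda>z. dd (\<lambda>y. chr (loc (\<gamma> z) c) y w v) x u) z r - dd (\<lambda>z. dd (\<lambda>y. chr (loc (\<gamma> z) c) y u v) x w) z r
       + (dd (\<lambda>z'. ?G z' u (?G z w v)) z r + ?G z u (dd (\<lambda>z. ?G z w v) z r))
       - (dd (\<lambda>z'. ?G z' w (?G z u v)) z r + ?G z w (dd (\<lambda>z. ?G z u v) z r)))) (at z)"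
    unfolding riem_def by (intro has_derivative_diff has_derivative_add d m[OF refl])
  from fun_cong[OF frechet_derivative_eqI[OF this], of e] show ?thesis
    unfolding de unfolding dchr_def .
qed

lemma scal_param_deriv:
  assumes x: "x \<in> img_c c"
  defines "I \<equiv> matrix_inv (loc (\<gamma> z) c x)"
  shows "sqrt_det (\<gamma> z) c x * (dd (\<lambda>z. scal_in (\<gamma> z) c x) z e
      + trace (I ** dd (\<lambda>z. loc (\<gamma> z) c x) z e ** I ** ricci (\<gamma> z) c (point c x)))
     = (\<Sum>i\<in>UNIV. dd (\<lambda>y. sqrt_det (\<gamma> z) c y * pal c y $ i) x (axis i 1))"
proof -
  note oi = open_img[OF atlas c]
  let ?h = "dd (\<lambda>z. loc (\<gamma> z) c x) z e"
  let ?R = "\<lambda>z. ricci (\<gamma> z) c (point c x)"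
  have sM: "smooth_on P (\<lambda>z. loc (\<gamma> z) c x)"
    using smooth_slice_fst[OF P oi fam_smooth[OF atlas P fam c] x] by simp
  have dI: "((\<lambda>z. matrix_inv (loc (\<gamma> z) c x)) has_derivative (\<lambda>r. - (I ** dd (\<lambda>z. loc (\<gamma> z) c x) z r ** I))) (at z)"
    unfolding I_def
    by (rule has_derivative_matrix_inv[OF P z sM]) (use pos_sym_det[OF lm_pos[OF lmz x]] in force)
  have dR: "(?R has_derivative dd ?R z) (at z)"
    using smooth_on_has_derivative[OF smooth_slice_fst[OF P oi fam_smooth_ricci[OF atlas P fam c] x] z] by simp
  have "((\<lambda>z. scal_in (\<gamma> z) c x) has_derivative (\<lambda>r. trace (I ** dd ?R z r + - (I ** dd (\<lambda>z. loc (\<gamma> z) c x) z r ** I) ** ?R z))) (at z)"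
    unfolding scal_in_def I_def
    by (rule bounded_linear.has_derivative[OF bounded_linear_trace
        bounded_bilinear.FDERIV[OF bounded_bilinear_matrix_mult dI[unfolded I_def] dR]])
  from fun_cong[OF frechet_derivative_eqI[OF this], of e]
  have S: "dd (\<lambda>z. scal_in (\<gamma> z) c x) z e = trace (I ** dd ?R z e) - trace (I ** ?h ** I ** ?R z)"
    by (simp add: trace_add trace_sub bounded_bilinear.minus_left[OF bounded_bilinear_matrix_mult]
        linear_neg[OF bounded_linear.linear[OF bounded_linear_trace]])
  have R: "dd ?R z e $ j $ k = (\<Sum>i\<in>UNIV. dd (\<lambda>z. riem (loc (\<gamma> z) c) x (axis i 1) (axis j 1) (axis k 1)) z e $ i)" for j k
  proof -
    have rd: "((\<lambda>z. riem (loc (\<gamma> z) c) x u w v) has_derivative dd (\<lambda>z. riem (loc (\<gamma> z) c) x u w v) z) (at z)" for u w v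
      using smooth_on_has_derivative[OF smooth_slice_fst[OF P oi fam_smooth_riem[OF atlas P fam c] x] z] by simp
    have "((\<lambda>z. ?R z $ j $ k) has_derivative (\<lambda>r. \<Sum>i\<in>UNIV. dd (\<lambda>z. riem (loc (\<gamma> z) c) x (axis i 1) (axis j 1) (axis k 1)) z r $ i)) (at z)"
    proof (rule has_derivative_transform_within_open[OF _ P z])
      show "((\<lambda>z. \<Sum>i\<in>UNIV. riem (loc (\<gamma> z) c) x (axis i 1) (axis j 1) (axis k 1) $ i) has_derivative
         (\<lambda>r. \<Sum>i\<in>UNIV. dd (\<lambda>z. riem (loc (\<gamma> z) c) x (axis i 1) (axis j 1) (axis k 1)) z r $ i)) (at z)"
        by (intro has_derivative_sum bounded_linear.has_derivative[OF bounded_linear_vec_nth rd])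
      show "(\<Sum>i\<in>UNIV. riem (loc (\<gamma> z') c) x (axis i 1) (axis j 1) (axis k 1) $ i) = ?R z' $ j $ k" if "z' \<in> P" for z'
        using that x by (simp add: ricci_def coord_point[OF atlas c] riemann_riem[OF atlas fam_Met[OF atlas P fam] c])
    qed
    moreover have "((\<lambda>z. ?R z $ j $ k) has_derivative (\<lambda>r. dd ?R z r $ j $ k)) (at z)"
      by (intro bounded_linear.has_derivative[OF bounded_linear_vec_nth] dR)
    ultimately show ?thesis using has_derivative_unique by (metis (no_types, lifting))
  qed
  have tr: "trace (I ** dd ?R z e) = (\<Sum>j\<in>UNIV. \<Sum>k\<in>UNIV. I $ k $ j * dd ?R z e $ j $ k)"
    unfolding trace_def matrix_matrix_mult_def by (simp, rule sum.swap)
  have "(\<Sum>i\<in>UNIV. dd (\<lambda>y. sqrt_det (\<gamma> z) c y * pal c y $ i) x (axis i 1)) = sqrt_det (\<gamma> z) c x * trace (I ** dd ?R z e)"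
    unfolding tr unfolding R riem_param_deriv[OF x] pal_def sqrt_det_def I_def
    by (rule palatini[OF lmz[OF z] x dchr_bilinear[OF x] dchr_sym[OF x] smooth_on_differentiable[OF dchr_smooth x]])
  then show ?thesis unfolding S by simp
qed

lemma pal_smooth: "smooth_on (img_c c) (\<lambda>x. pal c x $ i)"
proof -
  note oi = open_img[OF atlas c]
  note si = smooth_on_inv_entry[OF lmz[OF z]]
  have W: "pal c y $ i = (\<Sum>j\<in>UNIV. \<Sum>k\<in>UNIV. matrix_inv (loc (\<gamma> z) c y) $ j $ k * dchr c y (axis j 1) (axis k 1) $ i)
        - (\<Sum>j\<in>UNIV. matrix_inv (loc (\<gamma> z) c y) $ i $ j * (\<Sum>k\<in>UNIV. dchr c y (axis k 1) (axis j 1) $ k))" for y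
    by (simp add: pal_def palatini_vec_def matrix_vector_mult_def)
  show ?thesis unfolding W
    by (intro smooth_on_diff[OF oi] smooth_on_sum[OF oi] smooth_on_mult[OF oi] si smooth_on_vec_nth[OF oi] dchr_smooth)
qed

end

text \<open>The inhomogeneous term of \<open>chr_law\<close> depends only on the change of charts, not on the metric, so it disappears in the
  derivative along the family.\<close>

lemma pal_law:
  assumes c: "c \<in> A" and d: "d \<in> A" and p: "p \<in> dom_c c" "p \<in> dom_c d"
  shows "dd (coord d \<circ> point c) (coord c p) (pal c (coord c p)) = pal d (coord d p)"
proof -
  have x: "coord c p \<in> coord c ` (dom_c c \<inter> dom_c d)" using p by auto
  have xi: "coord c p \<in> img_c c" "coord d p \<in> img_c d" using p by (auto simp: img_c_def)
  interpret chart_change "img_c c" "img_c d" "coord c ` (dom_c c \<inter> dom_c d)" "loc (\<gamma> z) c" "loc (\<gamma> z) d" "coord d \<circ> point c"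
    by (rule chart_change_loc[OF atlas fam_Met[OF atlas P fam z] c d])
  have px: "(coord d \<circ> point c) (coord c p) = coord d p" by (simp add: point_coord[OF atlas c p(1)])
  have lin: "bounded_linear (dd (coord d \<circ> point c) (coord c p))"
    using J_linear[OF x] by (simp add: linear_conv_bounded_linear)
  have law: "J (coord c p) (dchr c (coord c p) u v) = dchr d (coord d p) (J (coord c p) u) (J (coord c p) v)" for u v
  proof -
    have "((\<lambda>z'. J (coord c p) (chr (loc (\<gamma> z') c) (coord c p) u v)) has_derivative
        (\<lambda>r. J (coord c p) (dd (\<lambda>z. chr (loc (\<gamma> z) c) (coord c p) u v) z r))) (at z)"
      by (rule bounded_linear.has_derivative[OF lin chr_param_deriv[OF c xi(1)]])
    moreover have "((\<lambda>z'. J (coord c p) (chr (loc (\<gamma> z') c) (coord c p) u v)) has_derivative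
        (\<lambda>r. dd (\<lambda>z. chr (loc (\<gamma> z) d) (coord d p) (J (coord c p) u) (J (coord c p) v)) z r + 0)) (at z)"
    proof (rule has_derivative_transform_within_open[OF has_derivative_add[OF chr_param_deriv[OF d xi(2)] has_derivative_const] P z])
      fix z' assume "z' \<in> P"
      from chart_change.chr_law[OF chart_change_loc[OF atlas fam_Met[OF atlas P fam this] c d] x, of u v]
      show "chr (loc (\<gamma> z') d) (coord d p) (J (coord c p) u) (J (coord c p) v) + H (coord c p) u v
         = J (coord c p) (chr (loc (\<gamma> z') c) (coord c p) u v)"
        unfolding px by simp
    qed
    ultimately show ?thesis
      unfolding dchr_def using has_derivative_unique by (metis (no_types, lifting) add.right_neutral)
  qed
  show ?thesis
    using palatini_vec_law[OF x dchr_bilinear[OF c xi(1)] dchr_bilinear[OF d xi(2)] law]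
    unfolding pal_def px .
qed

text \<open>The first variation of the total scalar curvature at fixed volume: up to the Ricci term it is
  the integral of a divergence. Integrating by parts against the partition of unity leaves the
  derivatives of the partition functions, whose sum is the derivative of the constant 1.\<close>

lemma first_variation:
  assumes comp: "compact (UNIV :: 'm set)" and part: "box_partition A Q cc a b \<eta>"
  defines "I \<equiv> \<lambda>q x. matrix_inv (loc (\<gamma> z) (cc q) x)"
  shows "(\<Sum>q\<in>Q. integral (cbox (a q) (b q)) (\<lambda>x. \<eta> q (point (cc q) x) * (sqrt_det (\<gamma> z) (cc q) x *
     (dd (\<lambda>z. scal_in (\<gamma> z) (cc q) x) z e
      + trace (I q x ** dd (\<lambda>z. loc (\<gamma> z) (cc q) x) z e ** I q x ** ricci (\<gamma> z) (cc q) (point (cc q) x)))))) = 0"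
proof -
  note g = fam_Met[OF atlas P fam z]
  note pf = part_chart[OF atlas part] part_box[OF atlas part] part_Ck[OF atlas part]
  \<comment> \<open>the derivative of the partition function along the vector field \<open>pal\<close>, in coordinates and as a function on the manifold\<close>
  define X where "X q c x = dd (\<lambda>x. \<eta> q (point c x)) x (pal c x)" for q c x
  define F where "F q p = X q (chart_at A p) (coord (chart_at A p) p)" for q p
  have dX: "(\<lambda>x. \<eta> q (point c x)) differentiable (at x)" if "q \<in> Q" "c \<in> A" "x \<in> img_c c" for q c x
    using pf(3)[OF that(1,2)] that(3) by simp
  have Fc: "F q p = X q c (coord c p)" if q: "q \<in> Q" and c: "c \<in> A" and p: "p \<in> dom_c c" for q c p
  proof -
    let ?d = "chart_at A p"
    note d = chart_at[OF atlas]
    have pi: "coord c p \<in> img_c c" "coord ?d p \<in> img_c ?d" using p d(2)[of p] by (auto simp: img_c_def)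
    have x: "coord c p \<in> coord c ` (dom_c c \<inter> dom_c ?d)" using p d(2)[of p] by auto
    have px: "(coord ?d \<circ> point c) (coord c p) = coord ?d p" by (simp add: point_coord[OF atlas c p])
    have "((\<lambda>x. \<eta> q (point ?d ((coord ?d \<circ> point c) x))) has_derivative
      (\<lambda>w. dd (\<lambda>x. \<eta> q (point ?d x)) (coord ?d p) (dd (coord ?d \<circ> point c) (coord c p) w))) (at (coord c p))"
      by (rule has_derivative_compose[OF smooth_on_has_derivative[OF transition_smooth[OF atlas c d(1)] x]])
        (use has_derivative_frechet[OF dX[OF q d(1) pi(2)]] in \<open>simp only: px\<close>)
    then have "((\<lambda>x. \<eta> q (point c x)) has_derivative
      (\<lambda>w. dd (\<lambda>x. \<eta> q (point ?d x)) (coord ?d p) (dd (coord ?d \<circ> point c) (coord c p) w))) (at (coord c p))"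
    proof (rule has_derivative_transform_within_open[OF _ open_overlap[OF atlas c d(1)] x])
      fix y assume "y \<in> coord c ` (dom_c c \<inter> dom_c ?d)"
      then show "\<eta> q (point ?d ((coord ?d \<circ> point c) y)) = \<eta> q (point c y)"
        by (auto simp: point_coord[OF atlas c] point_coord[OF atlas d(1)])
    qed
    from frechet_derivative_eqI[OF this] show ?thesis
      unfolding F_def X_def by (simp add: pal_law[OF c d(1) p d(2)])
  qed
  have Fcont: "continuous_on UNIV (F q)" if q: "q \<in> Q" for q
  proof (rule continuous_on_charts[OF atlas])
    fix c assume c: "c \<in> A"
    have "continuous_on (img_c c) (\<lambda>x. \<Sum>i\<in>UNIV. pal c x $ i * dd (\<lambda>x. \<eta> q (point c x)) x (axis i 1))"
    proof (intro continuous_on_sum continuous_on_mult smooth_on_continuous[OF pal_smooth[OF c]])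
      show "continuous_on (img_c c) (\<lambda>x. dd (\<lambda>x. \<eta> q (point c x)) x (axis i 1))" for i
        using pf(3)[OF q c] by simp
    qed
    then show "continuous_on (img_c c) (\<lambda>x. F q (point c x))"
    proof (rule continuous_on_eq)
      fix x assume x: "x \<in> img_c c"
      have lin: "linear (dd (\<lambda>x. \<eta> q (point c x)) x)"
        by (rule linear_frechet_derivative[OF dX[OF q c x]])
      have "F q (point c x) = dd (\<lambda>x. \<eta> q (point c x)) x (\<Sum>i\<in>UNIV. pal c x $ i *\<^sub>R axis i 1)"
        using Fc[OF q c point_in_dom[OF atlas c x]] vec_axis_sum[of "pal c x"]
        by (simp add: coord_point[OF atlas c x] X_def)
      then show "(\<Sum>i\<in>UNIV. pal c x $ i * dd (\<lambda>x. \<eta> q (point c x)) x (axis i 1)) = F q (point c x)"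
        by (simp add: linear_sum[OF lin] linear_cmul[OF lin])
    qed
  qed
  have Fz: "F q p = 0" if q: "q \<in> Q" and p: "p \<notin> point (cc q) ` cbox (a q) (b q)" for q p
  proof -
    let ?d = "chart_at A p" and ?K = "point (cc q) ` cbox (a q) (b q)"
    note d = chart_at[OF atlas]
    have "compact ?K"
      by (rule compact_continuous_image[OF continuous_on_subset[OF point_continuous[OF atlas pf(1)[OF q]] pf(2)[OF q]] compact_cbox])
    then have o: "open (coord ?d ` (dom_c ?d - ?K))"
      by (intro open_coord_image[OF atlas d(1)]) (use open_dom[OF atlas d(1)] compact_imp_closed in auto)
    have "((\<lambda>x. \<eta> q (point ?d x)) has_derivative (\<lambda>w. 0)) (at (coord ?d p))"
    proof (rule has_derivative_transform_within_open[OF has_derivative_const[of 0] o])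
      show "coord ?d p \<in> coord ?d ` (dom_c ?d - ?K)" using p d(2)[of p] by auto
      fix y assume "y \<in> coord ?d ` (dom_c ?d - ?K)"
      then obtain r where "r \<in> dom_c ?d" "r \<notin> ?K" "y = coord ?d r" by auto
      then show "0 = \<eta> q (point ?d y)"
        using part_zero[OF atlas part q] by (simp add: point_coord[OF atlas d(1)])
    qed
    from frechet_derivative_eqI[OF this] show ?thesis by (simp add: F_def X_def)
  qed
  have Fsum: "(\<Sum>q\<in>Q. F q p) = 0" for p
  proof -
    let ?d = "chart_at A p"
    note d = chart_at[OF atlas]
    have pi: "coord ?d p \<in> img_c ?d" using d(2)[of p] by (auto simp: img_c_def)
    have "((\<lambda>x. \<Sum>q\<in>Q. \<eta> q (point ?d x)) has_derivative (\<lambda>w. \<Sum>q\<in>Q. dd (\<lambda>x. \<eta> q (point ?d x)) (coord ?d p) w)) (at (coord ?d p))"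
      by (intro has_derivative_sum has_derivative_frechet dX d(1) pi)
    moreover have "((\<lambda>x. \<Sum>q\<in>Q. \<eta> q (point ?d x)) has_derivative (\<lambda>w. 0)) (at (coord ?d p))"
      by (simp add: part_sum[OF atlas part])
    ultimately have "(\<lambda>w. \<Sum>q\<in>Q. dd (\<lambda>x. \<eta> q (point ?d x)) (coord ?d p) w) = (\<lambda>w. 0)"
      by (rule has_derivative_unique)
    from fun_cong[OF this, of "pal ?d (coord ?d p)"] show ?thesis by (simp add: F_def X_def)
  qed
  have box: "integral (cbox (a q) (b q)) (\<lambda>x. \<eta> q (point (cc q) x) * (sqrt_det (\<gamma> z) (cc q) x *
     (dd (\<lambda>z. scal_in (\<gamma> z) (cc q) x) z e
      + trace (I q x ** dd (\<lambda>z. loc (\<gamma> z) (cc q) x) z e ** I q x ** ricci (\<gamma> z) (cc q) (point (cc q) x)))))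
     = - (\<integral>p. F q p \<partial>vol A (\<gamma> z))" if q: "q \<in> Q" for q
  proof -
    let ?c = "cc q"
    note c = pf(1)[OF q]
    note oi = open_img[OF atlas c]
    let ?n = "\<lambda>x. \<eta> q (point ?c x)"
    let ?w = "\<lambda>i y. sqrt_det (\<gamma> z) ?c y * pal ?c y $ i"
    have sw: "smooth_on (img_c ?c) (?w i)" for i
    proof -
      have "smooth_on (img_c ?c) (\<lambda>x. sqrt_det (\<gamma> z) ?c x)"
        using smooth_slice_snd[OF P oi fam_smooth_sqrt_det[OF atlas P fam c] z] by simp
      then show ?thesis by (rule smooth_on_mult[OF oi _ pal_smooth[OF c]])
    qed
    have cn: "continuous_on (cbox (a q) (b q)) ?n" "continuous_on (cbox (a q) (b q)) (\<lambda>x. dd ?n x v)" for v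
      using continuous_on_subset[OF Ck_on_continuous[OF pf(3)[OF q c]] pf(2)[OF q]]
        continuous_on_subset[OF _ pf(2)[OF q], of "\<lambda>x. dd ?n x v"] pf(3)[OF q c] by auto
    have cw: "continuous_on (cbox (a q) (b q)) (?w i)" "continuous_on (cbox (a q) (b q)) (\<lambda>x. dd (?w i) x v)" for i v
      by (rule continuous_on_subset[OF smooth_on_continuous[OF sw] pf(2)[OF q]],
          rule continuous_on_subset[OF smooth_on_continuous[OF smooth_on_deriv[OF sw]] pf(2)[OF q]])
    have "integral (cbox (a q) (b q)) (\<lambda>x. ?n x * (sqrt_det (\<gamma> z) ?c x *
       (dd (\<lambda>z. scal_in (\<gamma> z) ?c x) z e
        + trace (I q x ** dd (\<lambda>z. loc (\<gamma> z) ?c x) z e ** I q x ** ricci (\<gamma> z) ?c (point ?c x)))))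
      = integral (cbox (a q) (b q)) (\<lambda>x. (\<Sum>i\<in>UNIV. ?n x * dd (?w i) x (axis i 1)))"
    proof (rule integral_cong)
      fix x assume "x \<in> cbox (a q) (b q)"
      then have x: "x \<in> img_c ?c" using pf(2)[OF q] by blast
      show "?n x * (sqrt_det (\<gamma> z) ?c x *
       (dd (\<lambda>z. scal_in (\<gamma> z) ?c x) z e
        + trace (I q x ** dd (\<lambda>z. loc (\<gamma> z) ?c x) z e ** I q x ** ricci (\<gamma> z) ?c (point ?c x))))
        = (\<Sum>i\<in>UNIV. ?n x * dd (?w i) x (axis i 1))"
        unfolding I_def scal_param_deriv[OF c x] sum_distrib_left ..
    qed
    also have "\<dots> = (\<Sum>i\<in>UNIV. integral (cbox (a q) (b q)) (\<lambda>x. ?n x * dd (?w i) x (axis i 1)))"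
      by (rule integral_sum) (auto intro!: integrable_continuous continuous_on_mult cn cw)
    also have "\<dots> = (\<Sum>i\<in>UNIV. - integral (cbox (a q) (b q)) (\<lambda>x. dd ?n x (axis i 1) * ?w i x))"
    proof (rule sum.cong[OF refl])
      fix i
      have "integral (cbox (a q) (b q)) (\<lambda>x. ?n x * dd (?w i) x (axis i 1) + dd ?n x (axis i 1) * ?w i x) = 0"
        by (rule part_integration_by_parts[OF atlas part q smooth_on_imp_Ck[OF sw]])
      moreover have "integral (cbox (a q) (b q)) (\<lambda>x. ?n x * dd (?w i) x (axis i 1) + dd ?n x (axis i 1) * ?w i x)
        = integral (cbox (a q) (b q)) (\<lambda>x. ?n x * dd (?w i) x (axis i 1)) + integral (cbox (a q) (b q)) (\<lambda>x. dd ?n x (axis i 1) * ?w i x)"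
        by (rule Henstock_Kurzweil_Integration.integral_add)
          (rule integrable_continuous, rule continuous_on_mult, rule cn, rule cw)+
      ultimately show "integral (cbox (a q) (b q)) (\<lambda>x. ?n x * dd (?w i) x (axis i 1))
        = - integral (cbox (a q) (b q)) (\<lambda>x. dd ?n x (axis i 1) * ?w i x)" by linarith
    qed
    also have "\<dots> = - integral (cbox (a q) (b q)) (\<lambda>x. \<Sum>i\<in>UNIV. dd ?n x (axis i 1) * ?w i x)"
      unfolding sum_negf
      by (subst integral_sum) (auto intro!: integrable_continuous continuous_on_mult cn cw)
    also have "integral (cbox (a q) (b q)) (\<lambda>x. \<Sum>i\<in>UNIV. dd ?n x (axis i 1) * ?w i x)
       = integral (cbox (a q) (b q)) (\<lambda>x. F q (point ?c x) * sqrt_det (\<gamma> z) ?c x)"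
    proof (rule integral_cong)
      fix x assume "x \<in> cbox (a q) (b q)"
      then have x: "x \<in> img_c ?c" using pf(2)[OF q] by blast
      have lin: "linear (dd ?n x)" by (rule linear_frechet_derivative[OF dX[OF q c x]])
      have "F q (point ?c x) = dd ?n x (\<Sum>i\<in>UNIV. pal ?c x $ i *\<^sub>R axis i 1)"
        using Fc[OF q c point_in_dom[OF atlas c x]] vec_axis_sum[of "pal ?c x"]
        by (simp add: coord_point[OF atlas c x] X_def)
      then have "F q (point ?c x) = (\<Sum>i\<in>UNIV. pal ?c x $ i * dd ?n x (axis i 1))"
        by (simp add: linear_sum[OF lin] linear_cmul[OF lin])
      then show "(\<Sum>i\<in>UNIV. dd ?n x (axis i 1) * ?w i x) = F q (point ?c x) * sqrt_det (\<gamma> z) ?c x"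
        by (simp add: sum_distrib_right sum_distrib_left mult_ac)
    qed
    also have "\<dots> = (\<integral>p. F q p \<partial>vol A (\<gamma> z))"
      by (rule integral_vol_box(2)[OF atlas g comp c Fcont[OF q] pf(2)[OF q] Fz[OF q], symmetric])
    finally show ?thesis .
  qed
  have "(\<Sum>q\<in>Q. \<integral>p. F q p \<partial>vol A (\<gamma> z)) = (\<integral>p. (\<Sum>q\<in>Q. F q p) \<partial>vol A (\<gamma> z))"
    by (rule Bochner_Integration.integral_sum[symmetric])
      (rule integral_vol_box(1)[OF atlas g comp pf(1) Fcont pf(2) Fz])
  then show ?thesis by (simp add: box sum_negf Fsum)
qed

end

section \<open>Rays through an Einstein metric\<close>

definition ray :: "('m, 'n::finite) tensor \<Rightarrow> real \<Rightarrow> ('m, 'n) tensor" where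
  "ray g r = (\<lambda>c p. r *\<^sub>R g c p)"

lemma matrix_inv_scaleR:
  fixes B :: "real^'n^'n"
  assumes "invertible B" "r \<noteq> 0"
  shows "matrix_inv (r *\<^sub>R B) = (1 / r) *\<^sub>R matrix_inv B"
  by (rule matrix_inv_eqI)
    (simp add: bounded_bilinear.scaleR_left[OF bounded_bilinear_matrix_mult]
      bounded_bilinear.scaleR_right[OF bounded_bilinear_matrix_mult] matrix_inv_mult assms)

lemma det_scaleR_matrix:
  fixes B :: "real^'n^'n"
  shows "det (r *\<^sub>R B) = r ^ CARD('n) * det B"
proof -
  have "r *\<^sub>R B = (\<chi> i. r *s B $ i)" by (simp add: vec_eq_iff)
  then show ?thesis using det_rows_mul[of "\<lambda>i. r" "\<lambda>i. B $ i"] by simp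
qed

context
  fixes U :: "(real^'n) set" and M :: "real^'n \<Rightarrow> real^'n^'n" and r :: real
  assumes lm: "local_metric U M" and r: "r > 0"
begin

lemma dd_scaled: "x \<in> U \<Longrightarrow> dd (\<lambda>x. r *\<^sub>R M x) x w = r *\<^sub>R dd M x w"
  by (rule fun_cong[OF frechet_derivative_eqI[OF has_derivative_scaleR_right[OF
      has_derivative_frechet[OF lm_differentiable[OF lm]]]]])

text \<open>The factor \<open>r\<close> from the derivatives cancels against \<open>1 / r\<close> from the inverse matrix; therefore the Ricci tensor does
  not change along the ray.\<close>

lemma chr_scaled: "x \<in> U \<Longrightarrow> chr (\<lambda>x. r *\<^sub>R M x) x u v = chr M x u v"
proof -
  assume x: "x \<in> U"
  have e1: "matrix_inv (r *\<^sub>R M x) = (1 / r) *\<^sub>R matrix_inv (M x)"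
    using r matrix_inv_scaleR[OF pos_sym_invertible[OF lm_pos[OF lm x]], of r] by simp
  have e2: "(r *\<^sub>R dd M x u) *v v + (r *\<^sub>R dd M x v) *v u - (\<chi> l. u \<bullet> ((r *\<^sub>R dd M x (axis l 1)) *v v))
     = r *\<^sub>R (dd M x u *v v + dd M x v *v u - (\<chi> l. u \<bullet> (dd M x (axis l 1) *v v)))"
    by (simp add: vec_eq_iff scaleR_matrix_vector_assoc[symmetric] algebra_simps)
  have "chr (\<lambda>x. r *\<^sub>R M x) x u v = (1/2) *\<^sub>R (((1 / r) *\<^sub>R matrix_inv (M x)) *v
     (r *\<^sub>R (dd M x u *v v + dd M x v *v u - (\<chi> l. u \<bullet> (dd M x (axis l 1) *v v)))))"
    unfolding chr_def dd_scaled[OF x] e1 e2 ..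
  also have "\<dots> = chr M x u v"
    using r by (simp add: chr_def matrix_vector_mult_scaleR scaleR_matrix_vector_assoc[symmetric])
  finally show ?thesis .
qed

lemma riem_scaled: assumes x: "x \<in> U" shows "riem (\<lambda>x. r *\<^sub>R M x) x u w v = riem M x u w v"
proof -
  have "dd (\<lambda>y. chr (\<lambda>x. r *\<^sub>R M x) y a b) x = dd (\<lambda>y. chr M y a b) x" for a b
    by (rule frechet_derivative_eqI, rule has_derivative_transform_within_open[OF
          smooth_on_has_derivative[OF smooth_chr[OF lm] x] lm_open[OF lm] x]) (simp add: chr_scaled)
  then show ?thesis by (simp add: riem_def chr_scaled[OF x])
qed

end

lemma sqrt_det_ray:
  fixes g :: "('m, 'n::finite) tensor"
  shows "sqrt_det (ray g r) c x = sqrt (r ^ CARD('n)) * sqrt_det g c x"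
  by (simp add: sqrt_det_def ray_def det_scaleR_matrix real_sqrt_mult)

context
  fixes A :: "('m::t2_space, 'n::finite) chart set" and g :: "('m, 'n) tensor"
  assumes atlas: "smooth_atlas A" and g: "g \<in> Met A"
begin

lemma ray_Met: assumes r: "r > 0" shows "ray g r \<in> Met A"
proof -
  have tf: "sym_tensor_field A g" and pos: "\<And>c p v. c \<in> A \<Longrightarrow> p \<in> dom_c c \<Longrightarrow> v \<noteq> 0 \<Longrightarrow> v \<bullet> (g c p *v v) > 0"
    using g unfolding Met_def by blast+
  have "sym_tensor_field A (ray g r)"
    unfolding sym_tensor_field_def
  proof (intro conjI ballI allI impI)
    fix c assume c: "c \<in> A"
    show "smooth_on (img_c c) (\<lambda>x. ray g r c (point c x))"
      unfolding ray_def by (intro smooth_on_scaleR[OF open_img[OF atlas c]] smooth_on_const Met_smooth[OF atlas g c])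
    fix p assume p: "p \<in> dom_c c"
    show "transpose (ray g r c p) = ray g r c p"
      using Met_pos[OF atlas g c p] by (simp add: ray_def pos_sym_def transpose_scalar)
  next
    fix c d p assume "c \<in> A" "d \<in> A" "p \<in> dom_c c \<inter> dom_c d"
    then have "g c p = transpose (jacobian c d p) ** g d p ** jacobian c d p"
      by (intro Met_law[OF atlas g]) auto
    then show "ray g r c p = transpose (jacobian c d p) ** ray g r d p ** jacobian c d p"
      unfolding ray_def bounded_bilinear.scaleR_right[OF bounded_bilinear_matrix_mult]
        bounded_bilinear.scaleR_left[OF bounded_bilinear_matrix_mult] by (rule arg_cong)
  next
    fix c p assume "\<not> (c \<in> A \<and> p \<in> dom_c c)"
    then have "g c p = 0" using tf unfolding sym_tensor_field_def by blast
    then show "ray g r c p = 0" by (simp add: ray_def)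
  qed
  moreover have "v \<bullet> (ray g r c p *v v) > 0" if "c \<in> A" "p \<in> dom_c c" "v \<noteq> 0" for c p v
    using pos[OF that] r by (simp add: ray_def scaleR_matrix_vector_assoc[symmetric])
  ultimately show ?thesis unfolding Met_def by blast
qed

lemma ricci_ray:
  assumes r: "r > 0" and c: "c \<in> A" and p: "p \<in> dom_c c"
  shows "ricci (ray g r) c p = ricci g c p"
proof -
  have x: "coord c p \<in> img_c c" using p by (simp add: img_c_def)
  have "loc (ray g r) c = (\<lambda>x. r *\<^sub>R loc g c x)" by (simp add: ray_def)
  then show ?thesis
    unfolding ricci_def riemann_riem[OF atlas g c x] riemann_riem[OF atlas ray_Met[OF r] c x]
    by (simp add: riem_scaled[OF local_metric_loc[OF atlas g c] r x])
qed

lemma ray_smooth_family: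
  assumes I: "open I" and r: "smooth_on I r" "\<And>t. t \<in> I \<Longrightarrow> r t > 0"
  shows "smooth_family A I (\<lambda>t. ray g (r t))"
  unfolding smooth_family_def
proof (intro conjI ballI)
  show "ray g (r t) \<in> Met A" if "t \<in> I" for t using ray_Met r that by simp
  fix c assume c: "c \<in> A"
  have O: "open (I \<times> img_c c)" by (rule open_Times[OF I open_img[OF atlas c]])
  have "smooth_on (I \<times> img_c c) (\<lambda>y. r (fst y) *\<^sub>R loc g c (snd y))"
  proof (rule smooth_on_scaleR[OF O])
    show "smooth_on (I \<times> img_c c) (\<lambda>y. r (fst y))"
      by (rule smooth_on_compose[OF O smooth_on_bounded_linear[OF O bounded_linear_fst] r(1)]) auto
    show "smooth_on (I \<times> img_c c) (\<lambda>y. loc g c (snd y))"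
      by (rule smooth_on_compose[OF O smooth_on_bounded_linear[OF O bounded_linear_snd] Met_smooth[OF atlas g c]]) auto
  qed
  then show "smooth_on (I \<times> img_c c) (\<lambda>(t, x). ray g (r t) c (point c x))"
    by (simp add: ray_def case_prod_unfold)
qed

end

section \<open>The energy of a family of metrics\<close>

context
  fixes A :: "('m::t2_space, 'n::finite) chart set" and \<Phi> :: "real \<Rightarrow> real"
    and P :: "(real \<times> real) set" and W :: "real \<times> real \<Rightarrow> ('m, 'n) tensor"
  assumes atlas: "smooth_atlas A" and comp: "compact (UNIV :: 'm set)" and \<Phi>: "smooth_on UNIV \<Phi>"
    and P: "open P" and fam: "smooth_family A P W"
begin

text \<open>A parameter \<open>z = (s, t)\<close> consists of the variation parameter \<open>s\<close> and the time \<open>t\<close>, so the velocity is the derivative in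
  the direction \<open>(0, 1)\<close>.\<close>

definition speed2 :: "('m, 'n) chart \<Rightarrow> real \<times> real \<Rightarrow> real^'n \<Rightarrow> real" where
  "speed2 c z x = (let X = matrix_inv (loc (W z) c x) ** dd (\<lambda>z. loc (W z) c x) z (0, 1) in trace (X ** X))"

definition lagr :: "('m, 'n) chart \<Rightarrow> real \<times> real \<Rightarrow> real^'n \<Rightarrow> real" where
  "lagr c z x = \<Phi> (scal_in (W z) c x) * speed2 c z x"

lemma W_differentiable:
  assumes "c \<in> A" "x \<in> img_c c" "z \<in> P"
  shows "((\<lambda>z. loc (W z) c x) has_derivative dd (\<lambda>z. loc (W z) c x) z) (at z)"
  using smooth_on_has_derivative[OF smooth_slice_fst[OF P open_img[OF atlas assms(1)] fam_smooth[OF atlas P fam assms(1)] assms(2)] assms(3)]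
  by simp

lemma velocity_eq:
  assumes c: "c \<in> A" and p: "p \<in> dom_c c" and z: "(s, t) \<in> P"
  shows "velocity (\<lambda>t. W (s, t)) t c p = dd (\<lambda>z. loc (W z) c (coord c p)) (s, t) (0, 1)"
proof -
  have x: "coord c p \<in> img_c c" using p by (simp add: img_c_def)
  have d: "(\<lambda>z. loc (W z) c (coord c p)) differentiable (at (s, t))"
    using W_differentiable[OF c x z] by (auto simp: differentiable_def)
  have "((\<lambda>t. loc (W (s, t)) c (coord c p)) has_derivative (\<lambda>r. dd (\<lambda>z. loc (W z) c (coord c p)) (s, t) (0, r))) (at t)"
    by (rule dd_snd[OF d])
  moreover have "(\<lambda>r. dd (\<lambda>z. loc (W z) c (coord c p)) (s, t) (0, r))
      = (\<lambda>r. r *\<^sub>R dd (\<lambda>z. loc (W z) c (coord c p)) (s, t) (0, 1))"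
  proof
    fix r :: real
    show "dd (\<lambda>z. loc (W z) c (coord c p)) (s, t) (0, r) = r *\<^sub>R dd (\<lambda>z. loc (W z) c (coord c p)) (s, t) (0, 1)"
      using linear_cmul[OF linear_frechet_derivative[OF d], of r "(0, 1)"] by simp
  qed
  ultimately have "((\<lambda>t. loc (W (s, t)) c (coord c p)) has_vector_derivative dd (\<lambda>z. loc (W z) c (coord c p)) (s, t) (0, 1)) (at t)"
    by (simp only: has_vector_derivative_def)
  then show ?thesis
    unfolding velocity_def by (simp add: point_coord[OF atlas c p] vector_derivative_at)
qed

lemma velocity_law:
  assumes c: "c \<in> A" and d: "d \<in> A" and p: "p \<in> dom_c c" "p \<in> dom_c d" and z: "(s, t) \<in> P"
  shows "velocity (\<lambda>t. W (s, t)) t c p =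
    transpose (jacobian c d p) ** velocity (\<lambda>t. W (s, t)) t d p ** jacobian c d p"
proof -
  let ?J = "jacobian c d p"
  have x: "coord c p \<in> img_c c" "coord d p \<in> img_c d" using p by (auto simp: img_c_def)
  have bl: "bounded_linear (\<lambda>X. transpose ?J ** X ** ?J)"
    by (rule bounded_linear_compose[OF bounded_bilinear.bounded_linear_left[OF bounded_bilinear_matrix_mult]
        bounded_bilinear.bounded_linear_right[OF bounded_bilinear_matrix_mult]])
  have "((\<lambda>z. loc (W z) c (coord c p)) has_derivative
     (\<lambda>v. transpose ?J ** dd (\<lambda>z. loc (W z) d (coord d p)) (s, t) v ** ?J)) (at (s, t))"
  proof (rule has_derivative_transform_within_open[OF bounded_linear.has_derivative[OF bl W_differentiable[OF d x(2) z]] P z])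
    fix z' assume "z' \<in> P"
    then show "transpose ?J ** loc (W z') d (coord d p) ** ?J = loc (W z') c (coord c p)"
      using Met_law[OF atlas fam_Met[OF atlas P fam] c d p]
      by (simp add: point_coord[OF atlas c p(1)] point_coord[OF atlas d p(2)])
  qed
  from fun_cong[OF frechet_derivative_eqI[OF this], of "(0, 1)"] show ?thesis
    unfolding velocity_eq[OF c p(1) z] velocity_eq[OF d p(2) z] .
qed

context
  fixes c assumes c: "c \<in> A"
begin

private lemma open_lagr_dom: "open (P \<times> img_c c)" by (rule open_Times[OF P open_img[OF atlas c]])

lemma speed2_smooth: "smooth_on (P \<times> img_c c) (\<lambda>y. speed2 c (fst y) (snd y))"
proof -
  have "smooth_on (P \<times> img_c c) (\<lambda>y. dd (\<lambda>z. loc (W z) c (snd y)) (fst y) (0, 1))"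
    using smooth_dd_fst[OF P open_img[OF atlas c] fam_smooth[OF atlas P fam c]] by simp
  then show ?thesis
    unfolding speed2_def Let_def
    by (intro smooth_on_trace[OF open_lagr_dom] smooth_on_matrix_mult[OF open_lagr_dom] fam_smooth_inv[OF atlas P fam c])
qed

lemma lagr_smooth: "smooth_on (P \<times> img_c c) (\<lambda>y. lagr c (fst y) (snd y))"
  unfolding lagr_def
  by (intro smooth_on_mult[OF open_lagr_dom] speed2_smooth smooth_on_compose[OF open_lagr_dom fam_smooth_scal[OF atlas P fam c] \<Phi>]) simp

lemma lagr_vol_smooth: "smooth_on (P \<times> img_c c) (\<lambda>y. lagr c (fst y) (snd y) * sqrt_det (W (fst y)) c (snd y))"
  by (intro smooth_on_mult[OF open_lagr_dom] lagr_smooth fam_smooth_sqrt_det[OF atlas P fam c])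

end

lemma G_scal_eq:
  assumes part: "box_partition A Q cc a b \<eta>" and z: "(s, t) \<in> P"
  shows "G_scal A \<Phi> (W (s, t)) (velocity (\<lambda>t. W (s, t)) t) (velocity (\<lambda>t. W (s, t)) t)
    = (\<Sum>q\<in>Q. integral (cbox (a q) (b q)) (\<lambda>x. \<eta> q (point (cc q) x) *
        (lagr (cc q) (s, t) x * sqrt_det (W (s, t)) (cc q) x)))"
proof -
  note g = fam_Met[OF atlas P fam z]
  let ?v = "velocity (\<lambda>t. W (s, t)) t"
  let ?F = "\<lambda>p. \<Phi> (scal A (W (s, t)) p) * g02 A (W (s, t)) ?v ?v p"
  have F: "?F (point c x) = lagr c (s, t) x" if c: "c \<in> A" and x: "x \<in> img_c c" for c x
  proof -
    have p: "point c x \<in> dom_c c" by (rule point_in_dom[OF atlas c x])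
    have law: "?v c (point c x) = transpose (jacobian c d (point c x)) ** ?v d (point c x) ** jacobian c d (point c x)"
      if "d \<in> A" "point c x \<in> dom_c d" for d
      by (rule velocity_law[OF c that(1) p that(2) z])
    have v: "?v c (point c x) = dd (\<lambda>z. loc (W z) c x) (s, t) (0, 1)"
      using velocity_eq[OF c p z] unfolding coord_point[OF atlas c x] .
    have g1: "g02 A (W (s, t)) ?v ?v (point c x) = trace (matrix_inv (W (s, t) c (point c x)) ** ?v c (point c x)
        ** matrix_inv (W (s, t) c (point c x)) ** ?v c (point c x))"
      by (rule g02_chart[OF atlas g c p]) (rule law; assumption)+
    have g2: "trace (matrix_inv (W (s, t) c (point c x)) ** ?v c (point c x)
        ** matrix_inv (W (s, t) c (point c x)) ** ?v c (point c x)) = speed2 c (s, t) x"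
    proof -
      let ?V = "dd (\<lambda>z. loc (W z) c x) (s, t) (0, 1)" and ?I = "matrix_inv (W (s, t) c (point c x))"
      have "(?I ** ?V) ** (?I ** ?V) = ?I ** ?V ** ?I ** ?V" by (rule matrix_mul_assoc)
      then show ?thesis by (simp only: v speed2_def Let_def)
    qed
    show ?thesis
      unfolding lagr_def scal_in_def scal_chart[OF atlas g c p] g1 g2 ..
  qed
  have "continuous_on UNIV ?F"
  proof (rule continuous_on_charts[OF atlas])
    fix c assume c: "c \<in> A"
    have "continuous_on (img_c c) (\<lambda>x. lagr c (s, t) x)"
      using smooth_on_continuous[OF smooth_slice_snd[OF P open_img[OF atlas c] lagr_smooth[OF c] z]] by simp
    then show "continuous_on (img_c c) (\<lambda>x. ?F (point c x))"
      by (rule continuous_on_eq) (simp add: F[OF c])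
  qed
  from integral_vol_partition[OF atlas part g comp this]
  have "G_scal A \<Phi> (W (s, t)) ?v ?v = (\<Sum>q\<in>Q. integral (cbox (a q) (b q))
     (\<lambda>x. \<eta> q (point (cc q) x) * (?F (point (cc q) x) * sqrt_det (W (s, t)) (cc q) x)))"
    unfolding G_scal_def .
  also have "\<dots> = (\<Sum>q\<in>Q. integral (cbox (a q) (b q)) (\<lambda>x. \<eta> q (point (cc q) x) *
        (lagr (cc q) (s, t) x * sqrt_det (W (s, t)) (cc q) x)))"
  proof (intro sum.cong refl integral_cong)
    fix q x assume "q \<in> Q" "x \<in> cbox (a q) (b q)"
    then have "cc q \<in> A" "x \<in> img_c (cc q)" using part_chart[OF atlas part] part_box[OF atlas part] by auto
    then show "\<eta> q (point (cc q) x) * (?F (point (cc q) x) * sqrt_det (W (s, t)) (cc q) x)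
      = \<eta> q (point (cc q) x) * (lagr (cc q) (s, t) x * sqrt_det (W (s, t)) (cc q) x)" by (simp only: F)
  qed
  finally show ?thesis .
qed

lemma box_integral_deriv:
  fixes f :: "(real \<times> real) \<times> (real^'n) \<Rightarrow> real" and w :: "real^'n \<Rightarrow> real"
  assumes f: "smooth_on (P \<times> U) f" and U: "open U" "cbox l u \<subseteq> U" and w: "continuous_on (cbox l u) w"
  shows "continuous_on P (\<lambda>z. integral (cbox l u) (\<lambda>x. w x * dd (\<lambda>z. f (z, x)) z e))"
    and "continuous_on P (\<lambda>z. integral (cbox l u) (\<lambda>x. w x * f (z, x)))"
    and "\<And>S s t. open S \<Longrightarrow> convex S \<Longrightarrow> S \<times> {t} \<subseteq> P \<Longrightarrow> s \<in> S \<Longrightarrow>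
      ((\<lambda>s. integral (cbox l u) (\<lambda>x. w x * f ((s, t), x))) has_real_derivative
        integral (cbox l u) (\<lambda>x. w x * dd (\<lambda>z. f (z, x)) (s, t) (1, 0))) (at s)"
    and "\<And>S s t. open S \<Longrightarrow> convex S \<Longrightarrow> {s} \<times> S \<subseteq> P \<Longrightarrow> t \<in> S \<Longrightarrow>
      ((\<lambda>t. integral (cbox l u) (\<lambda>x. w x * f ((s, t), x))) has_real_derivative
        integral (cbox l u) (\<lambda>x. w x * dd (\<lambda>z. f (z, x)) (s, t) (0, 1))) (at t)"
proof -
  have cf: "continuous_on (P \<times> U) f" by (rule smooth_on_continuous[OF f])
  have cdf: "continuous_on (P \<times> U) (\<lambda>y. dd (\<lambda>z. f (z, snd y)) (fst y) v)" for v
    by (rule smooth_on_continuous[OF smooth_dd_fst[OF P U(1) f]])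
  have cw: "continuous_on (P' \<times> cbox l u) (\<lambda>y. w (snd y))" for P' :: "'x::topological_space set"
    by (rule continuous_on_compose2[OF w]) (auto intro!: continuous_intros)
  have df: "((\<lambda>z. f (z, x)) has_derivative dd (\<lambda>z. f (z, x)) z) (at z)" if "z \<in> P" "x \<in> cbox l u" for z x
    by (rule smooth_on_has_derivative[OF smooth_slice_fst[OF P U(1) f]]) (use that U in auto)
  have lin: "dd (\<lambda>z. f (z, x)) z (r *\<^sub>R v) = r * dd (\<lambda>z. f (z, x)) z v" if "z \<in> P" "x \<in> cbox l u" for z x r v
    using linear_cmul[OF has_derivative_linear[OF df[OF that]], of r v] by simp
  have sub: "P \<times> cbox l u \<subseteq> P \<times> U" using U by auto
  have "continuous_on (P \<times> cbox l u) (\<lambda>y. w (snd y) * dd (\<lambda>z. f (z, snd y)) (fst y) e)"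
    by (intro continuous_on_mult cw continuous_on_subset[OF cdf sub])
  then show "continuous_on P (\<lambda>z. integral (cbox l u) (\<lambda>x. w x * dd (\<lambda>z. f (z, x)) z e))"
    by (intro integral_continuous_on_param) (simp add: case_prod_unfold)
  have "continuous_on (P \<times> cbox l u) (\<lambda>y. w (snd y) * f (fst y, snd y))"
    using continuous_on_subset[OF cf sub] by (intro continuous_on_mult cw) simp
  then show "continuous_on P (\<lambda>z. integral (cbox l u) (\<lambda>x. w x * f (z, x)))"
    by (intro integral_continuous_on_param) (simp add: case_prod_unfold)
  have int: "(\<lambda>x. w x * f (z, x)) integrable_on cbox l u" if "z \<in> P" for z
    by (intro integrable_continuous continuous_on_mult w continuous_on_compose2[OF cf])
      (use that U in \<open>auto intro!: continuous_intros\<close>)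
  have curve: "((\<lambda>s. integral (cbox l u) (\<lambda>x. w x * f (k s, x))) has_real_derivative
        integral (cbox l u) (\<lambda>x. w x * dd (\<lambda>z. f (z, x)) (k s) v)) (at s)"
    if S: "open S" "convex S" "s \<in> S" and k: "\<And>s. s \<in> S \<Longrightarrow> k s \<in> P" "\<And>s. k s = k0 + s *\<^sub>R v" for S s k k0 v
  proof -
    have kk: "k = (\<lambda>s. k0 + s *\<^sub>R v)" using k(2) by (rule ext)
    have "((\<lambda>s. integral (cbox l u) (\<lambda>x. w x * f (k s, x))) has_real_derivative
        integral (cbox l u) (\<lambda>x. w x * dd (\<lambda>z. f (z, x)) (k s) v)) (at s within S)"
    proof (rule leibniz_rule_field_derivative[OF _ _ _ S(3,2)])
      fix s' x assume s': "s' \<in> S" and x: "x \<in> cbox l u"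
      have "((\<lambda>s. f (k s, x)) has_derivative (\<lambda>r. dd (\<lambda>z. f (z, x)) (k s') (r *\<^sub>R v))) (at s' within S)"
        by (rule has_derivative_compose[where f = k and g = "\<lambda>z. f (z, x)", OF _ df[OF k(1)[OF s'] x]]) (auto simp: kk intro!: derivative_eq_intros)
      then have "((\<lambda>s. f (k s, x)) has_real_derivative dd (\<lambda>z. f (z, x)) (k s') v) (at s' within S)"
        unfolding lin[OF k(1)[OF s'] x] by (simp add: has_field_derivative_def mult_commute_abs)
      then show "((\<lambda>s. w x * f (k s, x)) has_real_derivative w x * dd (\<lambda>z. f (z, x)) (k s') v) (at s' within S)"
        by (rule DERIV_cmult)
    next
      show "(\<lambda>x. w x * f (k s', x)) integrable_on cbox l u" if "s' \<in> S" for s' by (rule int[OF k(1)[OF that]])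
      have "continuous_on (S \<times> cbox l u) (\<lambda>y. dd (\<lambda>z. f (z, snd (k (fst y), snd y))) (fst (k (fst y), snd y)) v)"
        by (rule continuous_on_compose2[OF cdf]) (use k U in \<open>auto simp: k(2) intro!: continuous_intros\<close>)
      then show "continuous_on (S \<times> cbox l u) (\<lambda>(s, x). w x * dd (\<lambda>z. f (z, x)) (k s) v)"
        unfolding case_prod_unfold by (intro continuous_on_mult cw) simp
    qed
    then show ?thesis by (simp add: at_within_open[OF S(3,1)])
  qed
  show "((\<lambda>s. integral (cbox l u) (\<lambda>x. w x * f ((s, t), x))) has_real_derivative
        integral (cbox l u) (\<lambda>x. w x * dd (\<lambda>z. f (z, x)) (s, t) (1, 0))) (at s)"
    if "open S" "convex S" "S \<times> {t} \<subseteq> P" "s \<in> S" for S s t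
    by (rule curve[of S s "\<lambda>s. (s, t)" "(0, t)"]) (use that in auto)
  show "((\<lambda>t. integral (cbox l u) (\<lambda>x. w x * f ((s, t), x))) has_real_derivative
        integral (cbox l u) (\<lambda>x. w x * dd (\<lambda>z. f (z, x)) (s, t) (0, 1))) (at t)"
    if "open S" "convex S" "{s} \<times> S \<subseteq> P" "t \<in> S" for S s t
    by (rule curve[of S t "\<lambda>t. (s, t)" "(s, 0)"]) (use that in auto)
qed

lemma energy_deriv:
  assumes part: "box_partition A Q cc l u \<eta>" and e: "0 < \<epsilon>" and ab: "{a..b} \<subseteq> I" and PI: "P = {-\<epsilon><..<\<epsilon>} \<times> I"
  shows "((\<lambda>s. energy (G_scal A \<Phi>) a b (\<lambda>t. W (s, t))) has_real_derivative
     (1/2) * integral {a..b} (\<lambda>t. \<Sum>q\<in>Q. integral (cbox (l q) (u q)) (\<lambda>x. \<eta> q (point (cc q) x) *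
        dd (\<lambda>z. lagr (cc q) z x * sqrt_det (W z) (cc q) x) (0, t) (1, 0)))) (at 0)"
proof -
  let ?S = "{-\<epsilon><..<\<epsilon>}"
  let ?f = "\<lambda>q y. lagr (cc q) (fst y) (snd y) * sqrt_det (W (fst y)) (cc q) (snd y)"
  let ?w = "\<lambda>q x. \<eta> q (point (cc q) x)"
  let ?K = "\<lambda>z. \<Sum>q\<in>Q. integral (cbox (l q) (u q)) (\<lambda>x. ?w q x * ?f q (z, x))"
  let ?D = "\<lambda>z. \<Sum>q\<in>Q. integral (cbox (l q) (u q)) (\<lambda>x. ?w q x * dd (\<lambda>z. ?f q (z, x)) z (1, 0))"
  note pf = part_chart[OF atlas part] part_box[OF atlas part] part_Ck[OF atlas part]
  have cw: "continuous_on (cbox (l q) (u q)) (?w q)" if "q \<in> Q" for q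
    by (rule continuous_on_subset[OF Ck_on_continuous[OF pf(3)[OF that pf(1)[OF that]]] pf(2)[OF that]])
  note B = box_integral_deriv[OF lagr_vol_smooth[OF pf(1)] open_img[OF atlas pf(1)] pf(2) cw]
  have KD: "((\<lambda>s. ?K (s, t)) has_real_derivative ?D (s, t)) (at s)" if "s \<in> ?S" "t \<in> I" for s t
    by (rule DERIV_sum, rule B(3)[of _ ?S]) (use that PI in auto)
  have Kc1: "continuous_on P ?K" by (rule continuous_on_sum) (rule B(2); assumption)
  have Kc2: "continuous_on P ?D" by (rule continuous_on_sum) (rule B(1); assumption)
  have "((\<lambda>s. integral (cbox a b) (\<lambda>t. ?K (s, t))) has_real_derivative integral (cbox a b) (\<lambda>t. ?D (0, t))) (at 0 within ?S)"
  proof (rule leibniz_rule_field_derivative[where f = "\<lambda>s t. ?K (s, t)" and fx = "\<lambda>s t. ?D (s, t)"])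
    show "((\<lambda>s. ?K (s, t)) has_real_derivative ?D (s, t)) (at s within ?S)" if "s \<in> ?S" "t \<in> cbox a b" for s t
      by (rule has_field_derivative_at_within, rule KD) (use that ab in auto)
    show "(\<lambda>t. ?K (s, t)) integrable_on cbox a b" if "s \<in> ?S" for s
      by (intro integrable_continuous continuous_on_compose2[OF Kc1]) (use that ab PI in \<open>auto intro!: continuous_intros\<close>)
    have "continuous_on (?S \<times> cbox a b) ?D"
      by (rule continuous_on_subset[OF Kc2]) (use ab PI in auto)
    then show "continuous_on (?S \<times> cbox a b) (\<lambda>(s, t). ?D (s, t))" by (simp add: case_prod_unfold)
  qed (use e in auto)
  then have "((\<lambda>s. integral {a..b} (\<lambda>t. ?K (s, t))) has_real_derivative integral {a..b} (\<lambda>t. ?D (0, t))) (at 0)"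
    using e by (simp add: at_within_open[of 0 ?S])
  then have "((\<lambda>s. (1/2) * integral {a..b} (\<lambda>t. ?K (s, t))) has_real_derivative (1/2) * integral {a..b} (\<lambda>t. ?D (0, t))) (at 0)"
    by (rule DERIV_cmult)
  then have "((\<lambda>s. energy (G_scal A \<Phi>) a b (\<lambda>t. W (s, t))) has_real_derivative (1/2) * integral {a..b} (\<lambda>t. ?D (0, t))) (at 0)"
  proof (rule has_field_derivative_transform_within_open[where S = ?S])
    show "1/2 * integral {a..b} (\<lambda>t. ?K (s, t)) = energy (G_scal A \<Phi>) a b (\<lambda>t. W (s, t))" if "s \<in> ?S" for s
      unfolding energy_def
      by (rule arg_cong[where f = "\<lambda>x. 1/2 * x"], rule integral_cong) (use that ab PI in \<open>auto simp: G_scal_eq[OF part]\<close>)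
  qed (use e in auto)
  then show ?thesis by simp
qed

end

section \<open>The reparametrised ray is a geodesic\<close>

lemma has_derivative_dd: "(f has_derivative f') (at x) \<Longrightarrow> (f has_derivative dd f x) (at x)"
  by (metis frechet_derivative_eqI)

text \<open>On the ray through an Einstein metric the Lagrangian of the energy is, up to a constant factor,
  \<open>ray_density r * (r')\<^sup>2\<close>.\<close>

definition ray_density :: "(real \<Rightarrow> real) \<Rightarrow> real \<Rightarrow> nat \<Rightarrow> real \<Rightarrow> real" where
  "ray_density \<Phi> \<Lambda> n \<rho> = \<Phi> (real n * \<Lambda> / \<rho>) * sqrt (\<rho> ^ n) / \<rho>\<^sup>2"

lemma ray_density_smooth:
  assumes \<Phi>: "smooth_on UNIV \<Phi>"
  shows "smooth_on {0<..} (ray_density \<Phi> \<Lambda> n)"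
proof -
  have o: "open ({0<..} :: real set)" by simp
  have "smooth_on {0<..} (\<lambda>\<rho>. \<Phi> (real n * \<Lambda> / \<rho>))"
    by (rule smooth_on_compose[OF o _ \<Phi>]) (auto intro!: smooth_on_divide o smooth_on_const smooth_on_id)
  then show ?thesis
    unfolding ray_density_def[abs_def]
    by (intro smooth_on_divide smooth_on_mult smooth_on_sqrt smooth_on_power smooth_on_id o) auto
qed

lemma ray_density_pos: "(\<And>u. \<Phi> u > 0) \<Longrightarrow> \<rho> > 0 \<Longrightarrow> ray_density \<Phi> \<Lambda> n \<rho> > 0"
  by (simp add: ray_density_def)

lemma ray_density_deriv:
  assumes \<Phi>: "(\<Phi> has_real_derivative \<Phi>') (at (real n * \<Lambda> / \<rho>))" and \<rho>: "\<rho> > 0"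
  shows "(ray_density \<Phi> \<Lambda> n has_real_derivative
     sqrt (\<rho> ^ n) / \<rho>\<^sup>2 * (- (\<Phi>' * (real n * \<Lambda>) / \<rho>\<^sup>2) + \<Phi> (real n * \<Lambda> / \<rho>) * (real n / 2 - 2) / \<rho>)) (at \<rho>)"
proof -
  have s: "((\<lambda>\<rho>. sqrt (\<rho> ^ n)) has_real_derivative sqrt (\<rho> ^ n) * (real n / 2) / \<rho>) (at \<rho>)"
  proof -
    have pos: "\<rho> ^ n > 0" using \<rho> by simp
    have e: "real n * \<rho> ^ (n - 1) = real n * \<rho> ^ n / \<rho>"
      using \<rho> by (cases n) auto
    have "((\<lambda>\<rho>. sqrt (\<rho> ^ n)) has_real_derivative (real n * \<rho> ^ (n - 1)) * (inverse (sqrt (\<rho> ^ n)) / 2)) (at \<rho>)"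
      using DERIV_chain2[OF DERIV_real_sqrt[OF pos] DERIV_pow[of n \<rho>]] by (simp add: mult.commute)
    moreover have "real n * \<rho> ^ n / \<rho> * (inverse (sqrt (\<rho> ^ n)) / 2) = sqrt (\<rho> ^ n) * (real n / 2) / \<rho>"
    proof -
      have "\<rho> ^ n * inverse (sqrt (\<rho> ^ n)) = sqrt (\<rho> ^ n)"
        using pos real_div_sqrt[of "\<rho> ^ n"] by (simp add: divide_inverse)
      then have "real n * (\<rho> ^ n * inverse (sqrt (\<rho> ^ n))) / (\<rho> * 2) = real n * sqrt (\<rho> ^ n) / (\<rho> * 2)" by simp
      then show ?thesis by (simp add: mult_ac)
    qed
    ultimately show ?thesis by (simp only: e)
  qed
  have i: "((\<lambda>\<rho>. real n * \<Lambda> / \<rho>) has_real_derivative - (real n * \<Lambda>) / \<rho>\<^sup>2) (at \<rho>)"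
    using \<rho> by (auto intro!: derivative_eq_intros simp: power2_eq_square)
  have "((\<lambda>\<rho>. \<Phi> (real n * \<Lambda> / \<rho>)) has_real_derivative \<Phi>' * (- (real n * \<Lambda>) / \<rho>\<^sup>2)) (at \<rho>)"
    by (rule DERIV_chain2[OF \<Phi> i])
  from DERIV_divide[OF DERIV_mult[OF this s] DERIV_power[OF DERIV_ident, of 2]]
  show ?thesis
    unfolding ray_density_def[abs_def]
    by (rule DERIV_cong) (use \<rho> in \<open>simp_all add: field_simps power2_eq_square\<close>)
qed

context
  fixes A :: "('m::t2_space, 'n::finite) chart set" and \<Phi> :: "real \<Rightarrow> real" and g :: "('m, 'n) tensor"
    and \<Lambda> :: real and I :: "real set" and r d :: "real \<Rightarrow> real"
  assumes atlas: "smooth_atlas A" and comp: "compact (UNIV :: 'm set)" and \<Phi>: "smooth_on UNIV \<Phi>"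
    and ein: "einstein_metric A \<Lambda> g"
    and I: "open I" "is_interval I" and r: "smooth_on I r" "\<And>t. t \<in> I \<Longrightarrow> r t > 0"
    and ode: "\<And>t. t \<in> I \<Longrightarrow> (r has_real_derivative d t) (at t)"
begin

lemma ein_Met: "g \<in> Met A" using ein by (simp add: einstein_metric_def)

lemma ein_ricci: "c \<in> A \<Longrightarrow> p \<in> dom_c c \<Longrightarrow> ricci g c p = \<Lambda> *\<^sub>R g c p"
  using ein by (simp add: einstein_metric_def)

lemma ein_inv: "c \<in> A \<Longrightarrow> x \<in> img_c c \<Longrightarrow> invertible (loc g c x)"
  by (rule pos_sym_invertible[OF Met_pos[OF atlas ein_Met _ point_in_dom[OF atlas]]])

lemma inv_ray: "c \<in> A \<Longrightarrow> x \<in> img_c c \<Longrightarrow> \<rho> > 0 \<Longrightarrow>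
    matrix_inv (loc (ray g \<rho>) c x) = (1 / \<rho>) *\<^sub>R matrix_inv (loc g c x)"
  using matrix_inv_scaleR[OF ein_inv, of c x \<rho>] by (simp add: ray_def)

lemma scal_ray:
  assumes c: "c \<in> A" and x: "x \<in> img_c c" and \<rho>: "\<rho> > 0"
  shows "scal_in (ray g \<rho>) c x = real CARD('n) * \<Lambda> / \<rho>"
  using point_in_dom[OF atlas c x] \<rho>
  by (simp add: scal_in_def inv_ray[OF c x \<rho>] ricci_ray[OF atlas ein_Met \<rho> c] ein_ricci[OF c]
      bounded_bilinear.scaleR_left[OF bounded_bilinear_matrix_mult]
      bounded_bilinear.scaleR_right[OF bounded_bilinear_matrix_mult] matrix_inv_mult[OF ein_inv[OF c x]]
      linear_cmul[OF bounded_linear.linear[OF bounded_linear_trace]] trace_I)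

context
  fixes P :: "(real \<times> real) set" and W :: "real \<times> real \<Rightarrow> ('m, 'n) tensor" and \<epsilon> :: real
  assumes e: "0 < \<epsilon>" and PI: "P = {-\<epsilon><..<\<epsilon>} \<times> I" and fam: "smooth_family A P W"
    and W0: "\<And>t. t \<in> I \<Longrightarrow> W (0, t) = ray g (r t)"
begin

private lemma P: "open P" unfolding PI by (intro open_Times I) simp

private lemma zP: "t \<in> I \<Longrightarrow> (0, t) \<in> P" using e by (simp add: PI)

text \<open>The trace of the metric \<open>W z\<close> with respect to \<open>g\<close>; its first derivative in the variation
  parameter is the only quantity on which the first variation of the energy depends.\<close>

definition tr0 :: "('m, 'n) chart \<Rightarrow> real \<times> real \<Rightarrow> real^'n \<Rightarrow> real" where
  "tr0 c z x = trace (matrix_inv (loc g c x) ** loc (W z) c x)"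

definition dtr0 :: "('m, 'n) chart \<Rightarrow> real \<times> real \<Rightarrow> real^'n \<Rightarrow> real" where
  "dtr0 c z x = dd (\<lambda>z. tr0 c z x) z (1, 0)"

context
  fixes c assumes c: "c \<in> A"
begin

private lemma open_tr_dom: "open (P \<times> img_c c)" by (rule open_Times[OF P open_img[OF atlas c]])

lemma g_smooth_snd: "smooth_on (P \<times> img_c c) (\<lambda>y. loc g c (snd y))"
  by (rule smooth_on_compose[OF open_tr_dom smooth_on_bounded_linear[OF open_tr_dom bounded_linear_snd] Met_smooth[OF atlas ein_Met c]]) auto

lemma tr0_smooth: "smooth_on (P \<times> img_c c) (\<lambda>y. tr0 c (fst y) (snd y))"
proof -
  have "smooth_on (P \<times> img_c c) (\<lambda>y. matrix_inv (loc g c (snd y)))"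
    by (rule smooth_on_matrixI[OF open_tr_dom],
        rule smooth_on_matrix_inv[OF open_tr_dom smooth_on_vec_nth[OF open_tr_dom smooth_on_vec_nth[OF open_tr_dom g_smooth_snd]]])
      (use ein_inv[OF c] in \<open>auto simp: invertible_det_nz\<close>)
  then show ?thesis unfolding tr0_def
    by (intro smooth_on_trace[OF open_tr_dom] smooth_on_matrix_mult[OF open_tr_dom] fam_smooth[OF atlas P fam c])
qed

lemma dtr0_smooth: "smooth_on (P \<times> img_c c) (\<lambda>y. dtr0 c (fst y) (snd y))"
  using smooth_dd_fst[OF P open_img[OF atlas c] tr0_smooth] by (simp add: dtr0_def)

lemma dtr0_vol_smooth: "smooth_on (P \<times> img_c c) (\<lambda>y. dtr0 c (fst y) (snd y) * sqrt_det g c (snd y))"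
proof (rule smooth_on_mult[OF open_tr_dom dtr0_smooth])
  show "smooth_on (P \<times> img_c c) (\<lambda>y. sqrt_det g c (snd y))"
    unfolding sqrt_det_def
    by (rule smooth_on_sqrt[OF open_tr_dom smooth_on_det[OF open_tr_dom smooth_on_vec_nth[OF open_tr_dom smooth_on_vec_nth[OF open_tr_dom g_smooth_snd]]]])
      (use pos_sym_det[OF Met_pos[OF atlas ein_Met c point_in_dom[OF atlas c]]] in auto)
qed

context
  fixes x t assumes x: "x \<in> img_c c" and t: "t \<in> I"
begin

private abbreviation "B0 \<equiv> loc g c x"
private abbreviation "I0 \<equiv> matrix_inv (loc g c x)"
private abbreviation "M z \<equiv> loc (W z) c x"

private lemma Md: "z \<in> P \<Longrightarrow> ((\<lambda>z. M z) has_derivative dd (\<lambda>z. M z) z) (at z)"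
  by (rule W_differentiable[OF atlas comp \<Phi> P fam c x])

private lemma trL: "bounded_linear (\<lambda>X. trace (I0 ** X))"
  by (rule bounded_linear_compose[OF bounded_linear_trace bounded_bilinear.bounded_linear_right[OF bounded_bilinear_matrix_mult]])

private lemma dd_tr0: "z \<in> P \<Longrightarrow> dd (\<lambda>z. tr0 c z x) z v = trace (I0 ** dd (\<lambda>z. M z) z v)"
  unfolding tr0_def by (rule fun_cong[OF frechet_derivative_eqI[OF bounded_linear.has_derivative[OF trL Md]]])

private lemma inv0: "matrix_inv (M (0, t)) = (1 / r t) *\<^sub>R I0"
  unfolding W0[OF t] by (rule inv_ray[OF c x r(2)[OF t]])

private lemma dM0: "dd (\<lambda>z. M z) (0, t) (0, 1) = d t *\<^sub>R B0"
proof -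
  have diff: "(\<lambda>z. M z) differentiable (at (0, t))" using Md[OF zP[OF t]] by (auto simp: differentiable_def)
  have 1: "((\<lambda>t. M (0, t)) has_derivative (\<lambda>\<tau>. dd (\<lambda>z. M z) (0, t) (0, \<tau>))) (at t)" by (rule dd_snd[OF diff])
  have "((\<lambda>t. r t *\<^sub>R B0) has_derivative (\<lambda>\<tau>. (d t * \<tau>) *\<^sub>R B0)) (at t)"
    using ode[OF t] by (intro has_derivative_scaleR_left) (simp add: has_field_derivative_def)
  then have "((\<lambda>t. M (0, t)) has_derivative (\<lambda>\<tau>. (d t * \<tau>) *\<^sub>R B0)) (at t)"
    by (rule has_derivative_transform_within_open[OF _ I(1) t]) (simp add: W0 ray_def)
  from fun_cong[OF has_derivative_unique[OF 1 this], of 1] show ?thesis by simp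
qed

lemma tr_inv_ricci:
  "trace (matrix_inv (M (0, t)) ** dd (\<lambda>z. M z) (0, t) (1, 0) ** matrix_inv (M (0, t)) ** ricci (W (0, t)) c (point c x))
    = \<Lambda> / (r t)\<^sup>2 * dtr0 c (0, t) x"
proof -
  have p: "point c x \<in> dom_c c" by (rule point_in_dom[OF atlas c x])
  have R: "ricci (W (0, t)) c (point c x) = \<Lambda> *\<^sub>R B0"
    unfolding W0[OF t] ricci_ray[OF atlas ein_Met r(2)[OF t] c p] ein_ricci[OF c p] ..
  have "matrix_inv (M (0, t)) ** dd (\<lambda>z. M z) (0, t) (1, 0) ** matrix_inv (M (0, t)) ** ricci (W (0, t)) c (point c x)
     = (\<Lambda> / (r t)\<^sup>2) *\<^sub>R (I0 ** dd (\<lambda>z. M z) (0, t) (1, 0) ** (I0 ** B0))"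
    unfolding inv0 R
    by (simp add: bounded_bilinear.scaleR_left[OF bounded_bilinear_matrix_mult]
      bounded_bilinear.scaleR_right[OF bounded_bilinear_matrix_mult] matrix_mul_assoc power2_eq_square)
  then show ?thesis
    by (simp add: matrix_inv_mult[OF ein_inv[OF c x]] linear_cmul[OF bounded_linear.linear[OF bounded_linear_trace]]
        dtr0_def dd_tr0[OF zP[OF t]])
qed

text \<open>The velocity of the ray is a multiple of the metric, so the endomorphism \<open>matrix_inv M ** V\<close> whose square has trace
  \<open>speed2\<close> is a multiple of the identity there. Its variation then enters only by its trace.\<close>

lemma speed2_0: "speed2 W c (0, t) x = real CARD('n) * (d t / r t)\<^sup>2"
  and speed2_deriv: "((\<lambda>z. speed2 W c z x) has_derivative dd (\<lambda>z. speed2 W c z x) (0, t)) (at (0, t))"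
  and speed2_deriv_eq: "dd (\<lambda>z. speed2 W c z x) (0, t) (1, 0) =
     2 * (d t / r t) * (dd (\<lambda>z. dtr0 c z x) (0, t) (0, 1) / r t - d t / (r t)\<^sup>2 * dtr0 c (0, t) x)"
proof -
  let ?V = "\<lambda>z. dd (\<lambda>z. M z) z (0, 1)"
  let ?X = "\<lambda>z. matrix_inv (M z) ** ?V z"
  let ?h = "dd (\<lambda>z. M z) (0, t) (1, 0)"
  note z = zP[OF t]
  note scs = bounded_bilinear.scaleR_left[OF bounded_bilinear_matrix_mult]
      bounded_bilinear.scaleR_right[OF bounded_bilinear_matrix_mult]
  note trs = linear_cmul[OF bounded_linear.linear[OF bounded_linear_trace]]
  have X0: "?X (0, t) = (d t / r t) *\<^sub>R mat 1"
    unfolding inv0 dM0 by (simp add: scs matrix_inv_mult[OF ein_inv[OF c x]] mult.commute divide_inverse)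
  then show "speed2 W c (0, t) x = real CARD('n) * (d t / r t)\<^sup>2"
    unfolding speed2_def[OF atlas comp \<Phi> P fam] Let_def
    by (simp add: scs trs trace_I power2_eq_square)
  have sM: "smooth_on P (\<lambda>z. M z)"
    using smooth_slice_fst[OF P open_img[OF atlas c] fam_smooth[OF atlas P fam c] x] by simp
  have dV: "(?V has_derivative dd ?V (0, t)) (at (0, t))"
    by (rule smooth_on_has_derivative[OF smooth_on_deriv[OF sM] z])
  have dI: "((\<lambda>z. matrix_inv (M z)) has_derivative (\<lambda>v. - (matrix_inv (M (0, t)) ** dd (\<lambda>z. M z) (0, t) v ** matrix_inv (M (0, t))))) (at (0, t))"
    by (rule has_derivative_matrix_inv[OF P z sM]) (use pos_sym_det[OF lm_pos[OF fam_local_metric[OF atlas P fam _ c] x]] in force)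
  let ?X' = "\<lambda>v. matrix_inv (M (0, t)) ** dd ?V (0, t) v + - (matrix_inv (M (0, t)) ** dd (\<lambda>z. M z) (0, t) v ** matrix_inv (M (0, t))) ** ?V (0, t)"
  have dX: "(?X has_derivative ?X') (at (0, t))"
    by (rule bounded_bilinear.FDERIV[OF bounded_bilinear_matrix_mult dI dV])
  have D: "((\<lambda>z. speed2 W c z x) has_derivative (\<lambda>v. trace (?X (0, t) ** ?X' v + ?X' v ** ?X (0, t)))) (at (0, t))"
    unfolding speed2_def[OF atlas comp \<Phi> P fam] Let_def
    by (rule bounded_linear.has_derivative[OF bounded_linear_trace bounded_bilinear.FDERIV[OF bounded_bilinear_matrix_mult dX dX]])
  then show "((\<lambda>z. speed2 W c z x) has_derivative dd (\<lambda>z. speed2 W c z x) (0, t)) (at (0, t))"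
    by (rule has_derivative_dd)
  define Y where "Y = ?X' (1, 0)"
  have "dd (\<lambda>z. speed2 W c z x) (0, t) (1, 0) = trace (?X (0, t) ** Y + Y ** ?X (0, t))"
    unfolding Y_def by (rule fun_cong[OF frechet_derivative_eqI[OF D]])
  then have E1: "dd (\<lambda>z. speed2 W c z x) (0, t) (1, 0) = 2 * (d t / r t) * trace Y"
    unfolding X0 by (simp only: scs trs trace_add matrix_mul_lid matrix_mul_rid) simp
  have E2: "trace Y = trace (I0 ** dd ?V (0, t) (1, 0)) / r t - d t / (r t)\<^sup>2 * trace (I0 ** ?h)"
  proof -
    have "Y = (1 / r t) *\<^sub>R (I0 ** dd ?V (0, t) (1, 0)) - (d t / (r t)\<^sup>2) *\<^sub>R (I0 ** ?h ** (I0 ** B0))"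
      unfolding Y_def inv0 dM0
      by (simp add: scs bounded_bilinear.minus_left[OF bounded_bilinear_matrix_mult] matrix_mul_assoc power2_eq_square)
    then show ?thesis by (simp add: trs trace_sub matrix_inv_mult[OF ein_inv[OF c x]])
  qed
  have E3: "trace (I0 ** dd ?V (0, t) (1, 0)) = dd (\<lambda>z. dtr0 c z x) (0, t) (0, 1)"
  proof -
    have st: "smooth_on P (\<lambda>z. tr0 c z x)"
      using smooth_slice_fst[OF P open_img[OF atlas c] tr0_smooth x] by simp
    have "((\<lambda>z. dd (\<lambda>z. tr0 c z x) z (0, 1)) has_derivative (\<lambda>v. trace (I0 ** dd ?V (0, t) v))) (at (0, t))"
      by (rule has_derivative_transform_within_open[OF bounded_linear.has_derivative[OF trL dV] P z]) (simp add: dd_tr0)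
    from fun_cong[OF frechet_derivative_eqI[OF this], of "(1, 0)"]
    have "trace (I0 ** dd ?V (0, t) (1, 0)) = dd (\<lambda>z. dd (\<lambda>z. tr0 c z x) z (0, 1)) (0, t) (1, 0)" ..
    also have "\<dots> = dd (\<lambda>z. dd (\<lambda>z. tr0 c z x) z (1, 0)) (0, t) (0, 1)"
      by (rule frechet_derivative_commute[OF P st z])
    finally show ?thesis unfolding dtr0_def .
  qed
  have E4: "trace (I0 ** ?h) = dtr0 c (0, t) x" by (simp only: dtr0_def dd_tr0[OF z])
  show "dd (\<lambda>z. speed2 W c z x) (0, t) (1, 0) =
     2 * (d t / r t) * (dd (\<lambda>z. dtr0 c z x) (0, t) (0, 1) / r t - d t / (r t)\<^sup>2 * dtr0 c (0, t) x)"
    unfolding E1 E2 E3 E4 by simp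
qed

lemma sqrt_det_deriv: "((\<lambda>z. sqrt_det (W z) c x) has_derivative dd (\<lambda>z. sqrt_det (W z) c x) (0, t)) (at (0, t))"
  and sqrt_det_deriv_eq: "dd (\<lambda>z. sqrt_det (W z) c x) (0, t) (1, 0) =
    1/2 * (sqrt (r t ^ CARD('n)) * sqrt_det g c x) * (dtr0 c (0, t) x / r t)"
proof -
  note z = zP[OF t]
  have D: "((\<lambda>z. sqrt (det (M z))) has_derivative (\<lambda>v. 1/2 * sqrt (det (M (0, t))) * trace (matrix_inv (M (0, t)) ** dd (\<lambda>z. M z) (0, t) v))) (at (0, t))"
    by (rule has_derivative_sqrt_det[OF Md[OF z] pos_sym_det[OF lm_pos[OF fam_local_metric[OF atlas P fam z c] x]]])
  then show "((\<lambda>z. sqrt_det (W z) c x) has_derivative dd (\<lambda>z. sqrt_det (W z) c x) (0, t)) (at (0, t))"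
    unfolding sqrt_det_def by (rule has_derivative_dd)
  have "dd (\<lambda>z. sqrt_det (W z) c x) (0, t) (1, 0) = 1/2 * sqrt_det (W (0, t)) c x * trace (matrix_inv (M (0, t)) ** dd (\<lambda>z. M z) (0, t) (1, 0))"
    unfolding sqrt_det_def by (rule fun_cong[OF frechet_derivative_eqI[OF D]])
  also have "trace (matrix_inv (M (0, t)) ** dd (\<lambda>z. M z) (0, t) (1, 0)) = dtr0 c (0, t) x / r t"
    unfolding inv0 dtr0_def dd_tr0[OF z]
    by (simp add: bounded_bilinear.scaleR_left[OF bounded_bilinear_matrix_mult] linear_cmul[OF bounded_linear.linear[OF bounded_linear_trace]])
  finally show "dd (\<lambda>z. sqrt_det (W z) c x) (0, t) (1, 0) =
    1/2 * (sqrt (r t ^ CARD('n)) * sqrt_det g c x) * (dtr0 c (0, t) x / r t)"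
    unfolding W0[OF t] sqrt_det_ray .
qed

lemma lagr_deriv_eq:
  "dd (\<lambda>z. lagr \<Phi> W c z x * sqrt_det (W z) c x) (0, t) (1, 0) =
    (dd \<Phi> (real CARD('n) * \<Lambda> / r t) 1 * (real CARD('n) * (d t / r t)\<^sup>2)) * (sqrt_det (W (0, t)) c x * dd (\<lambda>z. scal_in (W z) c x) (0, t) (1, 0))
    + \<Phi> (real CARD('n) * \<Lambda> / r t) * sqrt (r t ^ CARD('n)) * (d t / (r t)\<^sup>2) * 2 * (dd (\<lambda>z. dtr0 c z x) (0, t) (0, 1) * sqrt_det g c x)
    + \<Phi> (real CARD('n) * \<Lambda> / r t) * sqrt (r t ^ CARD('n)) * ((d t)\<^sup>2 / (r t)^3) * (real CARD('n) / 2 - 2) * (dtr0 c (0, t) x * sqrt_det g c x)"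
proof -
  note z = zP[OF t]
  let ?k = "real CARD('n) * \<Lambda> / r t"
  have S0: "scal_in (W (0, t)) c x = ?k" unfolding W0[OF t] by (rule scal_ray[OF c x r(2)[OF t]])
  have dS: "((\<lambda>z. scal_in (W z) c x) has_derivative dd (\<lambda>z. scal_in (W z) c x) (0, t)) (at (0, t))"
    using smooth_on_has_derivative[OF smooth_slice_fst[OF P open_img[OF atlas c] fam_smooth_scal[OF atlas P fam c] x] z] by simp
  have dP: "(\<Phi> has_derivative dd \<Phi> (scal_in (W (0, t)) c x)) (at (scal_in (W (0, t)) c x))"
    by (rule smooth_on_has_derivative[OF \<Phi>]) simp
  have lin: "dd \<Phi> ?k y = dd \<Phi> ?k 1 * y" for y
    using linear_cmul[OF linear_frechet_derivative[OF smooth_on_differentiable[OF \<Phi>, of ?k]], of y 1] by simp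
  have "((\<lambda>z. lagr \<Phi> W c z x * sqrt_det (W z) c x) has_derivative
     (\<lambda>v. (\<Phi> (scal_in (W (0, t)) c x) * speed2 W c (0, t) x) * dd (\<lambda>z. sqrt_det (W z) c x) (0, t) v
       + (\<Phi> (scal_in (W (0, t)) c x) * dd (\<lambda>z. speed2 W c z x) (0, t) v
        + dd \<Phi> (scal_in (W (0, t)) c x) (dd (\<lambda>z. scal_in (W z) c x) (0, t) v) * speed2 W c (0, t) x) * sqrt_det (W (0, t)) c x)) (at (0, t))"
    unfolding lagr_def[OF atlas comp \<Phi> P fam]
    by (intro has_derivative_mult sqrt_det_deriv speed2_deriv has_derivative_compose[OF dS dP])
  from fun_cong[OF frechet_derivative_eqI[OF this], of "(1, 0)"]
  have D: "dd (\<lambda>z. lagr \<Phi> W c z x * sqrt_det (W z) c x) (0, t) (1, 0) =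
      (\<Phi> ?k * (real CARD('n) * (d t / r t)\<^sup>2)) * (1/2 * (sqrt (r t ^ CARD('n)) * sqrt_det g c x) * (dtr0 c (0, t) x / r t))
      + (\<Phi> ?k * (2 * (d t / r t) * (dd (\<lambda>z. dtr0 c z x) (0, t) (0, 1) / r t - d t / (r t)\<^sup>2 * dtr0 c (0, t) x))
        + (dd \<Phi> ?k 1 * dd (\<lambda>z. scal_in (W z) c x) (0, t) (1, 0)) * (real CARD('n) * (d t / r t)\<^sup>2)) * sqrt_det (W (0, t)) c x"
    unfolding S0 speed2_0 speed2_deriv_eq sqrt_det_deriv_eq lin[of "dd (\<lambda>z. scal_in (W z) c x) (0, t) (1, 0)"] .
  have Q: "sqrt_det (W (0, t)) c x = sqrt (r t ^ CARD('n)) * sqrt_det g c x"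
    unfolding W0[OF t] sqrt_det_ray ..
  have alg: "(f * (N * (v / \<rho>)\<^sup>2)) * (1/2 * (q * s) * (T / \<rho>)) + (f * (2 * (v / \<rho>) * (T' / \<rho> - v / \<rho>\<^sup>2 * T)) + (f' * S) * (N * (v / \<rho>)\<^sup>2)) * (q * s)
     = (f' * (N * (v / \<rho>)\<^sup>2)) * ((q * s) * S) + f * q * (v / \<rho>\<^sup>2) * 2 * (T' * s) + f * q * (v\<^sup>2 / \<rho> ^ 3) * (N / 2 - 2) * (T * s)"
    if "\<rho> > 0" for f f' N v \<rho> q s T T' S :: real
    using that by (simp add: field_simps power2_eq_square power3_eq_cube)
  show ?thesis unfolding D Q by (rule alg[OF r(2)[OF t]])
qed

end

end

lemma tr_integral_deriv:
  assumes part: "box_partition A Q cc l u \<eta>" and t: "t \<in> I"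
  shows "((\<lambda>t. \<Sum>q\<in>Q. integral (cbox (l q) (u q)) (\<lambda>x. \<eta> q (point (cc q) x) * (dtr0 (cc q) (0, t) x * sqrt_det g (cc q) x)))
    has_real_derivative (\<Sum>q\<in>Q. integral (cbox (l q) (u q)) (\<lambda>x. \<eta> q (point (cc q) x) *
       (dd (\<lambda>z. dtr0 (cc q) z x) (0, t) (0, 1) * sqrt_det g (cc q) x)))) (at t)"
proof (rule DERIV_sum)
  fix q assume q: "q \<in> Q"
  let ?c = "cc q" and ?w = "\<lambda>x. \<eta> q (point (cc q) x)"
  let ?f = "\<lambda>y. dtr0 ?c (fst y) (snd y) * sqrt_det g ?c (snd y)"
  note pf = part_chart[OF atlas part q] part_box[OF atlas part q]
  have cw: "continuous_on (cbox (l q) (u q)) ?w"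
    by (rule continuous_on_subset[OF Ck_on_continuous[OF part_Ck[OF atlas part q pf(1)]] pf(2)])
  have "((\<lambda>t. integral (cbox (l q) (u q)) (\<lambda>x. ?w x * ?f ((0, t), x))) has_real_derivative
      integral (cbox (l q) (u q)) (\<lambda>x. ?w x * dd (\<lambda>z. ?f (z, x)) (0, t) (0, 1))) (at t)"
    by (rule box_integral_deriv(4)[OF atlas comp \<Phi> P fam dtr0_vol_smooth[OF pf(1)] open_img[OF atlas pf(1)] pf(2) cw I(1) is_interval_convex[OF I(2)] _ t])
      (use zP in auto)
  moreover have "integral (cbox (l q) (u q)) (\<lambda>x. ?w x * dd (\<lambda>z. ?f (z, x)) (0, t) (0, 1))
     = integral (cbox (l q) (u q)) (\<lambda>x. ?w x * (dd (\<lambda>z. dtr0 ?c z x) (0, t) (0, 1) * sqrt_det g ?c x))"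
  proof (rule integral_cong)
    fix x assume "x \<in> cbox (l q) (u q)"
    then have x: "x \<in> img_c ?c" using pf(2) by blast
    have "((\<lambda>z. dtr0 ?c z x) has_derivative dd (\<lambda>z. dtr0 ?c z x) (0, t)) (at (0, t))"
      using smooth_on_has_derivative[OF smooth_slice_fst[OF P open_img[OF atlas pf(1)] dtr0_smooth[OF pf(1)] x] zP[OF t]] by simp
    from fun_cong[OF frechet_derivative_eqI[OF has_derivative_mult_left[OF this]], of "sqrt_det g ?c x" "(0, 1)"]
    show "?w x * dd (\<lambda>z. ?f (z, x)) (0, t) (0, 1) = ?w x * (dd (\<lambda>z. dtr0 ?c z x) (0, t) (0, 1) * sqrt_det g ?c x)"
      by simp
  qed
  ultimately show "((\<lambda>t. integral (cbox (l q) (u q)) (\<lambda>x. ?w x * (dtr0 ?c (0, t) x * sqrt_det g ?c x))) has_real_derivative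
      integral (cbox (l q) (u q)) (\<lambda>x. ?w x * (dd (\<lambda>z. dtr0 ?c z x) (0, t) (0, 1) * sqrt_det g ?c x))) (at t)"
    by simp
qed

text \<open>The coefficient of the variation of the scalar curvature in \<open>lagr_deriv_eq\<close> is constant on the manifold. Hence only
  the integral of this variation matters, which \<open>first_variation\<close> and the Einstein equation evaluate.\<close>

lemma lagr_variation:
  assumes part: "box_partition A Q cc l u \<eta>" and t: "t \<in> I"
  defines "\<tau> \<equiv> \<Sum>q\<in>Q. integral (cbox (l q) (u q)) (\<lambda>x. \<eta> q (point (cc q) x) * (dtr0 (cc q) (0, t) x * sqrt_det g (cc q) x))"
    and "\<tau>' \<equiv> \<Sum>q\<in>Q. integral (cbox (l q) (u q)) (\<lambda>x. \<eta> q (point (cc q) x) *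
       (dd (\<lambda>z. dtr0 (cc q) z x) (0, t) (0, 1) * sqrt_det g (cc q) x))"
    and "k \<equiv> real CARD('n) * \<Lambda> / r t" and "n \<equiv> real CARD('n)" and "w \<equiv> sqrt (r t ^ CARD('n))"
  shows "(\<Sum>q\<in>Q. integral (cbox (l q) (u q)) (\<lambda>x. \<eta> q (point (cc q) x) *
        dd (\<lambda>z. lagr \<Phi> W (cc q) z x * sqrt_det (W z) (cc q) x) (0, t) (1, 0)))
    = (dd \<Phi> k 1 * (n * (d t / r t)\<^sup>2)) * (- (\<Lambda> / (r t)\<^sup>2 * w * \<tau>))
      + \<Phi> k * w * (d t / (r t)\<^sup>2) * 2 * \<tau>' + \<Phi> k * w * ((d t)\<^sup>2 / (r t)^3) * (n / 2 - 2) * \<tau>"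
proof -
  let ?w = "\<lambda>q x. \<eta> q (point (cc q) x)"
  let ?B = "\<lambda>q. cbox (l q) (u q)"
  let ?S = "\<lambda>q x. sqrt_det (W (0, t)) (cc q) x * dd (\<lambda>z. scal_in (W z) (cc q) x) (0, t) (1, 0)"
  let ?T = "\<lambda>q x. dtr0 (cc q) (0, t) x * sqrt_det g (cc q) x"
  let ?T' = "\<lambda>q x. dd (\<lambda>z. dtr0 (cc q) z x) (0, t) (0, 1) * sqrt_det g (cc q) x"
  note z = zP[OF t]
  define \<sigma> where "\<sigma> = (\<Sum>q\<in>Q. integral (?B q) (\<lambda>x. ?w q x * ?S q x))"
  have int: "(\<lambda>x. ?w q x * ?S q x) integrable_on ?B q" "(\<lambda>x. ?w q x * ?T q x) integrable_on ?B q"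
    "(\<lambda>x. ?w q x * ?T' q x) integrable_on ?B q" if q: "q \<in> Q" for q
  proof -
    note pf = part_chart[OF atlas part q] part_box[OF atlas part q]
    note oi = open_img[OF atlas pf(1)]
    have cw: "continuous_on (?B q) (?w q)"
      by (rule continuous_on_subset[OF Ck_on_continuous[OF part_Ck[OF atlas part q pf(1)]] pf(2)])
    have cs: "continuous_on (?B q) (\<lambda>x. sqrt_det h (cc q) x)" if "h \<in> Met A" for h
      by (rule continuous_on_subset[OF sqrt_det_continuous[OF atlas that pf(1)] pf(2)])
    have c1: "continuous_on (?B q) (\<lambda>x. dd (\<lambda>z. scal_in (W z) (cc q) x) (0, t) (1, 0))"
      using smooth_on_continuous[OF smooth_slice_snd[OF P oi smooth_dd_fst[OF P oi fam_smooth_scal[OF atlas P fam pf(1)]] z]]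
      by (intro continuous_on_subset[OF _ pf(2)]) simp
    have c2: "continuous_on (?B q) (\<lambda>x. dtr0 (cc q) (0, t) x)"
      using smooth_on_continuous[OF smooth_slice_snd[OF P oi dtr0_smooth[OF pf(1)] z]]
      by (intro continuous_on_subset[OF _ pf(2)]) simp
    have c3: "continuous_on (?B q) (\<lambda>x. dd (\<lambda>z. dtr0 (cc q) z x) (0, t) (0, 1))"
      using smooth_on_continuous[OF smooth_slice_snd[OF P oi smooth_dd_fst[OF P oi dtr0_smooth[OF pf(1)]] z]]
      by (intro continuous_on_subset[OF _ pf(2)]) simp
    show "(\<lambda>x. ?w q x * ?S q x) integrable_on ?B q" "(\<lambda>x. ?w q x * ?T q x) integrable_on ?B q"
      "(\<lambda>x. ?w q x * ?T' q x) integrable_on ?B q"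
      by (intro integrable_continuous continuous_on_mult cw c1 c2 c3 cs ein_Met fam_Met[OF atlas P fam z])+
  qed
  have x: "x \<in> img_c (cc q)" if "q \<in> Q" "x \<in> ?B q" for q x
    using part_box[OF atlas part that(1)] that(2) by blast
  note pc = part_chart[OF atlas part]
  have \<sigma>: "\<sigma> = - (\<Lambda> / (r t)\<^sup>2 * w * \<tau>)"
  proof -
    have fv: "(\<Sum>q\<in>Q. integral (?B q) (\<lambda>x. ?w q x * ?S q x + (\<Lambda> / (r t)\<^sup>2 * w) * (?w q x * ?T q x))) = 0"
    proof (rule trans[OF _ first_variation[OF atlas P fam z comp part, of "(1, 0)"]], intro sum.cong refl integral_cong)
      fix q x assume q: "q \<in> Q" and xB: "x \<in> ?B q"
      have Q: "sqrt_det (W (0, t)) (cc q) x = w * sqrt_det g (cc q) x"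
        unfolding W0[OF t] sqrt_det_ray w_def ..
      show "?w q x * ?S q x + (\<Lambda> / (r t)\<^sup>2 * w) * (?w q x * ?T q x)
        = ?w q x * (sqrt_det (W (0, t)) (cc q) x * (dd (\<lambda>z. scal_in (W z) (cc q) x) (0, t) (1, 0)
         + trace (matrix_inv (loc (W (0, t)) (cc q) x) ** dd (\<lambda>z. loc (W z) (cc q) x) (0, t) (1, 0)
            ** matrix_inv (loc (W (0, t)) (cc q) x) ** ricci (W (0, t)) (cc q) (point (cc q) x))))"
        unfolding tr_inv_ricci[OF pc[OF q] x[OF q xB] t] Q by (simp add: algebra_simps)
    qed
    have "integral (?B q) (\<lambda>x. ?w q x * ?S q x + (\<Lambda> / (r t)\<^sup>2 * w) * (?w q x * ?T q x))
       = integral (?B q) (\<lambda>x. ?w q x * ?S q x) + (\<Lambda> / (r t)\<^sup>2 * w) * integral (?B q) (\<lambda>x. ?w q x * ?T q x)" if q: "q \<in> Q" for q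
      unfolding Henstock_Kurzweil_Integration.integral_add[OF int(1)[OF q] integrable_on_mult_right[OF int(2)[OF q]]]
      by (simp only: integral_mult_right)
    then have "(\<Sum>q\<in>Q. integral (?B q) (\<lambda>x. ?w q x * ?S q x + (\<Lambda> / (r t)\<^sup>2 * w) * (?w q x * ?T q x)))
      = (\<Sum>q\<in>Q. integral (?B q) (\<lambda>x. ?w q x * ?S q x) + (\<Lambda> / (r t)\<^sup>2 * w) * integral (?B q) (\<lambda>x. ?w q x * ?T q x))"
      by (intro sum.cong refl)
    also have "\<dots> = \<sigma> + \<Lambda> / (r t)\<^sup>2 * w * \<tau>"
      unfolding \<sigma>_def \<tau>_def sum.distrib by (simp only: sum_distrib_left)
    finally show ?thesis unfolding fv by linarith
  qed
  let ?a = "dd \<Phi> k 1 * (n * (d t / r t)\<^sup>2)" and ?b = "\<Phi> k * w * (d t / (r t)\<^sup>2) * 2"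
    and ?e = "\<Phi> k * w * ((d t)\<^sup>2 / (r t)^3) * (n / 2 - 2)"
  have "(\<Sum>q\<in>Q. integral (?B q) (\<lambda>x. ?w q x * dd (\<lambda>z. lagr \<Phi> W (cc q) z x * sqrt_det (W z) (cc q) x) (0, t) (1, 0)))
     = (\<Sum>q\<in>Q. integral (?B q) (\<lambda>x. ?a * (?w q x * ?S q x) + ?b * (?w q x * ?T' q x) + ?e * (?w q x * ?T q x)))"
  proof (intro sum.cong refl integral_cong)
    fix q x assume q: "q \<in> Q" and xB: "x \<in> ?B q"
    show "?w q x * dd (\<lambda>z. lagr \<Phi> W (cc q) z x * sqrt_det (W z) (cc q) x) (0, t) (1, 0)
       = ?a * (?w q x * ?S q x) + ?b * (?w q x * ?T' q x) + ?e * (?w q x * ?T q x)"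
      unfolding lagr_deriv_eq[OF pc[OF q] x[OF q xB] t] k_def n_def w_def distrib_left by (simp only: mult_ac)
  qed
  also have "\<dots> = (\<Sum>q\<in>Q. ?a * integral (?B q) (\<lambda>x. ?w q x * ?S q x) + ?b * integral (?B q) (\<lambda>x. ?w q x * ?T' q x)
      + ?e * integral (?B q) (\<lambda>x. ?w q x * ?T q x))"
  proof (intro sum.cong refl)
    fix q assume q: "q \<in> Q"
    have i: "(\<lambda>x. ?a * (?w q x * ?S q x)) integrable_on ?B q" "(\<lambda>x. ?b * (?w q x * ?T' q x)) integrable_on ?B q"
      "(\<lambda>x. ?e * (?w q x * ?T q x)) integrable_on ?B q"
      by (rule integrable_on_mult_right[OF int(1)[OF q]], rule integrable_on_mult_right[OF int(3)[OF q]],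
          rule integrable_on_mult_right[OF int(2)[OF q]])
    show "integral (?B q) (\<lambda>x. ?a * (?w q x * ?S q x) + ?b * (?w q x * ?T' q x) + ?e * (?w q x * ?T q x))
      = ?a * integral (?B q) (\<lambda>x. ?w q x * ?S q x) + ?b * integral (?B q) (\<lambda>x. ?w q x * ?T' q x)
      + ?e * integral (?B q) (\<lambda>x. ?w q x * ?T q x)"
      unfolding Henstock_Kurzweil_Integration.integral_add[OF integrable_add[OF i(1,2)] i(3)]
        Henstock_Kurzweil_Integration.integral_add[OF i(1,2)] by (simp only: integral_mult_right)
  qed
  also have "\<dots> = ?a * \<sigma> + ?b * \<tau>' + ?e * \<tau>"
    unfolding \<sigma>_def \<tau>_def \<tau>'_def sum.distrib by (simp only: sum_distrib_left)
  finally show ?thesis unfolding \<sigma> .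
qed

text \<open>The unit speed condition turns the integrand, as given by \<open>lagr_variation\<close>, into an exact derivative.\<close>

lemma energy_variation_zero:
  assumes part: "box_partition A Q cc l u \<eta>" and ab: "a < b" "{a..b} \<subseteq> I"
    and ends: "\<And>s. s \<in> {-\<epsilon><..<\<epsilon>} \<Longrightarrow> W (s, a) = ray g (r a) \<and> W (s, b) = ray g (r b)"
    and \<Phi>pos: "\<And>u. \<Phi> u > 0"
    and d: "\<And>t. t \<in> I \<Longrightarrow> d t = inverse (sqrt (ray_density \<Phi> \<Lambda> CARD('n) (r t)))"
  shows "integral {a..b} (\<lambda>t. \<Sum>q\<in>Q. integral (cbox (l q) (u q)) (\<lambda>x. \<eta> q (point (cc q) x) *
        dd (\<lambda>z. lagr \<Phi> W (cc q) z x * sqrt_det (W z) (cc q) x) (0, t) (1, 0))) = 0"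
proof -
  let ?\<psi> = "ray_density \<Phi> \<Lambda> CARD('n)"
  define \<tau> where "\<tau> t = (\<Sum>q\<in>Q. integral (cbox (l q) (u q)) (\<lambda>x. \<eta> q (point (cc q) x) * (dtr0 (cc q) (0, t) x * sqrt_det g (cc q) x)))" for t
  define \<tau>' where "\<tau>' t = (\<Sum>q\<in>Q. integral (cbox (l q) (u q)) (\<lambda>x. \<eta> q (point (cc q) x) *
       (dd (\<lambda>z. dtr0 (cc q) z x) (0, t) (0, 1) * sqrt_det g (cc q) x)))" for t
  \<comment> \<open>the derivative of the squared speed \<open>\<psi>(r) r'\<^sup>2\<close> with respect to \<open>r'\<close>, at \<open>r' = 1 / \<surd>\<psi>(r)\<close>, times \<open>\<tau>\<close>\<close>
  define E where "E t = 2 * sqrt (?\<psi> (r t)) * \<tau> t" for t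
  have dE: "(E has_real_derivative (\<Sum>q\<in>Q. integral (cbox (l q) (u q)) (\<lambda>x. \<eta> q (point (cc q) x) *
        dd (\<lambda>z. lagr \<Phi> W (cc q) z x * sqrt_det (W z) (cc q) x) (0, t) (1, 0)))) (at t)" if t: "t \<in> I" for t
  proof -
    let ?k = "real CARD('n) * \<Lambda> / r t" and ?n = "real CARD('n)" and ?w = "sqrt (r t ^ CARD('n))"
    have pos: "?\<psi> (r t) > 0" by (rule ray_density_pos[OF \<Phi>pos r(2)[OF t]])
    have "(\<Phi> has_real_derivative dd \<Phi> ?k 1) (at ?k)"
    proof -
      have D: "\<Phi> differentiable (at ?k)" by (rule smooth_on_differentiable[OF \<Phi>]) simp
      have "dd \<Phi> ?k = (*) (dd \<Phi> ?k 1)"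
      proof
        fix y show "dd \<Phi> ?k y = dd \<Phi> ?k 1 * y"
          using linear_cmul[OF linear_frechet_derivative[OF D], of y 1] by simp
      qed
      then show ?thesis using has_derivative_frechet[OF D] by (simp add: has_field_derivative_def)
    qed
    from ray_density_deriv[OF this r(2)[OF t]]
    have "(?\<psi> has_real_derivative ?w / (r t)\<^sup>2 * (- (dd \<Phi> ?k 1 * (?n * \<Lambda>) / (r t)\<^sup>2) + \<Phi> ?k * (?n / 2 - 2) / r t)) (at (r t))"
      (is "(_ has_real_derivative ?p) _") .
    from DERIV_chain2[OF DERIV_real_sqrt[OF pos] DERIV_chain2[OF this ode[OF t]]]
    have s: "((\<lambda>t. sqrt (?\<psi> (r t))) has_real_derivative (inverse (sqrt (?\<psi> (r t))) / 2) * (?p * d t)) (at t)" .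
    have t': "(\<tau> has_real_derivative \<tau>' t) (at t)"
      unfolding \<tau>_def[abs_def] \<tau>'_def by (rule tr_integral_deriv[OF part t])
    have "(E has_real_derivative (2 * ((inverse (sqrt (?\<psi> (r t))) / 2) * (?p * d t))) * \<tau> t + \<tau>' t * (2 * sqrt (?\<psi> (r t)))) (at t)"
      unfolding E_def[abs_def] by (rule DERIV_mult[OF DERIV_cmult[OF s] t'])
    moreover have "(2 * ((inverse (sqrt (?\<psi> (r t))) / 2) * (?p * d t))) * \<tau> t + \<tau>' t * (2 * sqrt (?\<psi> (r t)))
      = (\<Sum>q\<in>Q. integral (cbox (l q) (u q)) (\<lambda>x. \<eta> q (point (cc q) x) *
        dd (\<lambda>z. lagr \<Phi> W (cc q) z x * sqrt_det (W z) (cc q) x) (0, t) (1, 0)))"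
    proof -
      have sq: "sqrt (?\<psi> (r t)) = \<Phi> ?k * ?w / (r t)\<^sup>2 * d t"
      proof -
        have "sqrt (?\<psi> (r t)) = ?\<psi> (r t) * d t"
          unfolding d[OF t] using real_div_sqrt[of "?\<psi> (r t)"] pos by (simp add: divide_inverse)
        then show ?thesis by (simp add: ray_density_def)
      qed
      have "2 * ((D / 2) * ((w / \<rho>\<^sup>2 * (- (f' * (n * \<Lambda>) / \<rho>\<^sup>2) + f * (n / 2 - 2) / \<rho>)) * D)) * T + T' * (2 * (f * w / \<rho>\<^sup>2 * D))
        = (f' * (n * (D / \<rho>)\<^sup>2)) * (- (\<Lambda> / \<rho>\<^sup>2 * w * T)) + f * w * (D / \<rho>\<^sup>2) * 2 * T' + f * w * (D\<^sup>2 / \<rho>^3) * (n / 2 - 2) * T"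
        if "\<rho> > 0" for D w \<rho> f f' n T T' :: real
        using that by (simp add: field_simps power2_eq_square power3_eq_cube)
      from this[OF r(2)[OF t]] show ?thesis
        unfolding lagr_variation[OF part t] \<tau>_def[symmetric] \<tau>'_def[symmetric] d[OF t, symmetric] unfolding sq .
    qed
    ultimately show ?thesis by (simp only:)
  qed
  have z: "\<tau> t = 0" if t: "t \<in> I" and fixd: "\<And>s. s \<in> {-\<epsilon><..<\<epsilon>} \<Longrightarrow> W (s, t) = ray g (r t)" for t
  proof -
    have "integral (cbox (l q) (u q)) (\<lambda>x. \<eta> q (point (cc q) x) * (dtr0 (cc q) (0, t) x * sqrt_det g (cc q) x)) = integral (cbox (l q) (u q)) (\<lambda>x. 0)" if q: "q \<in> Q" for q
    proof (rule integral_cong)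
      fix x assume "x \<in> cbox (l q) (u q)"
      then have x: "x \<in> img_c (cc q)" using part_box[OF atlas part q] by blast
      have "(\<lambda>z. tr0 (cc q) z x) differentiable (at (0, t))"
        using smooth_on_differentiable[OF smooth_slice_fst[OF P open_img[OF atlas part_chart[OF atlas part q]] tr0_smooth[OF part_chart[OF atlas part q]] x] zP[OF t]]
        by simp
      then have 1: "((\<lambda>s. tr0 (cc q) (s, t) x) has_derivative (\<lambda>v. dd (\<lambda>z. tr0 (cc q) z x) (0, t) (v, 0))) (at 0)"
        by (rule dd_fst)
      have "((\<lambda>s. tr0 (cc q) (s, t) x) has_derivative (\<lambda>v. 0)) (at 0)"
        by (rule has_derivative_transform_within_open[OF has_derivative_const, of "{-\<epsilon><..<\<epsilon>}" 0 "tr0 (cc q) (0, t) x"])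
          (use e fixd in \<open>auto simp: tr0_def\<close>)
      from fun_cong[OF has_derivative_unique[OF 1 this], of 1]
      show "\<eta> q (point (cc q) x) * (dtr0 (cc q) (0, t) x * sqrt_det g (cc q) x) = 0" by (simp add: dtr0_def)
    qed
    then show ?thesis by (simp add: \<tau>_def)
  qed
  have I': "a \<in> I" "b \<in> I" using ab by auto
  have "((\<lambda>t. \<Sum>q\<in>Q. integral (cbox (l q) (u q)) (\<lambda>x. \<eta> q (point (cc q) x) *
        dd (\<lambda>z. lagr \<Phi> W (cc q) z x * sqrt_det (W z) (cc q) x) (0, t) (1, 0))) has_integral E b - E a) {a..b}"
  proof (rule fundamental_theorem_of_calculus)
    show "a \<le> b" using ab by simp
    fix t assume "t \<in> {a..b}"
    then have "t \<in> I" using ab by blast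
    from dE[OF this] show "(E has_vector_derivative (\<Sum>q\<in>Q. integral (cbox (l q) (u q)) (\<lambda>x. \<eta> q (point (cc q) x) *
        dd (\<lambda>z. lagr \<Phi> W (cc q) z x * sqrt_det (W z) (cc q) x) (0, t) (1, 0)))) (at t within {a..b})"
      unfolding has_real_derivative_iff_has_vector_derivative[symmetric] by (rule has_field_derivative_at_within)
  qed
  moreover have "E a = 0" "E b = 0" using z[OF I'(1)] z[OF I'(2)] ends by (auto simp: E_def)
  ultimately show ?thesis by (simp add: integral_unique)
qed

end

lemma ray_geodesic:
  assumes \<Phi>pos: "\<And>u. \<Phi> u > 0"
    and d: "\<And>t. t \<in> I \<Longrightarrow> d t = inverse (sqrt (ray_density \<Phi> \<Lambda> CARD('n) (r t)))"
  shows "geodesic A (G_scal A \<Phi>) I (\<lambda>t. ray g (r t))"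
  unfolding geodesic_def
proof (intro conjI allI impI)
  show "smooth_family A I (\<lambda>t. ray g (r t))"
    by (rule ray_smooth_family[OF atlas ein_Met I(1) r])
  fix a b \<epsilon> V
  assume "a < b \<and> {a..b} \<subseteq> I \<and> 0 < \<epsilon> \<and> fixed_end_variation A I a b \<epsilon> (\<lambda>t. ray g (r t)) V"
  then have ab: "a < b" "{a..b} \<subseteq> I" and e: "0 < \<epsilon>" and V: "fixed_end_variation A I a b \<epsilon> (\<lambda>t. ray g (r t)) V"
    by auto
  define W where "W z = V (fst z) (snd z)" for z
  let ?P = "{-\<epsilon><..<\<epsilon>} \<times> I"
  have P: "open ?P" by (intro open_Times I) simp
  have fam: "smooth_family A ?P W"
    using V unfolding fixed_end_variation_def W_def[abs_def] case_prod_unfold by blast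
  have W0: "W (0, t) = ray g (r t)" if "t \<in> I" for t
    using V that unfolding fixed_end_variation_def W_def by simp
  have ends: "W (s, a) = ray g (r a) \<and> W (s, b) = ray g (r b)" if "s \<in> {-\<epsilon><..<\<epsilon>}" for s
    using V that unfolding fixed_end_variation_def W_def by simp
  obtain Q cc l u \<eta> where part: "box_partition A Q cc l u \<eta>"
    using box_partition_exists[OF atlas comp] by metis
  have Z: "integral {a..b} (\<lambda>t. \<Sum>q\<in>Q. integral (cbox (l q) (u q)) (\<lambda>x. \<eta> q (point (cc q) x) *
      dd (\<lambda>z. lagr \<Phi> W (cc q) z x * sqrt_det (W z) (cc q) x) (0, t) (1, 0))) = 0"
    by (rule energy_variation_zero[OF e refl fam W0 part ab ends \<Phi>pos d])
  have "((\<lambda>s. energy (G_scal A \<Phi>) a b (\<lambda>t. W (s, t))) has_real_derivative (1/2) * 0) (at 0)"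
    using energy_deriv[OF atlas comp \<Phi> P fam part e ab(2) refl] unfolding Z .
  then show "((\<lambda>s. energy (G_scal A \<Phi>) a b (V s)) has_real_derivative 0) (at 0)"
    by (simp add: W_def)
qed

end

section \<open>The ray has finite length at the origin\<close>

text \<open>The parametrisation is the inverse of the arc length function \<open>l\<close>. The bound by an integrable power keeps
  \<open>l\<close> bounded below, so \<open>r\<close> tends to \<open>0\<close> along parameters that converge to a finite limit.\<close>

lemma unit_speed_parametrisation:
  fixes \<psi> :: "real \<Rightarrow> real"
  assumes \<psi>: "smooth_on {0<..} \<psi>" and pos: "\<And>\<rho>. \<rho> > 0 \<Longrightarrow> \<psi> \<rho> > 0"
    and \<alpha>: "\<alpha> > 0" and bound: "\<And>\<rho>. 0 < \<rho> \<Longrightarrow> \<rho> \<le> 1 \<Longrightarrow> sqrt (\<psi> \<rho>) \<le> K * \<rho> powr (\<alpha> - 1)"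
  obtains I r L s where "open I" "is_interval I" "smooth_on I r" "\<And>t. t \<in> I \<Longrightarrow> r t > 0"
    "\<And>t. t \<in> I \<Longrightarrow> (r has_real_derivative inverse (sqrt (\<psi> (r t)))) (at t)"
    "\<And>k::nat. s k \<in> I" "s \<longlonglongrightarrow> L" "(\<lambda>k. r (s k)) \<longlonglongrightarrow> 0"
proof -
  let ?J = "{0<..<1::real}"
  let ?f = "\<lambda>\<rho>. sqrt (\<psi> \<rho>)"
  have cf: "continuous_on {0<..} ?f" by (intro continuous_intros smooth_on_continuous[OF \<psi>])
  define l where "l \<rho> = - integral {\<rho>..1} ?f" for \<rho>
  have dl: "(l has_real_derivative ?f \<rho>) (at \<rho>)" if \<rho>: "\<rho> \<in> ?J" for \<rho>
  proof -
    let ?\<delta> = "\<rho> / 2"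
    have int: "?f integrable_on {?\<delta>..1}"
      by (rule integrable_continuous_real) (rule continuous_on_subset[OF cf], use \<rho> in auto)
    have "((\<lambda>y. integral {?\<delta>..y} ?f) has_real_derivative ?f \<rho>) (at \<rho> within {?\<delta>..1})"
      by (rule integral_has_real_derivative) (use \<rho> in \<open>auto intro: continuous_on_subset[OF cf]\<close>)
    moreover have "at \<rho> within {?\<delta>..1} = at \<rho>"
      by (rule at_within_interior) (use \<rho> in \<open>simp add: interior_atLeastAtMost_real\<close>)
    ultimately have "((\<lambda>y. integral {?\<delta>..y} ?f - integral {?\<delta>..1} ?f) has_real_derivative ?f \<rho> - 0) (at \<rho>)"
      by (intro DERIV_diff DERIV_const) simp
    then have "((\<lambda>y. integral {?\<delta>..y} ?f - integral {?\<delta>..1} ?f) has_real_derivative ?f \<rho>) (at \<rho>)" by simp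
    then show ?thesis
    proof (rule has_field_derivative_transform_within_open[where S = "{?\<delta><..<1}"])
      fix y assume y: "y \<in> {?\<delta><..<1}"
      have "integral {?\<delta>..y} ?f + integral {y..1} ?f = integral {?\<delta>..1} ?f"
        by (rule Henstock_Kurzweil_Integration.integral_combine[OF _ _ int]) (use y in auto)
      then show "integral {?\<delta>..y} ?f - integral {?\<delta>..1} ?f = l y" by (simp add: l_def)
    qed (use \<rho> in auto)
  qed
  have fpos: "?f \<rho> > 0" if "\<rho> > 0" for \<rho> using pos[OF that] by simp
  have cl: "continuous_on ?J l"
    by (auto simp: continuous_on_eq_continuous_within intro!: continuous_at_imp_continuous_within DERIV_isCont dl)
  have mono: "l x < l y" if "x \<in> ?J" "y \<in> ?J" "x < y" for x y
  proof (rule DERIV_pos_imp_increasing[OF that(3)])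
    fix z assume "x \<le> z" "z \<le> y"
    then have z: "z \<in> ?J" using that by auto
    show "\<exists>d. (l has_real_derivative d) (at z) \<and> d > 0"
      by (intro exI[of _ "?f z"] conjI dl[OF z] fpos) (use z in simp)
  qed
  have inj: "inj_on l ?J" by (rule inj_onI) (metis mono less_irrefl linorder_neqE_linordered_idom)
  define I where "I = l ` ?J"
  obtain r where hom: "homeomorphism ?J I l r"
    using invariance_of_domain_homeomorphism[OF _ cl _ inj] unfolding I_def by auto
  have oI: "open I" unfolding I_def by (rule invariance_of_domain[OF cl _ inj]) simp
  have iI: "is_interval I"
    unfolding I_def by (simp add: is_interval_connected_1 connected_continuous_image[OF cl])
  have rJ: "r t \<in> ?J" if "t \<in> I" for t using homeomorphism_image2[OF hom] that by blast
  have lr: "l (r t) = t" if "t \<in> I" for t using homeomorphism_apply2[OF hom that] .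
  have rl: "r (l \<rho>) = \<rho>" if "\<rho> \<in> ?J" for \<rho> using homeomorphism_apply1[OF hom that] .
  have cr: "continuous_on I r" by (rule homeomorphism_cont2[OF hom])
  have dr: "(r has_real_derivative inverse (?f (r t))) (at t)" if t: "t \<in> I" for t
  proof -
    obtain a b where ab: "a < t" "t < b" "{a..b} \<subseteq> I"
    proof -
      obtain e where "e > 0" "cball t e \<subseteq> I" using oI t open_contains_cball by blast
      then show ?thesis using that[of "t - e" "t + e"] by (auto simp: cball_eq_atLeastAtMost)
    qed
    have "isCont r t" using cr oI t continuous_on_eq_continuous_at by blast
    moreover have "?f (r t) \<noteq> 0" using fpos[of "r t"] rJ[OF t] by force
    ultimately show ?thesis
      using DERIV_inverse_function[where g = r, OF dl[OF rJ[OF t]] _ ab(1,2)] lr ab(3) by (auto simp: subset_iff)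
  qed
  have sr: "smooth_on I r"
  proof -
    have "Ck_on k I r" for k
    proof (induction k)
      case 0
      then show ?case using cr by simp
    next
      case (Suc k)
      have "smooth_on {0<..} (\<lambda>\<rho>. inverse (?f \<rho>))"
        by (intro smooth_on_inverse smooth_on_sqrt \<psi> pos) (use fpos in \<open>auto simp: less_imp_neq[symmetric]\<close>)
      then have "Ck_on k I (\<lambda>t. inverse (?f (r t)))"
        by (intro Ck_on_compose[OF oI Suc smooth_on_imp_Ck]) (use rJ in auto)
      then show ?case by (intro Ck_on_real_SucI[OF oI dr]) auto
    qed
    then show ?thesis by (simp add: smooth_on_def)
  qed
  \<comment> \<open>\<open>K / \<alpha> * \<rho> powr \<alpha>\<close> is an antiderivative of the bound and grows at least as fast as \<open>l\<close>\<close>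
  define m where "m = l (1/2) - K / \<alpha> * (1/2) powr \<alpha>"
  have K0: "K > 0" using less_le_trans[OF fpos[of 1] bound[of 1]] by simp
  have low: "m \<le> l \<rho>" if \<rho>: "0 < \<rho>" "\<rho> \<le> 1/2" for \<rho>
  proof -
    have "l (1/2) - K / \<alpha> * (1/2) powr \<alpha> \<le> l \<rho> - K / \<alpha> * \<rho> powr \<alpha>"
    proof (rule DERIV_nonpos_imp_nonincreasing[OF \<rho>(2)])
      fix x assume x: "\<rho> \<le> x" "x \<le> 1/2"
      have "((\<lambda>x. l x - K / \<alpha> * x powr \<alpha>) has_real_derivative ?f x - K / \<alpha> * (\<alpha> * x powr (\<alpha> - 1))) (at x)"
        by (intro DERIV_diff DERIV_cmult dl has_real_derivative_powr) (use x \<rho> in auto)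
      moreover have "?f x - K / \<alpha> * (\<alpha> * x powr (\<alpha> - 1)) \<le> 0"
        using bound[of x] x \<rho> \<alpha> by simp
      ultimately show "\<exists>y. ((\<lambda>x. l x - K / \<alpha> * x powr \<alpha>) has_real_derivative y) (at x) \<and> y \<le> 0" by blast
    qed
    moreover have "0 \<le> K / \<alpha> * \<rho> powr \<alpha>" using K0 \<alpha> by simp
    ultimately show ?thesis by (simp add: m_def)
  qed
  define \<rho> where "\<rho> k = 1 / real (Suc (Suc k))" for k
  have \<rho>: "0 < \<rho> k" "\<rho> k \<le> 1/2" "\<rho> k \<in> ?J" "\<rho> (Suc k) < \<rho> k" for k
    by (auto simp: \<rho>_def field_simps)
  define s where "s k = l (\<rho> k)" for k
  have "decseq s" unfolding decseq_Suc_iff s_def using mono[OF \<rho>(3) \<rho>(3) \<rho>(4)] by (auto intro: less_imp_le)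
  moreover have "m \<le> s k" for k unfolding s_def by (rule low[OF \<rho>(1,2)])
  ultimately obtain L where L: "s \<longlonglongrightarrow> L" using decseq_convergent[of s m] by blast
  have "(\<lambda>k. r (s k)) = \<rho>" using rl[OF \<rho>(3)] by (simp add: s_def)
  moreover have "\<rho> \<longlonglongrightarrow> 0"
    unfolding \<rho>_def[abs_def] using LIMSEQ_inverse_real_of_nat[THEN LIMSEQ_Suc] by (simp add: inverse_eq_divide)
  ultimately have "(\<lambda>k. r (s k)) \<longlonglongrightarrow> 0" by simp
  moreover have "s k \<in> I" for k unfolding s_def I_def using \<rho>(3) by blast
  ultimately show thesis
    using that[OF oI iI sr _ dr _ L] rJ by fastforce
qed

text \<open>If \<open>k \<ge> 0\<close> then \<open>\<surd>\<Phi>(n \<Lambda> / \<rho>)\<close> is at most a constant times \<open>\<rho> powr (- k)\<close>, and the volume and the velocity contribute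
  \<open>\<rho> powr (n/4 - 1)\<close>.\<close>

lemma ray_density_bound:
  fixes \<Phi> :: "real \<Rightarrow> real"
  assumes pos: "\<And>u. \<Phi> u > 0" and growth: "\<And>u. u \<noteq> 0 \<Longrightarrow> \<Phi> u \<le> C * (1 + \<bar>u\<bar> powr (2 * k))"
    and k: "k < real n / 8" and n: "n > 0"
  obtains \<alpha> K where "\<alpha> > 0" "\<And>\<rho>. 0 < \<rho> \<Longrightarrow> \<rho> \<le> 1 \<Longrightarrow> sqrt (ray_density \<Phi> \<Lambda> n \<rho>) \<le> K * \<rho> powr (\<alpha> - 1)"
proof -
  \<comment> \<open>for \<open>\<rho> \<le> 1\<close> the exponent may be enlarged, and a nonnegative one also dominates the constant in the growth condition\<close>
  define k' where "k' = max k 0"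
  have k': "0 \<le> k'" "k \<le> k'" "k' < real n / 4" using k n by (auto simp: k'_def)
  define b where "b = real n * \<Lambda>"
  have C0: "C > 0"
  proof (rule ccontr)
    assume "\<not> C > 0"
    then have "C * (1 + \<bar>1::real\<bar> powr (2 * k)) \<le> 0" by simp
    with growth[of 1] pos[of 1] show False by simp
  qed
  \<comment> \<open>the value at \<open>0\<close>, which the growth condition does not control, is attained when \<open>\<Lambda> = 0\<close>\<close>
  define D where "D = max (\<Phi> 0) (C * (1 + \<bar>b\<bar> powr (2 * k)))"
  have D0: "D \<ge> 0" using pos[of 0] by (simp add: D_def)
  have bnd: "\<Phi> (b / \<rho>) \<le> D * \<rho> powr (- 2 * k')" if \<rho>: "0 < \<rho>" "\<rho> \<le> 1" for \<rho>
  proof -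
    have p1: "1 \<le> \<rho> powr (- 2 * k')"
      using powr_mono'[of "- 2 * k'" 0 \<rho>] \<rho> k' by simp
    show ?thesis
    proof (cases "b = 0")
      case True
      have "\<Phi> 0 \<le> D * 1" by (simp add: D_def)
      also have "\<dots> \<le> D * \<rho> powr (- 2 * k')" by (rule mult_left_mono[OF p1 D0])
      finally show ?thesis using True by simp
    next
      case False
      have p2: "\<rho> powr (- 2 * k) \<le> \<rho> powr (- 2 * k')"
        by (rule powr_mono') (use k' \<rho> in auto)
      have "\<bar>b / \<rho>\<bar> powr (2 * k) = \<bar>b\<bar> powr (2 * k) * \<rho> powr (- 2 * k)"
        using \<rho> powr_divide[of "\<bar>b\<bar>" \<rho> "2 * k"] by (simp add: abs_divide powr_minus_divide)
      then have "\<Phi> (b / \<rho>) \<le> C * (1 + \<bar>b\<bar> powr (2 * k) * \<rho> powr (- 2 * k))"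
        using growth[of "b / \<rho>"] False \<rho> by simp
      also have "\<dots> \<le> C * (\<rho> powr (- 2 * k') + \<bar>b\<bar> powr (2 * k) * \<rho> powr (- 2 * k'))"
        using p1 p2 C0 by (intro mult_left_mono add_mono) auto
      also have "\<dots> = C * (1 + \<bar>b\<bar> powr (2 * k)) * \<rho> powr (- 2 * k')" by (simp add: algebra_simps)
      also have "\<dots> \<le> D * \<rho> powr (- 2 * k')"
        by (intro mult_right_mono) (auto simp: D_def)
      finally show ?thesis .
    qed
  qed
  define \<alpha> where "\<alpha> = real n / 4 - k'"
  have "sqrt (ray_density \<Phi> \<Lambda> n \<rho>) \<le> sqrt D * \<rho> powr (\<alpha> - 1)" if \<rho>: "0 < \<rho>" "\<rho> \<le> 1" for \<rho>
  proof -
    have "sqrt (\<rho> ^ n) / \<rho>\<^sup>2 = \<rho> powr (real n / 2 - 2)"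
    proof -
      have "sqrt (\<rho> ^ n) = \<rho> powr (real n / 2)"
        using \<rho> by (simp add: powr_half_sqrt[symmetric] powr_powr flip: powr_realpow)
      moreover have "\<rho>\<^sup>2 = \<rho> powr 2" using \<rho> by (simp flip: powr_numeral)
      ultimately show ?thesis by (simp add: powr_diff)
    qed
    then have "ray_density \<Phi> \<Lambda> n \<rho> = \<Phi> (b / \<rho>) * \<rho> powr (real n / 2 - 2)"
      by (simp add: ray_density_def b_def flip: times_divide_eq_right)
    also have "\<dots> \<le> D * \<rho> powr (- 2 * k') * \<rho> powr (real n / 2 - 2)"
      by (intro mult_right_mono bnd \<rho>) simp
    also have "\<dots> = D * (\<rho> powr (\<alpha> - 1))\<^sup>2"
    proof -
      have "(\<rho> powr (\<alpha> - 1))\<^sup>2 = \<rho> powr ((\<alpha> - 1) + (\<alpha> - 1))" by (simp only: power2_eq_square powr_add)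
      moreover have "\<rho> powr (- 2 * k') * \<rho> powr (real n / 2 - 2) = \<rho> powr (- 2 * k' + (real n / 2 - 2))"
        by (simp only: powr_add)
      moreover have "- 2 * k' + (real n / 2 - 2) = (\<alpha> - 1) + (\<alpha> - 1)" by (simp add: \<alpha>_def)
      ultimately show ?thesis by (simp only: mult.assoc)
    qed
    finally have "sqrt (ray_density \<Phi> \<Lambda> n \<rho>) \<le> sqrt (D * (\<rho> powr (\<alpha> - 1))\<^sup>2)" by simp
    then show ?thesis by (simp add: real_sqrt_mult)
  qed
  moreover have "\<alpha> > 0" using k' by (simp add: \<alpha>_def)
  ultimately show thesis using that by blast
qed

theorem mainTheorem8:
  fixes A :: "('m::t2_space, 'n::finite) chart set"
    and \<Phi> :: "real \<Rightarrow> real"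
    and g0 :: "('m, 'n) tensor"
    and \<Lambda> C k :: real
  assumes "compact_smooth_manifold A"
    and "smooth_on UNIV \<Phi>"
    and "\<And>u. \<Phi> u > 0"
    and "einstein_metric A \<Lambda> g0"
    and "\<And>u. u \<noteq> 0 \<Longrightarrow> \<Phi> u \<le> C * (1 + \<bar>u\<bar> powr (2 * k))"
    and "k < real CARD('n) / 8"
  shows "geodesically_incomplete A (G_scal A \<Phi>)"
proof -
  have comp: "compact (UNIV :: 'm set)" and atlas: "smooth_atlas A"
    using assms(1) by (auto simp: compact_smooth_manifold_def)
  have gM: "g0 \<in> Met A" using assms(4) by (simp add: einstein_metric_def)
  obtain \<alpha> K where \<alpha>: "\<alpha> > 0"
    and bound: "\<And>\<rho>. 0 < \<rho> \<Longrightarrow> \<rho> \<le> 1 \<Longrightarrow> sqrt (ray_density \<Phi> \<Lambda> CARD('n) \<rho>) \<le> K * \<rho> powr (\<alpha> - 1)"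
    using ray_density_bound[of \<Phi> C k "CARD('n)" \<Lambda>, OF assms(3,5,6)] by auto
  obtain I r L s where I: "open I" "is_interval I" and r: "smooth_on I r" "\<And>t. t \<in> I \<Longrightarrow> r t > 0"
    and ode: "\<And>t. t \<in> I \<Longrightarrow> (r has_real_derivative inverse (sqrt (ray_density \<Phi> \<Lambda> CARD('n) (r t)))) (at t)"
    and s: "\<And>k::nat. s k \<in> I" "s \<longlonglongrightarrow> L" "(\<lambda>k. r (s k)) \<longlonglongrightarrow> 0"
    using unit_speed_parametrisation[OF ray_density_smooth[OF assms(2)] ray_density_pos[OF assms(3)] \<alpha> bound]
    by metis
  have geo: "geodesic A (G_scal A \<Phi>) I (\<lambda>t. ray g0 (r t))"
    by (rule ray_geodesic[OF atlas comp assms(2,4) I r ode assms(3)]) auto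
  have "\<not> (\<exists>\<gamma>'. geodesic A (G_scal A \<Phi>) UNIV \<gamma>' \<and> (\<forall>t\<in>I. \<gamma>' t = ray g0 (r t)))"
  proof
    assume "\<exists>\<gamma>'. geodesic A (G_scal A \<Phi>) UNIV \<gamma>' \<and> (\<forall>t\<in>I. \<gamma>' t = ray g0 (r t))"
    then obtain \<gamma>' where fam: "smooth_family A UNIV \<gamma>'" and eq: "\<And>t. t \<in> I \<Longrightarrow> \<gamma>' t = ray g0 (r t)"
      by (auto simp: geodesic_def)
    \<comment> \<open>by continuity the extension takes the limit of \<open>r (s k) g0\<close> at the time \<open>L\<close>, and this limit is \<open>0\<close>\<close>
    fix p :: 'm
    let ?c = "chart_at A p"
    note c = chart_at[OF atlas, of p]
    define x where "x = coord ?c p"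
    have x: "x \<in> img_c ?c" using c by (simp add: x_def img_c_def)
    have px: "point ?c x = p" by (simp add: x_def point_coord[OF atlas c])
    have "continuous_on UNIV (\<lambda>t. loc (\<gamma>' t) ?c x)"
      using smooth_on_continuous[OF smooth_slice_fst[OF open_UNIV open_img[OF atlas c(1)] fam_smooth[OF atlas open_UNIV fam c(1)] x]] by simp
    then have "isCont (\<lambda>t. loc (\<gamma>' t) ?c x) L" by (simp add: continuous_on_eq_continuous_at)
    then have "(\<lambda>k. loc (\<gamma>' (s k)) ?c x) \<longlonglongrightarrow> loc (\<gamma>' L) ?c x"
      using s(2) by (rule isCont_tendsto_compose)
    moreover have "(\<lambda>k. loc (\<gamma>' (s k)) ?c x) = (\<lambda>k. r (s k) *\<^sub>R g0 ?c p)"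
      using eq[OF s(1)] by (simp add: ray_def px)
    moreover have "(\<lambda>k. r (s k) *\<^sub>R g0 ?c p) \<longlonglongrightarrow> 0 *\<^sub>R g0 ?c p"
      by (intro tendsto_scaleR s(3) tendsto_const)
    ultimately have "\<gamma>' L ?c p = 0" using LIMSEQ_unique by (fastforce simp: px)
    moreover have "pos_sym (\<gamma>' L ?c p)"
      by (rule Met_pos[OF atlas fam_Met[OF atlas open_UNIV fam] c]) simp
    ultimately show False using pos_sym_det[of "\<gamma>' L ?c p"] by (simp add: pos_sym_def) (metis axis_eq_0_iff zero_neq_one)
  qed
  moreover have "I \<noteq> {}" using s(1) by blast
  ultimately show ?thesis unfolding geodesically_incomplete_def using I geo by blast
qed

end
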